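(* Let $\lambda$ be a partition of $N$ and $H_T$ a connected component of $H_\lambda$. (1) For each vertex $(\tau,v)$ of $H_T$, $J_{v,\tau}\mathcal{S}$ is a scalar multiple of $J_{\lambda_T,\mathrm{std}(T)}\mathcal{S}$. (2) $J_{\lambda_T,\mathrm{std}(T)}\mathcal{S}\ne0$ if and only if $H_T$ is $1$-compatible. (3) If $H_T$ is $1$-compatible, then $J_T=\sum_{(\tau,v)\text{ vertex of }H_T}\mathcal{E}_{v,\tau}J_{v,\tau}$ is symmetric, i.e. $J_T(s_i\otimes s_i)=J_T$ for all $1\le i<N$.
   Context: Partitions in French convention (rows numbered bottom to top). An RST of shape $\lambda\vdash N$ is a bijective filling with $1,\dots,N$ strictly decreasing along rows (left to right) and columns (bottom to top); $\mathrm{CT}_\tau[i]=c-r$ if $i$ is in column $c$, row $r$; $\tau_\lambda$ fills the columns left to right, each bottom to top, with $N,\dots,1$. For $v\in\mathbb{N}^N$: $v^+$ decreasing rearrangement; $\sigma_v$ labels positions by $1,\dots,N$ in order of decreasing entries, ties left to right; $vs_i$ swaps entries $i,i+1$; $v\Psi=[v[2],\dots,v[N],v[1]+1]$. $\alpha$ indeterminate; $\zeta_{v,\tau}[i]=\alpha v[i]+\mathrm{CT}_\tau[\sigma_v[i]]$. Graph $G_\lambda$: vertices are pairs $(\tau,v)$ reachable from $(\tau_\lambda,0^N)$ plus $\varnothing$; from $(\tau,v)$: edge $\Psi$ to $(\tau,v\Psi)$; edge $s_i$ to $(\tau,vs_i)$ if $v[i]<v[i+1]$; if $v[i]=v[i+1]$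 and $\mathrm{CT}_\tau[\sigma_v[i]]-\mathrm{CT}_\tau[\sigma_v[i]+1]\ge2$, edge $s_i$ to $(\tau',v)$, $\tau'$ obtained by interchanging $\sigma_v[i],\sigma_v[i]+1$; if $v[i]=v[i+1]$ and this interchange is not an RST, edge $s_i$ to $\varnothing$. $H_\lambda$: remove from $G_\lambda$ the $\Psi$-edges, $\varnothing$ and edges into it. $T(\tau,v)$: replace each entry $i$ of $\tau$ by $v^+[i]$; the vertices $(\tau,v)$ with $T(\tau,v)=T$ form a connected component $H_T$. $H_T$ is $1$-compatible if $T$ is strictly increasing up each column. $\lambda_T\in\mathbb{N}^N$ is the decreasing arrangement of the entries of $T$. $\mathrm{std}(T)$ is the RST obtained from $T$ as follows: for each value $k$, with $n_j$ the number of entries of $T$ equal to $j$, the entries equal to $k$, read row by row from bottom to top and left to right in each row, are replaced successively by $N-\sum_{j<k}n_j,\ N-\sum_{j<k}n_j-1,\dots,N-\sum_{j\le k}n_j+1$. Coefficients $\mathcal{E}_{v,\tau}$ on vertices of $H_T$: $\mathcal{E}=1$ at the vertex with no incoming edge in $H_T$; if $H_T$ has an edge labeled $s_i$ from $(\tau',v')$ to $(\tau,v)$, then $\mathcal{E}_{v,\tau}=\frac{\zeta'[i]-\zeta'[i+1]}{\zeta'[i]-\zeta'[i+1]+1}\mathcal{E}_{v',\tau'}$ with $\zeta'=\zeta_{v',\tau'}$ (these rules define $\mathcal{E}$ consistently). $V_\lambda$: $\mathbb{Q}(\alpha)$-space with basis the RSTs of shape $\lambda$, right action: with $b=1/(\mathrm{CT}_\tau[i]-\mathrm{CT}_\tau[i+1])$,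 $\tau s_i=b\tau$ if $b=\pm1$; $b\tau+\tau^{(i,i+1)}$ if $0<b\le\frac12$; $b\tau+(1-b^2)\tau^{(i,i+1)}$ otherwise. $M_\lambda=\mathbb{Q}(\alpha)[x_1,\dots,x_N]\otimes V_\lambda$, operators on the right, $(f\otimes t)(\omega\otimes\omega)=(f\omega)\otimes(t\omega)$ where $f\omega$ permutes variables; $P\Psi=x_N\cdot(P(\theta\otimes\theta))$, $\theta=s_1\cdots s_{N-1}$. $\mathcal{S}=\sum_{\omega\in\mathfrak{S}_N}\omega\otimes\omega$. Polynomials $J_{v,\tau}$: $J_{0^N,\tau_\lambda}=1\otimes\tau_\lambda$ and along each edge from $(\tau,v)$: an $s_i$-edge to $w$ gives $J_w=J_{v,\tau}\big(s_i\otimes s_i+\frac1{\zeta_{v,\tau}[i+1]-\zeta_{v,\tau}[i]}\big)$, a $\Psi$-edge gives $J_{v\Psi,\tau}=J_{v,\tau}\Psi$ (path-independent; $J_\varnothing=0$). *)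

theory Defs
  imports
    "HOL-Library.Poly_Mapping"
    "HOL-Library.Multiset"
    "HOL-Computational_Algebra.Computational_Algebra"
    "HOL-Combinatorics.Permutations"
begin

section \<open>Partitions and tableaux\<close>

definition partition_of :: "nat list \<Rightarrow> nat \<Rightarrow> bool" where
  "partition_of lam N \<longleftrightarrow> sorted_wrt (\<ge>) lam \<and> (\<forall>x\<in>set lam. 0 < x) \<and> sum_list lam = N"

text \<open>A cell is a pair (row, column), both counted from 1; rows are numbered bottom to top.
  Fillings of a diagram are functions on all cells, with value 0 outside the diagram.\<close>

type_synonym tab = "nat \<times> nat \<Rightarrow> nat"

definition cells :: "nat list \<Rightarrow> (nat \<times> nat) set" where
  "cells lam = {(r, c). 1 \<le> r \<and> r \<le> length lam \<and> 1 \<le> c \<and> c \<le> lam ! (r - 1)}"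

definition is_rst :: "nat list \<Rightarrow> tab \<Rightarrow> bool" where
  "is_rst lam \<tau> \<longleftrightarrow>
     bij_betw \<tau> (cells lam) {1..sum_list lam} \<and>
     (\<forall>p. p \<notin> cells lam \<longrightarrow> \<tau> p = 0) \<and>
     (\<forall>r c c'. (r, c) \<in> cells lam \<and> (r, c') \<in> cells lam \<and> c < c' \<longrightarrow> \<tau> (r, c) > \<tau> (r, c')) \<and>
     (\<forall>r r' c. (r, c) \<in> cells lam \<and> (r', c) \<in> cells lam \<and> r < r' \<longrightarrow> \<tau> (r, c) > \<tau> (r', c))"

definition CT :: "tab \<Rightarrow> nat \<Rightarrow> int" where
  "CT \<tau> i = (case (THE p. \<tau> p = i) of (r, c) \<Rightarrow> int c - int r)"

definition tau_shape :: "nat list \<Rightarrow> tab" where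
  "tau_shape lam = (\<lambda>(r, c). if (r, c) \<in> cells lam
     then sum_list lam - card {(r', c') \<in> cells lam. c' < c \<or> (c' = c \<and> r' < r)}
     else 0)"

definition interchange :: "nat \<Rightarrow> tab \<Rightarrow> tab" where
  "interchange a \<tau> = transpose a (a + 1) \<circ> \<tau>"


section \<open>Vectors\<close>

text \<open>Elements of $\mathbb{N}^N$ are lists of length $N$; positions are counted from 1.\<close>

abbreviation entry :: "nat list \<Rightarrow> nat \<Rightarrow> nat" where
  "entry v i \<equiv> v ! (i - 1)"

definition vplus :: "nat list \<Rightarrow> nat list" where
  "vplus v = rev (sort v)"

definition sigma :: "nat list \<Rightarrow> nat \<Rightarrow> nat" where
  "sigma v i = card {j \<in> {1..length v}. entry v j > entry v i}
             + card {j \<in> {1..i}. entry v j = entry v i}"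

definition vswap :: "nat \<Rightarrow> nat list \<Rightarrow> nat list" where
  "vswap i v = v[i - 1 := entry v (i + 1), i := entry v i]"

definition vpsi :: "nat list \<Rightarrow> nat list" where
  "vpsi v = tl v @ [hd v + 1]"


section \<open>The ground field and spectral vectors\<close>

type_synonym qalpha = "rat poly fract"

definition rat_const :: "rat \<Rightarrow> qalpha" where
  "rat_const q = Fract [:q:] 1"

definition alpha :: qalpha where
  "alpha = Fract [:0, 1:] 1"

definition zeta :: "tab \<Rightarrow> nat list \<Rightarrow> nat \<Rightarrow> qalpha" where
  "zeta \<tau> v i = alpha * of_nat (entry v i) + of_int (CT \<tau> (sigma v i))"


section \<open>The graphs\<close>

text \<open>Vertices of the graph $G_\lambda$: \<open>None\<close> is the vertex $\varnothing$.\<close>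

type_synonym vertex = "tab \<times> nat list"

datatype label = Psi_edge | S_edge nat

inductive arrow :: "nat list \<Rightarrow> vertex option \<Rightarrow> label \<Rightarrow> vertex option \<Rightarrow> bool"
  for lam :: "nat list" where
  psi: "v \<noteq> [] \<Longrightarrow> arrow lam (Some (\<tau>, v)) Psi_edge (Some (\<tau>, vpsi v))"
| swap: "\<lbrakk>1 \<le> i; i < sum_list lam; entry v i < entry v (i + 1)\<rbrakk>
     \<Longrightarrow> arrow lam (Some (\<tau>, v)) (S_edge i) (Some (\<tau>, vswap i v))"
| inter: "\<lbrakk>1 \<le> i; i < sum_list lam; entry v i = entry v (i + 1);
       CT \<tau> (sigma v i) - CT \<tau> (sigma v i + 1) \<ge> 2\<rbrakk>
     \<Longrightarrow> arrow lam (Some (\<tau>, v)) (S_edge i) (Some (interchange (sigma v i) \<tau>, v))"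
| fall: "\<lbrakk>1 \<le> i; i < sum_list lam; entry v i = entry v (i + 1);
       \<not> is_rst lam (interchange (sigma v i) \<tau>)\<rbrakk>
     \<Longrightarrow> arrow lam (Some (\<tau>, v)) (S_edge i) None"

definition root_vertex :: "nat list \<Rightarrow> vertex" where
  "root_vertex lam = (tau_shape lam, replicate (sum_list lam) 0)"

inductive_set reachable :: "nat list \<Rightarrow> vertex option set" for lam :: "nat list" where
  root: "Some (root_vertex lam) \<in> reachable lam"
| step: "u \<in> reachable lam \<Longrightarrow> arrow lam u l w \<Longrightarrow> w \<in> reachable lam"

definition G_verts :: "nat list \<Rightarrow> vertex option set" where
  "G_verts lam = reachable lam \<union> {None}"

definition G_edge :: "nat list \<Rightarrow> vertex option \<Rightarrow> label \<Rightarrow> vertex option \<Rightarrow> bool" where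
  "G_edge lam u l w \<longleftrightarrow> u \<in> G_verts lam \<and> arrow lam u l w"

definition H_verts :: "nat list \<Rightarrow> vertex set" where
  "H_verts lam = {u. Some u \<in> G_verts lam}"

definition H_edge :: "nat list \<Rightarrow> vertex \<Rightarrow> nat \<Rightarrow> vertex \<Rightarrow> bool" where
  "H_edge lam u i w \<longleftrightarrow> G_edge lam (Some u) (S_edge i) (Some w)"

definition H_adj :: "nat list \<Rightarrow> (vertex \<times> vertex) set" where
  "H_adj lam = {(u, w). \<exists>i. H_edge lam u i w \<or> H_edge lam w i u}"

definition H_components :: "nat list \<Rightarrow> vertex set set" where
  "H_components lam = {(H_adj lam)\<^sup>* `` {u} | u. u \<in> H_verts lam}"


section \<open>The filling attached to a component\<close>

definition T_of :: "nat list \<Rightarrow> vertex \<Rightarrow> tab" where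
  "T_of lam = (\<lambda>(\<tau>, v) p. if p \<in> cells lam then entry (vplus v) (\<tau> p) else 0)"

definition one_compatible :: "nat list \<Rightarrow> tab \<Rightarrow> bool" where
  "one_compatible lam T \<longleftrightarrow>
     (\<forall>r r' c. (r, c) \<in> cells lam \<and> (r', c) \<in> cells lam \<and> r < r' \<longrightarrow> T (r, c) < T (r', c))"

definition lambda_T :: "nat list \<Rightarrow> tab \<Rightarrow> nat list" where
  "lambda_T lam T = rev (sorted_list_of_multiset (image_mset T (mset_set (cells lam))))"

definition std :: "nat list \<Rightarrow> tab \<Rightarrow> tab" where
  "std lam T = (\<lambda>(r, c). if (r, c) \<in> cells lam
     then sum_list lam - (\<Sum>j<T (r, c). card {q \<in> cells lam. T q = j})
        - card {(r', c') \<in> cells lam. T (r', c') = T (r, c) \<and> (r' < r \<or> (r' = r \<and> c' < c))}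
     else 0)"


section \<open>The coefficients on a component\<close>

text \<open>\<open>E_rel lam C u e\<close>: the value \<open>e\<close> is obtained at \<open>u\<close> by following some path inside the
  component \<open>C\<close> from a vertex without incoming edge.\<close>

inductive E_rel :: "nat list \<Rightarrow> vertex set \<Rightarrow> vertex \<Rightarrow> qalpha \<Rightarrow> bool"
  for lam :: "nat list" and C :: "vertex set" where
  source: "\<lbrakk>u \<in> C; \<not> (\<exists>u'\<in>C. \<exists>i. H_edge lam u' i u)\<rbrakk> \<Longrightarrow> E_rel lam C u 1"
| step: "\<lbrakk>E_rel lam C (\<tau>', v') e; w \<in> C; H_edge lam (\<tau>', v') i w\<rbrakk> \<Longrightarrow>
     E_rel lam C w
       ((zeta \<tau>' v' i - zeta \<tau>' v' (i + 1)) / (zeta \<tau>' v' i - zeta \<tau>' v' (i + 1) + 1) * e)"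

definition E_coeff :: "nat list \<Rightarrow> vertex set \<Rightarrow> vertex \<Rightarrow> qalpha" where
  "E_coeff lam C u = (THE e. E_rel lam C u e)"


section \<open>Vector-valued polynomials\<close>

type_synonym mpol = "(nat \<Rightarrow>\<^sub>0 nat) \<Rightarrow>\<^sub>0 qalpha"

text \<open>$V_\lambda$ is spanned by the basis vectors \<open>Poly_Mapping.single \<tau> 1\<close>, and $M_\lambda$
  is the free module over the polynomials on the same basis: the coefficient of an element
  at \<open>\<tau>\<close> is the polynomial tensored with \<open>\<tau>\<close>.\<close>

type_synonym tabvec = "tab \<Rightarrow>\<^sub>0 qalpha"
type_synonym tabpol = "tab \<Rightarrow>\<^sub>0 mpol"

definition pconst :: "qalpha \<Rightarrow> mpol" where
  "pconst c = Poly_Mapping.single 0 c"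

definition pvar :: "nat \<Rightarrow> mpol" where
  "pvar i = Poly_Mapping.single (Poly_Mapping.single i 1) 1"

definition pmul :: "mpol \<Rightarrow> tabpol \<Rightarrow> tabpol" where
  "pmul f P = Poly_Mapping.map (\<lambda>g. f * g) P"

definition smul :: "qalpha \<Rightarrow> tabpol \<Rightarrow> tabpol" where
  "smul c P = pmul (pconst c) P"

definition tensor :: "mpol \<Rightarrow> tabvec \<Rightarrow> tabpol" where
  "tensor f t = Poly_Mapping.map (\<lambda>c. pconst c * f) t"

definition pol_s :: "nat \<Rightarrow> mpol \<Rightarrow> mpol" where
  "pol_s i f = Poly_Mapping.map_key (Poly_Mapping.map_key (transpose i (i + 1))) f"

definition tab_s :: "nat \<Rightarrow> tab \<Rightarrow> tabvec" where
  "tab_s i \<tau> =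
     (let b = 1 / rat_of_int (CT \<tau> i - CT \<tau> (i + 1)) in
      if b = 1 \<or> b = -1 then Poly_Mapping.single \<tau> (rat_const b)
      else if 0 < b \<and> b \<le> 1 / 2
      then Poly_Mapping.single \<tau> (rat_const b) + Poly_Mapping.single (interchange i \<tau>) 1
      else Poly_Mapping.single \<tau> (rat_const b)
         + Poly_Mapping.single (interchange i \<tau>) (rat_const (1 - b\<^sup>2)))"

text \<open>The operator $s_i \otimes s_i$ acting from the right.\<close>

definition diag_s :: "nat \<Rightarrow> tabpol \<Rightarrow> tabpol" where
  "diag_s i P = (\<Sum>\<tau>\<in>Poly_Mapping.keys P. tensor (pol_s i (Poly_Mapping.lookup P \<tau>)) (tab_s i \<tau>))"

text \<open>The operator $\omega \otimes \omega$ for the product $\omega$ of the simple transpositions in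
  a word; since operators act from the right, the leftmost letter is applied first. The image
  of \<open>j\<close> under \<open>word_perm ws\<close> is correspondingly obtained by applying the leftmost letter first.\<close>

definition diag_word :: "nat list \<Rightarrow> tabpol \<Rightarrow> tabpol" where
  "diag_word ws P = fold diag_s ws P"

definition word_perm :: "nat list \<Rightarrow> nat \<Rightarrow> nat" where
  "word_perm ws = fold (\<lambda>i p. transpose i (i + 1) \<circ> p) ws id"

definition diag_perm :: "nat \<Rightarrow> (nat \<Rightarrow> nat) \<Rightarrow> tabpol \<Rightarrow> tabpol" where
  "diag_perm N w P = diag_word (SOME ws. set ws \<subseteq> {1..<N} \<and> word_perm ws = w) P"

definition Sym :: "nat \<Rightarrow> tabpol \<Rightarrow> tabpol" where
  "Sym N P = (\<Sum>w | w permutes {1..N}. diag_perm N w P)"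

definition Psi :: "nat \<Rightarrow> tabpol \<Rightarrow> tabpol" where
  "Psi N P = pmul (pvar N) (diag_word [1..<N] P)"


section \<open>The vector-valued Jack polynomials\<close>

text \<open>\<open>J_rel lam u P\<close>: the element \<open>P\<close> is obtained at \<open>u\<close> by following some path from the root.\<close>

inductive J_rel :: "nat list \<Rightarrow> vertex option \<Rightarrow> tabpol \<Rightarrow> bool" for lam :: "nat list" where
  root: "J_rel lam (Some (root_vertex lam)) (tensor 1 (Poly_Mapping.single (tau_shape lam) 1))"
| s_step: "\<lbrakk>J_rel lam (Some (\<tau>, v)) P; G_edge lam (Some (\<tau>, v)) (S_edge i) w\<rbrakk> \<Longrightarrow>
     J_rel lam w (diag_s i P + smul (1 / (zeta \<tau> v (i + 1) - zeta \<tau> v i)) P)"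
| psi_step: "\<lbrakk>J_rel lam (Some (\<tau>, v)) P; G_edge lam (Some (\<tau>, v)) Psi_edge w\<rbrakk> \<Longrightarrow>
     J_rel lam w (Psi (sum_list lam) P)"

definition Jack :: "nat list \<Rightarrow> vertex \<Rightarrow> tabpol" where
  "Jack lam u = (THE P. J_rel lam (Some u) P)"

definition Jack_T :: "nat list \<Rightarrow> vertex set \<Rightarrow> tabpol" where
  "Jack_T lam C = (\<Sum>u\<in>C. smul (E_coeff lam C u) (Jack lam u))"

end

theory Submission
  imports Defs
begin

text \<open>
  To a vertex attach the sequence of labels \<open>(v[i], CT(\<sigma>\<^sub>v[i]))\<close>; it determines the vertex. An edge \<open>s\<^sub>i\<close>
  exchanges the labels at \<open>i\<close> and \<open>i + 1\<close>, and the affine edge rotates the sequence. Any two edges entering a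
  vertex can be completed to a square, a hexagon or a double affine step, so the Yang--Baxter
  equation and the commutation of \<open>\<Psi>\<close> with the \<open>s\<^sub>i\<close> give path independence by descent; the same descent shows
  that an edge into the sink \<open>\<emptyset>\<close> annihilates the polynomial.

  An edge multiplies the symmetrization by a nonzero scalar, so all symmetrizations on a component are
  proportional. If two equal entries of \<open>T\<close> share a column, the source of the component
  contains them as consecutive entries, and its polynomial is antisymmetric under one \<open>s\<^sub>i\<close>.
  Otherwise the two ends of each edge contribute a multiple of \<open>J (1 + s\<^sub>i)\<close> to \<open>J\<^sub>T\<close>, which is therefore
  symmetric. Finally, \<open>J\<^sub>T\<close> does not vanish: only the vertices with \<open>v = \<lambda>\<^sub>T\<close> contribute to the monomial
  \<open>x\<close> to the power \<open>\<lambda>\<^sub>T\<close>, and the coefficients there are the images of distinct tableaux under one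
  invertible operator.
\<close>

text \<open>Three points shape the proof. \<open>Sym\<close> uses an arbitrarily chosen word for
  each permutation, so the word problem of the symmetric group has to be solved for the operators
  \<open>diag_s\<close>. Their braid relation rests on 1/d * 1/e = 1/(d+e) * (1/d + 1/e) and is
  secured only on the span of the reverse standard tableaux, where none of these axial distances is
  0. Next, \<open>Jack\<close> and \<open>E_coeff\<close> are definite descriptions, unusable before
  uniqueness. For \<open>E_coeff\<close> a closed product over inverted pairs of labels settles it.
  For \<open>Jack\<close> the delicate case is s_(N-1) against \<Psi>: there is no s_N to exchange
  it with, so \<Psi> must be undone twice. Finally, nonvanishing asks for an order on exponents that
  is respected by \<Psi> as well as by swaps, and for a leading operator shared by all tableaux at a
  given vector, so that induction there runs through v alone. As \<alpha> is transcendental,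
  spectral differences along edges are never 0, 1 or -1; hence the scalars attached to edges are
  defined and invertible.\<close>

abbreviation lookup :: "('a \<Rightarrow>\<^sub>0 'b::zero) \<Rightarrow> 'a \<Rightarrow> 'b" where
  "lookup \<equiv> Poly_Mapping.lookup"

abbreviation single :: "'a \<Rightarrow> 'b::zero \<Rightarrow> ('a \<Rightarrow>\<^sub>0 'b)" where
  "single \<equiv> Poly_Mapping.single"

section \<open>Additive maps on finitely supported functions\<close>

lemma poly_mapping_sum_single:
  fixes P :: "'a \<Rightarrow>\<^sub>0 'b::comm_monoid_add"
  assumes "finite A" "Poly_Mapping.keys P \<subseteq> A"
  shows "P = (\<Sum>k\<in>A. single k (lookup P k))"
proof (rule poly_mapping_eqI)
  fix k
  have "(\<Sum>x\<in>A. lookup (single x (lookup P x)) k) = (\<Sum>x\<in>A. if x = k then lookup P k else 0)"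
    by (rule sum.cong) (auto simp: lookup_single when_def)
  also have "\<dots> = lookup P k"
    using assms by (auto simp: sum.delta in_keys_iff)
  finally show "lookup P k = lookup (\<Sum>x\<in>A. single x (lookup P x)) k"
    by (simp add: lookup_sum)
qed

lemma additive_sum:
  fixes F :: "'b::comm_monoid_add \<Rightarrow> 'c::comm_monoid_add"
  assumes "F 0 = 0" "\<And>P Q. F (P + Q) = F P + F Q"
  shows "F (sum g A) = (\<Sum>a\<in>A. F (g a))"
  by (induction A rule: infinite_finite_induct) (auto simp: assms)

text \<open>Linearity arguments are reduced to one-term elements by this rule. Asking for agreement
  only at the keys of \<open>P\<close> lets an identity known just for reverse standard tableaux,
  such as the braid relation, be lifted to \<open>Mod\<close>.\<close>

lemma additive_eq_on_keys:
  fixes F G :: "('a \<Rightarrow>\<^sub>0 'b::comm_monoid_add) \<Rightarrow> 'c::comm_monoid_add"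
  assumes F: "F 0 = 0" "\<And>P Q. F (P + Q) = F P + F Q"
    and G: "G 0 = 0" "\<And>P Q. G (P + Q) = G P + G Q"
    and eq: "\<And>k x. k \<in> Poly_Mapping.keys P \<Longrightarrow> F (single k x) = G (single k x)"
  shows "F P = G P"
proof -
  have P: "P = (\<Sum>k\<in>Poly_Mapping.keys P. single k (lookup P k))"
    by (rule poly_mapping_sum_single) auto
  have "F P = (\<Sum>k\<in>Poly_Mapping.keys P. F (single k (lookup P k)))"
    using additive_sum[of F "\<lambda>k. single k (lookup P k)" "Poly_Mapping.keys P", OF F] P by simp
  also have "\<dots> = (\<Sum>k\<in>Poly_Mapping.keys P. G (single k (lookup P k)))"
    by (rule sum.cong) (auto simp: eq)
  also have "\<dots> = G P"
    using additive_sum[of G "\<lambda>k. single k (lookup P k)" "Poly_Mapping.keys P", OF G] P by simp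
  finally show ?thesis .
qed

section \<open>Scalars\<close>

lemma rat_const_add: "rat_const (a + b) = rat_const a + rat_const b"
  by (simp add: rat_const_def)

lemma rat_const_mult: "rat_const (a * b) = rat_const a * rat_const b"
  by (simp add: rat_const_def mult.commute)

lemma rat_const_0 [simp]: "rat_const 0 = 0"
  by (simp add: rat_const_def Zero_fract_def)

lemma rat_const_1 [simp]: "rat_const 1 = 1"
  by (simp add: rat_const_def One_fract_def pCons_one)

lemma rat_const_minus: "rat_const (- a) = - rat_const a"
  by (simp add: rat_const_def)

lemma rat_const_of_nat: "rat_const (of_nat n) = of_nat n"
  by (induction n) (auto simp: rat_const_add)

lemma rat_const_of_int: "rat_const (of_int n) = of_int n"
  by (cases n) (auto simp: rat_const_of_nat rat_const_minus simp del: of_nat_Suc)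

lemma rat_const_eq_0_iff [simp]: "rat_const a = 0 \<longleftrightarrow> a = 0"
  by (simp add: rat_const_def Zero_fract_def eq_fract)

lemma rat_const_divide: "rat_const (a / b) = rat_const a / rat_const b"
proof (cases "b = 0")
  case False
  then have "rat_const (a / b) * rat_const b = rat_const a"
    by (simp flip: rat_const_mult)
  then show ?thesis using False by (metis nonzero_eq_divide_eq rat_const_eq_0_iff)
qed auto

lemma of_int_qalpha_eq_0_iff [simp]: "(of_int n :: qalpha) = 0 \<longleftrightarrow> n = 0"
  by (metis of_int_eq_0_iff rat_const_eq_0_iff rat_const_of_int)

text \<open>\<alpha> is transcendental over the rationals; every nonvanishing of a spectral
  difference is drawn from this.\<close>

lemma alpha_lincomb_eq_0_iff: "alpha * of_int n + of_int m = 0 \<longleftrightarrow> n = 0 \<and> m = 0"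
proof -
  have "alpha * of_int n + of_int m = Fract [:of_int m, of_int n:] 1"
    unfolding rat_const_of_int[symmetric] alpha_def rat_const_def by simp
  also have "\<dots> = 0 \<longleftrightarrow> n = 0 \<and> m = 0"
    by (auto simp: Zero_fract_def eq_fract)
  finally show ?thesis .
qed

section \<open>The module structure\<close>

lemma pconst_0 [simp]: "pconst 0 = 0" by (simp add: pconst_def)
lemma pconst_1 [simp]: "pconst 1 = 1" by (simp add: pconst_def)
lemma pconst_add: "pconst (a + b) = pconst a + pconst b" by (simp add: pconst_def single_add)
lemma pconst_mult: "pconst (a * b) = pconst a * pconst b" by (simp add: pconst_def mult_single)

lemma lookup_pconst_mult [simp]: "lookup (pconst c * f) m = c * lookup f m"
  by (simp add: pconst_def flip: mult_map_scale_conv_mult) (simp add: map.rep_eq when_def)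

lemma lookup_pmul [simp]: "lookup (pmul f P) \<tau> = f * lookup P \<tau>"
  by (simp add: pmul_def map.rep_eq when_def)

lemma lookup_smul [simp]: "lookup (smul c P) \<tau> = pconst c * lookup P \<tau>"
  by (simp add: smul_def)

interpretation smul: vector_space smul
  by unfold_locales
    (auto intro!: poly_mapping_eqI simp: lookup_add algebra_simps pconst_add pconst_mult)

lemma smul_single: "smul c (single \<tau> f) = single \<tau> (pconst c * f)"
  by (auto intro!: poly_mapping_eqI simp: lookup_single when_def)

lemma pmul_add: "pmul f (P + Q) = pmul f P + pmul f Q"
  by (auto intro!: poly_mapping_eqI simp: lookup_add algebra_simps)

lemma pmul_0 [simp]: "pmul f 0 = 0"
  by (auto intro!: poly_mapping_eqI)

lemma pmul_single: "pmul f (single \<tau> g) = single \<tau> (f * g)"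
  by (auto intro!: poly_mapping_eqI simp: lookup_single when_def)

lemma pmul_pmul: "pmul f (pmul g P) = pmul (f * g) P"
  by (auto intro!: poly_mapping_eqI simp: algebra_simps)

lemma pmul_smul: "pmul f (smul c P) = smul c (pmul f P)"
  by (auto intro!: poly_mapping_eqI simp: algebra_simps)

section \<open>The action of a simple transposition\<close>

lemma inj_transpose [simp]: "inj (transpose a b)"
  by (rule bij_is_inj) simp

abbreviation mon_s :: "nat \<Rightarrow> (nat \<Rightarrow>\<^sub>0 nat) \<Rightarrow> (nat \<Rightarrow>\<^sub>0 nat)" where
  "mon_s i \<equiv> Poly_Mapping.map_key (transpose i (Suc i))"

lemma lookup_mon_s [simp]: "lookup (mon_s i m) k = lookup m (transpose i (Suc i) k)"
  by (simp add: map_key.rep_eq)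

lemma mon_s_mon_s [simp]: "mon_s i (mon_s i m) = m"
  by (auto intro!: poly_mapping_eqI)

lemma inj_mon_s [simp]: "inj (mon_s i)"
  by (metis injI mon_s_mon_s)

lemma lookup_pol_s [simp]: "lookup (pol_s i f) m = lookup f (mon_s i m)"
  by (simp add: pol_s_def map_key.rep_eq)

lemma pol_s_add: "pol_s i (f + g) = pol_s i f + pol_s i g"
  by (auto intro!: poly_mapping_eqI simp: lookup_add)

lemma pol_s_0 [simp]: "pol_s i 0 = 0"
  by (auto intro!: poly_mapping_eqI)

lemma pol_s_pconst_mult: "pol_s i (pconst c * f) = pconst c * pol_s i f"
  by (auto intro!: poly_mapping_eqI)

lemma pol_s_single: "pol_s i (single m c) = single (mon_s i m) c"
  by (auto intro!: poly_mapping_eqI simp: lookup_single when_def)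

lemma pol_s_mult: "pol_s i (f * g) = pol_s i f * pol_s i g"
proof (rule additive_eq_on_keys[where F = "\<lambda>f. pol_s i (f * g)" and G = "\<lambda>f. pol_s i f * pol_s i g"])
  fix m c
  show "pol_s i (single m c * g) = pol_s i (single m c) * pol_s i g"
    by (rule additive_eq_on_keys[where F = "\<lambda>g. pol_s i (single m c * g)"
          and G = "\<lambda>g. pol_s i (single m c) * pol_s i g"])
      (auto simp: pol_s_add algebra_simps mult_single pol_s_single map_key_plus)
qed (auto simp: pol_s_add algebra_simps)

lemma pol_s_1 [simp]: "pol_s i 1 = 1"
  by (simp add: pol_s_single flip: single_one)

lemma pol_s_pconst [simp]: "pol_s i (pconst c) = pconst c"
  by (metis mult.right_neutral pol_s_1 pol_s_pconst_mult)

lemma pol_s_pol_s [simp]: "pol_s i (pol_s i f) = f"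
  by (auto intro!: poly_mapping_eqI)

lemma pol_s_commute:
  assumes "Suc (Suc i) \<le> j"
  shows "pol_s i (pol_s j f) = pol_s j (pol_s i f)"
proof -
  have "mon_s j (mon_s i m) = mon_s i (mon_s j m)" for m
    using assms by (auto intro!: poly_mapping_eqI arg_cong[of _ _ "lookup m"] simp: transpose_def)
  then show ?thesis by (auto intro!: poly_mapping_eqI)
qed

lemma pol_s_braid: "pol_s i (pol_s (Suc i) (pol_s i f)) = pol_s (Suc i) (pol_s i (pol_s (Suc i) f))"
proof -
  have "mon_s i (mon_s (Suc i) (mon_s i m)) = mon_s (Suc i) (mon_s i (mon_s (Suc i) m))" for m
    by (auto intro!: poly_mapping_eqI arg_cong[of _ _ "lookup m"] simp: transpose_def)
  then show ?thesis by (auto intro!: poly_mapping_eqI)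
qed

section \<open>Young's seminormal form\<close>

lemma CT_interchange: "CT (interchange i \<tau>) k = CT \<tau> (transpose i (Suc i) k)"
proof -
  have "transpose i (Suc i) (\<tau> p) = k \<longleftrightarrow> \<tau> p = transpose i (Suc i) k" for p
    by (metis transpose_involutory)
  then show ?thesis by (simp add: CT_def interchange_def)
qed

lemma interchange_interchange [simp]: "interchange i (interchange i \<tau>) = \<tau>"
  by (auto simp: interchange_def fun_eq_iff)

text \<open>Off-diagonal entry of Young's seminormal form for axial distance \<open>d\<close>.\<close>

definition seminormal :: "int \<Rightarrow> qalpha" where
  "seminormal d = (if d = 1 \<or> d = -1 then 0 else if 2 \<le> d then 1 else 1 - (1 / of_int d)\<^sup>2)"

text \<open>For an absolute value of at least 2 one of the two factors is 1; for absolute value 1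
  both sides vanish; at 0 the convention 1/0 = 0 makes both sides 1. Hence \<open>diag_s i\<close>
  is an involution on arbitrary fillings.\<close>

lemma seminormal_mult_uminus: "seminormal d * seminormal (- d) = 1 - (1 / of_int d)\<^sup>2"
  by (auto simp: seminormal_def)

definition axial :: "nat \<Rightarrow> tab \<Rightarrow> int" where
  "axial i \<tau> = CT \<tau> i - CT \<tau> (Suc i)"

lemma axial_interchange:
  "axial i (interchange i \<tau>) = - axial i \<tau>"
  "axial (Suc i) (interchange i \<tau>) = axial i \<tau> + axial (Suc i) \<tau>"
  "axial i (interchange (Suc i) \<tau>) = axial i \<tau> + axial (Suc i) \<tau>"
  by (auto simp: axial_def CT_interchange transpose_def)

lemma axial_interchange_far:
  "Suc (Suc i) \<le> j \<Longrightarrow> axial i (interchange j \<tau>) = axial i \<tau>"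
  "Suc (Suc i) \<le> j \<Longrightarrow> axial j (interchange i \<tau>) = axial j \<tau>"
  by (auto simp: axial_def CT_interchange transpose_def)

text \<open>The case split on the rational b becomes one on the integer
  \<open>axial i \<tau>\<close>; the branches b = 1 and b = -1 are absorbed because the off-diagonal
  entry is then 0. Distance 0 gives b = 0 and falls under the last branch.\<close>

lemma tab_s_eq:
  "tab_s i \<tau> = single \<tau> (1 / of_int (axial i \<tau>)) + single (interchange i \<tau>) (seminormal (axial i \<tau>))"
proof -
  let ?d = "axial i \<tau>"
  define b where "b = 1 / rat_of_int ?d"
  have rb: "rat_const b = 1 / of_int ?d"
    by (simp add: b_def rat_const_divide rat_const_of_int)
  have rb2: "rat_const (1 - b\<^sup>2) = 1 - (1 / of_int ?d)\<^sup>2"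
  proof -
    have "rat_const (1 - b\<^sup>2) = rat_const (1 + - (b * b))" by (simp add: power2_eq_square)
    also have "\<dots> = 1 - rat_const b * rat_const b"
      by (simp only: rat_const_add rat_const_minus rat_const_mult rat_const_1 diff_conv_add_uminus)
    finally show ?thesis by (simp add: rb power2_eq_square)
  qed
  have b1: "b = 1 \<longleftrightarrow> ?d = 1"
    unfolding b_def by (cases "?d = 0") (auto simp: field_simps)
  have b2: "b = -1 \<longleftrightarrow> ?d = -1"
    unfolding b_def by (auto simp: divide_eq_minus_1_iff)
  have b3: "0 < b \<and> b \<le> 1 / 2 \<longleftrightarrow> 2 \<le> ?d"
  proof
    assume h: "0 < b \<and> b \<le> 1 / 2"
    then have "0 < ?d" by (simp add: b_def)
    with h show "2 \<le> ?d" by (auto simp: b_def divide_le_eq le_divide_eq)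
  qed (auto simp: b_def divide_le_eq le_divide_eq)
  show ?thesis
    unfolding tab_s_def Let_def Suc_eq_plus1[symmetric] axial_def[symmetric] b_def[symmetric] b1 b2 b3 rb rb2
    by (auto simp: seminormal_def)
qed

lemma lookup_tensor [simp]: "lookup (tensor f t) \<tau> = pconst (lookup t \<tau>) * f"
  by (simp add: tensor_def map.rep_eq when_def)

lemma diag_s_superset:
  assumes "finite A" "Poly_Mapping.keys P \<subseteq> A"
  shows "diag_s i P = (\<Sum>\<tau>\<in>A. tensor (pol_s i (lookup P \<tau>)) (tab_s i \<tau>))"
proof -
  have "tensor 0 t = 0" for t by (auto intro!: poly_mapping_eqI)
  then show ?thesis
    unfolding diag_s_def using assms
    by (intro sum.mono_neutral_left) (auto simp: in_keys_iff)
qed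

lemma diag_s_0 [simp]: "diag_s i 0 = 0"
  by (simp add: diag_s_def)

lemma diag_s_add: "diag_s i (P + Q) = diag_s i P + diag_s i Q"
proof -
  let ?A = "Poly_Mapping.keys P \<union> Poly_Mapping.keys Q"
  have "tensor (pol_s i (f + g)) t = tensor (pol_s i f) t + tensor (pol_s i g) t" for f g t
    by (auto intro!: poly_mapping_eqI simp: lookup_add pol_s_add algebra_simps)
  then show ?thesis
    using keys_add[of P Q]
    by (simp add: diag_s_superset[of ?A] sum.distrib lookup_add)
qed

lemma diag_s_single:
  "diag_s i (single \<tau> f) = smul (1 / of_int (axial i \<tau>)) (single \<tau> (pol_s i f))
    + smul (seminormal (axial i \<tau>)) (single (interchange i \<tau>) (pol_s i f))"
proof -
  have "diag_s i (single \<tau> f) = tensor (pol_s i f) (tab_s i \<tau>)"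
    by (subst diag_s_superset[of "{\<tau>}"]) auto
  then show ?thesis
    by (auto intro!: poly_mapping_eqI
        simp: tab_s_eq lookup_add lookup_single when_def pconst_add distrib_right)
qed

lemma diag_s_pmul: "diag_s i (pmul f P) = pmul (pol_s i f) (diag_s i P)"
  by (rule additive_eq_on_keys[where F = "\<lambda>P. diag_s i (pmul f P)" and G = "\<lambda>P. pmul (pol_s i f) (diag_s i P)"])
    (auto simp: pmul_add diag_s_add pmul_single diag_s_single pol_s_mult smul_single algebra_simps)

lemma diag_s_smul: "diag_s i (smul c P) = smul c (diag_s i P)"
  by (simp add: smul_def diag_s_pmul)

lemma diag_s_sum: "diag_s i (sum g A) = (\<Sum>a\<in>A. diag_s i (g a))"
  by (rule additive_sum) (auto simp: diag_s_add)

lemma diag_s_diag_s_single: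
  "diag_s i (diag_s i (single \<tau> f)) = single \<tau> f"
proof -
  let ?b = "1 / of_int (axial i \<tau>)" and ?w = "seminormal (axial i \<tau>)"
  let ?X = "single \<tau> f" and ?Y = "single (interchange i \<tau>) f"
  have "diag_s i (diag_s i (single \<tau> f)) =
      smul (?b * ?b + ?w * seminormal (- axial i \<tau>)) ?X + smul (?b * ?w + ?w * (1 / of_int (- axial i \<tau>))) ?Y"
    unfolding diag_s_single diag_s_add diag_s_smul axial_interchange pol_s_pol_s
      smul.scale_left_distrib smul.scale_right_distrib smul.scale_scale interchange_interchange
    by (simp only: ac_simps)
  also have "\<dots> = single \<tau> f"
    by (simp add: seminormal_mult_uminus power2_eq_square)
  finally show ?thesis .
qed

lemma diag_s_diag_s [simp]: "diag_s i (diag_s i P) = P"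
  by (rule additive_eq_on_keys[where F = "\<lambda>P. diag_s i (diag_s i P)" and G = "\<lambda>P. P"])
    (auto simp: diag_s_add diag_s_diag_s_single)

lemma diag_s_commute:
  assumes "Suc (Suc i) \<le> j"
  shows "diag_s i (diag_s j P) = diag_s j (diag_s i P)"
proof (rule additive_eq_on_keys[where F = "\<lambda>P. diag_s i (diag_s j P)" and G = "\<lambda>P. diag_s j (diag_s i P)"])
  fix \<tau> f
  have 1: "interchange i (interchange j \<tau>) = interchange j (interchange i \<tau>)"
    using assms by (auto simp: interchange_def fun_eq_iff transpose_def)
  show "diag_s i (diag_s j (single \<tau> f)) = diag_s j (diag_s i (single \<tau> f))"
    unfolding diag_s_single diag_s_add diag_s_smul 1 axial_interchange_far[OF assms]
      pol_s_commute[OF assms] smul.scale_right_distrib smul.scale_scale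
    by (simp only: ac_simps)
qed (auto simp: diag_s_add)

text \<open>With x and y the differences of three successive parameters, this one identity feeds
  both the braid relation of the seminormal form and the hypothesis of
  \<open>yang_baxter\<close>.\<close>

lemma inverse_sum_identity:
  fixes x y :: "'a::field"
  assumes "x \<noteq> 0" "y \<noteq> 0" "x + y \<noteq> 0"
  shows "1 / x * (1 / y) = 1 / (x + y) * (1 / x + 1 / y)"
  using assms by (simp add: field_simps)

text \<open>Write d and e for the distances at i and i+1; after an interchange the distance d+e
  appears as well, and the three hypotheses keep all denominators away from 0. Both sides expand
  over the tableaux obtained by permuting three consecutive entries.\<close>

lemma diag_s_braid_single:
  assumes "axial i \<tau> \<noteq> 0" "axial (Suc i) \<tau> \<noteq> 0" "axial i \<tau> + axial (Suc i) \<tau> \<noteq> 0"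
  shows "diag_s i (diag_s (Suc i) (diag_s i (single \<tau> f))) =
    diag_s (Suc i) (diag_s i (diag_s (Suc i) (single \<tau> f)))"
proof -
  define d where "d = axial i \<tau>"
  define e where "e = axial (Suc i) \<tau>"
  let ?g = "pol_s (Suc i) (pol_s i (pol_s (Suc i) f))"
  let ?S = "\<lambda>w. single (foldr interchange w \<tau>) ?g"
  define b where "b d = 1 / (of_int d :: qalpha)" for d
  have bm: "b (- d) = - b d" for d by (simp add: b_def)
  have w: "b d * b e = b (d + e) * (b d + b e)"
    unfolding b_def of_int_add using assms d_def e_def
    by (intro inverse_sum_identity) (auto simp flip: of_int_add)
  have c: "interchange (Suc i) (interchange i (interchange (Suc i) \<tau>))
      = interchange i (interchange (Suc i) (interchange i \<tau>))"
    by (auto simp: interchange_def fun_eq_iff transpose_def)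
  note exp = diag_s_single diag_s_add diag_s_smul axial_interchange d_def[symmetric] e_def[symmetric]
      pol_s_braid[unfolded Suc_eq_plus1[symmetric]] smul.scale_right_distrib smul.scale_scale
      interchange_interchange b_def[symmetric]
  \<comment> \<open>The words index the tableaux, rightmost letter applied first. The coefficients
    at the empty word and at the two one-letter words need the identity \<open>w\<close>; the other
    three agree up to commutativity.\<close>
  have L: "diag_s i (diag_s (Suc i) (diag_s i (single \<tau> f))) =
      smul (b d * b e * b d + seminormal d * b (d + e) * seminormal (- d)) (?S [])
    + smul (b d * b e * seminormal d + seminormal d * b (d + e) * b (- d)) (?S [i])
    + smul (b d * seminormal e * b (d + e)) (?S [Suc i])
    + smul (b d * seminormal e * seminormal (d + e)) (?S [i, Suc i])
    + smul (seminormal d * seminormal (d + e) * b e) (?S [Suc i, i])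
    + smul (seminormal d * seminormal (d + e) * seminormal e) (?S [i, Suc i, i])"
    unfolding exp by (simp add: algebra_simps smul.scale_left_distrib)
  have R: "diag_s (Suc i) (diag_s i (diag_s (Suc i) (single \<tau> f))) =
      smul (b e * b d * b e + seminormal e * b (d + e) * seminormal (- e)) (?S [])
    + smul (b e * b d * seminormal e + seminormal e * b (d + e) * b (- e)) (?S [Suc i])
    + smul (b e * seminormal d * b (d + e)) (?S [i])
    + smul (b e * seminormal d * seminormal (d + e)) (?S [Suc i, i])
    + smul (seminormal e * seminormal (d + e) * b d) (?S [i, Suc i])
    + smul (seminormal e * seminormal (d + e) * seminormal d) (?S [i, Suc i, i])"
    unfolding exp by (simp add: algebra_simps smul.scale_left_distrib c)
  have ww: "seminormal d * seminormal (- d) = 1 - b d * b d" for d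
    by (simp add: seminormal_mult_uminus b_def power2_eq_square)
  have e1: "b d * b e * b d + seminormal d * b (d + e) * seminormal (- d)
      = b e * b d * b e + seminormal e * b (d + e) * seminormal (- e)"
    using ww[of d] ww[of e] w by algebra
  have e2: "b d * b e * seminormal d + seminormal d * b (d + e) * b (- d) = b e * seminormal d * b (d + e)"
    unfolding bm using w by algebra
  have e3: "b e * b d * seminormal e + seminormal e * b (d + e) * b (- e) = b d * seminormal e * b (d + e)"
    unfolding bm using w by algebra
  show ?thesis
    unfolding L R e1 e2 e3 by (simp add: algebra_simps)
qed

section \<open>Words in the simple transpositions\<close>

lemma word_perm_Nil [simp]: "word_perm [] = id"
  by (simp add: word_perm_def)

lemma word_perm_append: "word_perm (us @ vs) = word_perm vs \<circ> word_perm us"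
proof -
  have "fold (\<lambda>i p. transpose i (i + 1) \<circ> p) vs q = fold (\<lambda>i p. transpose i (i + 1) \<circ> p) vs id \<circ> q" for q
  proof (induction vs rule: rev_induct)
    case (snoc i vs)
    then show ?case by (simp add: o_assoc)
  qed auto
  then show ?thesis by (simp add: word_perm_def)
qed

lemma word_perm_single [simp]: "word_perm [i] = transpose i (Suc i)"
  by (simp add: word_perm_def)

lemma word_perm_Cons: "word_perm (i # vs) = word_perm vs \<circ> transpose i (Suc i)"
  using word_perm_append[of "[i]" vs] by simp

lemma word_perm_permutes: "set ws \<subseteq> {1..<N} \<Longrightarrow> word_perm ws permutes {1..N}"
proof (induction ws)
  case (Cons i ws)
  then have "transpose i (Suc i) permutes {1..N}" by (intro permutes_swap_id) auto
  moreover have "word_perm ws permutes {1..N}" using Cons by auto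
  ultimately show ?case unfolding word_perm_Cons by (rule permutes_compose)
qed (auto simp: permutes_id)

lemma inj_word_perm: "inj (word_perm ws)"
proof (induction ws)
  case (Cons i ws)
  then show ?case unfolding word_perm_Cons by (intro inj_compose) auto
qed simp

lemma word_perm_fixes: "set ws \<subseteq> {1..<n} \<Longrightarrow> n < k \<Longrightarrow> word_perm ws k = k"
  using word_perm_permutes[of ws n] by (auto simp: permutes_def)

text \<open>For \<open>1 \<le> k \<le> n + 1\<close> these words represent the cosets of the symmetric group on \<open>n\<close> letters
  in that on \<open>n + 1\<close> letters.\<close>

definition descent_word :: "nat \<Rightarrow> nat \<Rightarrow> nat list" where
  "descent_word n k = rev [k..<Suc n]"

lemma descent_word_snoc: "k \<le> n \<Longrightarrow> descent_word n k = descent_word n (Suc k) @ [k]"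
  by (simp add: descent_word_def upt_rec[of k])

lemma descent_word_empty [simp]: "descent_word n (Suc n) = []"
  by (simp add: descent_word_def)

text \<open>Evaluating at n+1 recovers k, hence the coset, from the permutation;
  \<open>word_perm_surj\<close> and the uniqueness of normal forms both use this.\<close>

lemma word_perm_descent: "k \<le> Suc n \<Longrightarrow> word_perm (descent_word n k) (Suc n) = k"
proof (induction k rule: inc_induct)
  case (step k)
  then have "descent_word n k = descent_word n (Suc k) @ [k]" by (intro descent_word_snoc) auto
  with step show ?case by (simp add: word_perm_append)
qed simp

lemma set_descent_word: "set (descent_word n k) = {k..n}"
  by (auto simp: descent_word_def)

text \<open>Dividing w by the coset word for w(n+1) leaves a permutation that fixes n+1.\<close>

lemma word_perm_surj:
  "w permutes {1..N} \<Longrightarrow> \<exists>ws. set ws \<subseteq> {1..<N} \<and> word_perm ws = w"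
proof (induction N arbitrary: w)
  case 0
  then show ?case by (intro exI[of _ "[]"]) auto
next
  case (Suc n)
  define k where "k = w (Suc n)"
  have k: "1 \<le> k" "k \<le> Suc n"
    using permutes_in_image[OF Suc.prems, of "Suc n"] by (auto simp: k_def)
  let ?d = "descent_word n k"
  have dp: "word_perm ?d permutes {1..Suc n}"
    using k by (intro word_perm_permutes) (auto simp: set_descent_word)
  define w' where "w' = inv (word_perm ?d) \<circ> w"
  have w'p: "w' permutes {1..Suc n}"
    unfolding w'_def using Suc.prems dp by (intro permutes_compose permutes_inv)
  have fix1: "w' (Suc n) = Suc n"
    using word_perm_descent[OF k(2)] permutes_inj[OF dp]
    by (simp add: w'_def k_def[symmetric] inv_f_eq)
  have "w' permutes {1..n}"
    unfolding permutes_def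
  proof (intro conjI allI impI)
    fix x assume "x \<notin> {1..n}"
    then show "w' x = x"
      using fix1 w'p by (cases "x = Suc n") (auto simp: permutes_def)
  next
    fix y show "\<exists>!x. w' x = y" using w'p by (simp add: permutes_def)
  qed
  from Suc.IH[OF this] obtain ws where ws: "set ws \<subseteq> {1..<n}" "word_perm ws = w'" by auto
  have "word_perm (ws @ ?d) = w"
    using ws permutes_surj[OF dp] by (simp add: word_perm_append w'_def o_assoc surj_iff)
  moreover have "set (ws @ ?d) \<subseteq> {1..<Suc n}"
    using ws k by (auto simp: set_descent_word)
  ultimately show ?case by blast
qed

text \<open>There are two instances: \<open>diag_s\<close> on \<open>Mod\<close>, and composition
  with transpositions on functions. Through the second one the rewriting of words is justified for
  permutations by the very lemmas that justify it for operators. The carrier \<open>M\<close> is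
  there because the braid relation is available only on an invariant subset.\<close>

locale coxeter_action =
  fixes N :: nat and S :: "nat \<Rightarrow> 'm \<Rightarrow> 'm" and M :: "'m set"
  assumes closed: "P \<in> M \<Longrightarrow> 0 < i \<Longrightarrow> i < N \<Longrightarrow> S i P \<in> M"
    and quad: "P \<in> M \<Longrightarrow> 0 < i \<Longrightarrow> i < N \<Longrightarrow> S i (S i P) = P"
    and far: "P \<in> M \<Longrightarrow> 0 < i \<Longrightarrow> Suc (Suc i) \<le> j \<Longrightarrow> j < N \<Longrightarrow> S i (S j P) = S j (S i P)"
    and braid: "P \<in> M \<Longrightarrow> 0 < i \<Longrightarrow> Suc i < N \<Longrightarrow>
      S i (S (Suc i) (S i P)) = S (Suc i) (S i (S (Suc i) P))"
begin

lemma closed_word: "P \<in> M \<Longrightarrow> set ws \<subseteq> {1..<N} \<Longrightarrow> fold S ws P \<in> M"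
  by (induction ws arbitrary: P) (auto simp: closed Suc_le_eq)

lemma fold_commute_letter:
  assumes "P \<in> M" "set ws \<subseteq> {1..<N}" "1 \<le> j" "j < N"
    and "\<And>i. i \<in> set ws \<Longrightarrow> Suc (Suc i) \<le> j \<or> Suc (Suc j) \<le> i"
  shows "fold S ws (S j P) = S j (fold S ws P)"
  using assms
proof (induction ws arbitrary: P)
  case (Cons i ws)
  have "Suc (Suc i) \<le> j \<or> Suc (Suc j) \<le> i" using Cons.prems by auto
  then have "S i (S j P) = S j (S i P)" using far[of P i j] far[of P j i] Cons.prems by (elim disjE) (auto simp: Suc_le_eq)
  then show ?case using Cons closed by (auto simp: Suc_le_eq)
qed auto

text \<open>s_j commutes with the tail below j-1; one braid relation on the letters j, j-1 turns it
  into s_(j-1), which commutes with the head above j.\<close>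

lemma descent_word_shift:
  assumes "P \<in> M" "n < N" "1 \<le> k" "k < j" "j \<le> n"
  shows "S j (fold S (descent_word n k) P) = fold S (descent_word n k) (S (j - 1) P)"
proof -
  obtain i where j: "j = Suc i" using assms by (cases j) auto
  have "descent_word n k = descent_word n (Suc j) @ [j, i] @ descent_word (i - 1) k"
  proof -
    have "[k..<Suc n] = [k..<i] @ [i..<Suc n]" using assms j upt_add_eq_append[of k i "Suc n - i"] by simp
    moreover have "[i..<Suc n] = i # j # [Suc j..<Suc n]" using assms j by (simp add: upt_rec)
    moreover have "Suc (i - 1) = i" using assms j by simp
    ultimately show ?thesis by (simp add: descent_word_def)
  qed
  note dw = this
  let ?A = "descent_word n (Suc j)" and ?B = "descent_word (i - 1) k"
  have sets: "set ?A \<subseteq> {1..<N}" "set ?B \<subseteq> {1..<N}"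
    using assms j by (auto simp: set_descent_word)
  let ?Q = "fold S ?A P"
  have Q: "?Q \<in> M" using assms sets closed_word by blast
  have SSQ: "S i (S j ?Q) \<in> M" using Q assms j by (auto intro!: closed)
  have "S j (fold S (descent_word n k) P) = S j (fold S ?B (S i (S j ?Q)))"
    by (simp add: dw)
  also have "\<dots> = fold S ?B (S j (S i (S j ?Q)))"
    using SSQ assms j sets by (intro fold_commute_letter[symmetric]) (auto simp: set_descent_word)
  also have "S j (S i (S j ?Q)) = S i (S j (S i ?Q))"
    using braid[of ?Q i] Q assms j by auto
  also have "S i ?Q = fold S ?A (S i P)"
    using assms j sets by (intro fold_commute_letter[symmetric]) (auto simp: set_descent_word)
  finally show ?thesis by (simp add: dw j)
qed

text \<open>Only the Coxeter relations are used, so the same rewriting is valid for the permutation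
  and for the operators; the conjunction records this parallel.\<close>

lemma word_normal_form:
  assumes "n < N" "set ws \<subseteq> {1..<Suc n}"
  shows "\<exists>us k. set us \<subseteq> {1..<n} \<and> 1 \<le> k \<and> k \<le> Suc n \<and>
    word_perm ws = word_perm (us @ descent_word n k) \<and>
    (\<forall>P\<in>M. fold S ws P = fold S (us @ descent_word n k) P)"
  using assms(2)
proof (induction ws rule: rev_induct)
  case Nil
  then show ?case by (intro exI[of _ "[]"] exI[of _ "Suc n"]) auto
next
  case (snoc j ws)
  then obtain us k where us: "set us \<subseteq> {1..<n}" "1 \<le> k" "k \<le> Suc n"
      "word_perm ws = word_perm (us @ descent_word n k)"
      "\<And>P. P \<in> M \<Longrightarrow> fold S ws P = fold S (us @ descent_word n k) P"
    by auto
  have j: "1 \<le> j" "j \<le> n" using snoc.prems by auto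
  have usM: "fold S us P \<in> M" if "P \<in> M" for P
    using that us(1) assms(1) by (intro closed_word) auto
  have wp: "word_perm (ws @ [j]) = word_perm (us @ descent_word n k @ [j])"
    using us(4) by (simp add: word_perm_append o_assoc)
  interpret tr: coxeter_action N "\<lambda>i. (\<circ>) (transpose i (Suc i))" "UNIV :: (nat \<Rightarrow> nat) set"
    by unfold_locales (auto simp: fun_eq_iff transpose_def)
  have wpf: "word_perm ws = fold (\<lambda>i. (\<circ>) (transpose i (Suc i))) ws id" for ws
    by (simp add: word_perm_def)
  \<comment> \<open>The new letter j meets a descending word that ends in k. Far below k it commutes
    past the whole word, at k-1 it lengthens the word, at k it cancels the last letter, and above k
    it slides through as j-1.\<close>
  consider "j < k - 1" | "j = k - 1" | "j = k" | "k < j" by linarith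
  then show ?case
  proof cases
    case 1
    have comm: "transpose j (Suc j) \<circ> word_perm (us @ descent_word n k)
        = word_perm ((us @ [j]) @ descent_word n k)"
    proof -
      have "fold (\<lambda>i. (\<circ>) (transpose i (Suc i))) (descent_word n k) (transpose j (Suc j) \<circ> Q)
          = transpose j (Suc j) \<circ> fold (\<lambda>i. (\<circ>) (transpose i (Suc i))) (descent_word n k) Q" for Q :: "nat \<Rightarrow> nat"
        using us 1 j assms(1) by (intro tr.fold_commute_letter) (auto simp: set_descent_word)
      then show ?thesis unfolding wpf by simp
    qed
    show ?thesis
    proof (intro exI[of _ "us @ [j]"] exI[of _ k] conjI ballI)
      show "word_perm (ws @ [j]) = word_perm ((us @ [j]) @ descent_word n k)"
        using comm us(4) by (simp add: word_perm_append[of ws])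
      fix P assume "P \<in> M"
      moreover have "fold S (descent_word n k) (S j (fold S us P)) = S j (fold S (descent_word n k) (fold S us P))"
        using us usM[OF \<open>P \<in> M\<close>] 1 j assms(1) by (intro fold_commute_letter) (auto simp: set_descent_word)
      ultimately show "fold S (ws @ [j]) P = fold S ((us @ [j]) @ descent_word n k) P"
        using us(5) by simp
    qed (use us 1 j in auto)
  next
    case 2
    then have "descent_word n j = descent_word n k @ [j]"
      using j us descent_word_snoc[of j n] by simp
    then show ?thesis using us j
      by (intro exI[of _ us] exI[of _ j]) (auto simp: wp)
  next
    case 3
    then have dw: "descent_word n k = descent_word n (Suc k) @ [k]"
      using j descent_word_snoc by simp
    show ?thesis
    proof (intro exI[of _ us] exI[of _ "Suc k"] conjI ballI)
      show "word_perm (ws @ [j]) = word_perm (us @ descent_word n (Suc k))"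
        unfolding wp unfolding dw 3 by (simp add: word_perm_append word_perm_Cons o_assoc)
      fix P assume "P \<in> M"
      moreover from this have "fold S (descent_word n (Suc k)) (fold S us P) \<in> M"
        using assms(1) by (intro closed_word[OF usM]) (auto simp: set_descent_word)
      ultimately show "fold S (ws @ [j]) P = fold S (us @ descent_word n (Suc k)) P"
        using us 3 j assms(1) by (simp add: dw quad)
    qed (use us 3 j in auto)
  next
    case 4
    show ?thesis
    proof (intro exI[of _ "us @ [j - 1]"] exI[of _ k] conjI ballI)
      show "word_perm (ws @ [j]) = word_perm ((us @ [j - 1]) @ descent_word n k)"
        unfolding wp unfolding wpf using tr.descent_word_shift[of _ n k j] us 4 j assms(1) by simp
      fix P assume "P \<in> M"
      then show "fold S (ws @ [j]) P = fold S ((us @ [j - 1]) @ descent_word n k) P"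
        using us usM 4 j assms(1) descent_word_shift by simp
    qed (use us 4 j in auto)
  qed
qed

text \<open>This solves the word problem. In normal form the images of n+1 force equal coset words,
  these cancel by injectivity, and the remaining words use fewer letters.\<close>

theorem fold_eq_of_word_perm_eq:
  assumes "set us \<subseteq> {1..<N}" "set vs \<subseteq> {1..<N}" "word_perm us = word_perm vs" "P \<in> M"
  shows "fold S us P = fold S vs P"
proof -
  have "set us \<subseteq> {1..<n} \<Longrightarrow> set vs \<subseteq> {1..<n} \<Longrightarrow> word_perm us = word_perm vs \<Longrightarrow> fold S us P = fold S vs P"
    if "n \<le> N" for n
    using that
  proof (induction n arbitrary: us vs)
    case (Suc n)
    have n: "n < N" using Suc.prems by simp
    obtain us' k where us': "set us' \<subseteq> {1..<n}" "1 \<le> k" "k \<le> Suc n"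
        "word_perm us = word_perm (us' @ descent_word n k)" "fold S us P = fold S (us' @ descent_word n k) P"
      using word_normal_form[OF n Suc.prems(1)] assms(4) by blast
    obtain vs' l where vs': "set vs' \<subseteq> {1..<n}" "1 \<le> l" "l \<le> Suc n"
        "word_perm vs = word_perm (vs' @ descent_word n l)" "fold S vs P = fold S (vs' @ descent_word n l) P"
      using word_normal_form[OF n Suc.prems(2)] assms(4) by blast
    have "word_perm us (Suc n) = k" "word_perm vs (Suc n) = l"
      using us' vs' word_perm_fixes[of us' n "Suc n"] word_perm_fixes[of vs' n "Suc n"]
      by (auto simp: word_perm_append word_perm_descent)
    then have kl: "k = l" using Suc.prems(3) by simp
    have "word_perm (descent_word n k) (word_perm us' x) = word_perm (descent_word n k) (word_perm vs' x)" for x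
      using us'(4) vs'(4) Suc.prems(3) kl by (metis comp_apply word_perm_append)
    then have "word_perm us' = word_perm vs'"
      using inj_word_perm[of "descent_word n k"] by (auto simp: fun_eq_iff dest: injD)
    then have "fold S us' P = fold S vs' P" using Suc.IH[OF us'(1) vs'(1)] n by simp
    then show ?case using us' vs' kl by simp
  qed auto
  then show ?thesis using assms by auto
qed

end

section \<open>Reverse standard tableaux\<close>

lemma card_below_strict_mono:
  assumes "finite A" "p \<in> A" "lt p q" "\<not> lt p p"
    and "\<And>x. x \<in> A \<Longrightarrow> lt x p \<Longrightarrow> lt x q"
  shows "card {x \<in> A. lt x p} < card {x \<in> A. lt x q}"
  using assms by (intro psubset_card_mono) auto

text \<open>Ranks in a finite strict linear order, counted downwards so that the minimum receives
  \<open>card A\<close>. With the column order it shows that \<open>tau_shape\<close> is a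
  bijection.\<close>

lemma bij_betw_card_below:
  assumes "finite A"
    and irr: "\<And>x. x \<in> A \<Longrightarrow> \<not> lt x x"
    and trans: "\<And>x y z. x \<in> A \<Longrightarrow> y \<in> A \<Longrightarrow> z \<in> A \<Longrightarrow> lt x y \<Longrightarrow> lt y z \<Longrightarrow> lt x z"
    and total: "\<And>x y. x \<in> A \<Longrightarrow> y \<in> A \<Longrightarrow> x \<noteq> y \<Longrightarrow> lt x y \<or> lt y x"
  shows "bij_betw (\<lambda>p. card A - card {x \<in> A. lt x p}) A {1..card A}"
proof -
  let ?f = "\<lambda>p. card {x \<in> A. lt x p}"
  have mono: "?f p < ?f q" if "p \<in> A" "q \<in> A" "lt p q" for p q
    by (rule card_below_strict_mono[where lt = lt]) (use that assms in blast)+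
  have less: "?f p < card A" if "p \<in> A" for p
    using that \<open>finite A\<close> irr[OF that] by (intro psubset_card_mono) auto
  have inj: "inj_on (\<lambda>p. card A - ?f p) A"
  proof (rule inj_onI)
    fix p q assume h: "p \<in> A" "q \<in> A" "card A - ?f p = card A - ?f q"
    then have "?f p = ?f q" using less[of p] less[of q] by simp
    then show "p = q" using mono[of p q] mono[of q p] total[of p q] h by force
  qed
  moreover have "(\<lambda>p. card A - ?f p) ` A \<subseteq> {1..card A}"
    using less by (auto simp: Suc_le_eq)
  ultimately have "(\<lambda>p. card A - ?f p) ` A = {1..card A}"
    by (intro card_subset_eq) (auto simp: card_image)
  with inj show ?thesis by (simp add: bij_betw_def)
qed

locale shape =
  fixes lam :: "nat list" and N :: nat
  assumes part: "partition_of lam N"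
begin

section \<open>Diagrams and reverse standard fillings\<close>

lemma sum_list_lam: "sum_list lam = N"
  using part by (simp add: partition_of_def)

lemma cells_down_closed:
  assumes "(r, c) \<in> cells lam" "1 \<le> r'" "r' \<le> r" "1 \<le> c'" "c' \<le> c"
  shows "(r', c') \<in> cells lam"
proof -
  have "lam ! (r - 1) \<le> lam ! (r' - 1)"
  proof (cases "r' = r")
    case False
    then show ?thesis
      using part assms by (auto simp: partition_of_def cells_def intro!: sorted_wrt_nth_less[of "(\<ge>)"])
  qed auto
  then show ?thesis using assms by (auto simp: cells_def)
qed

lemma cells_Sigma: "cells lam = (SIGMA r:{1..length lam}. {1..lam ! (r - 1)})"
  by (auto simp: cells_def)

lemma finite_cells [simp]: "finite (cells lam)"
  by (auto simp: cells_Sigma)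

lemma card_cells: "card (cells lam) = N"
proof -
  have "card (cells lam) = (\<Sum>r\<in>{1..length lam}. lam ! (r - 1))"
    by (simp add: cells_Sigma)
  also have "\<dots> = (\<Sum>r\<in>{0..<length lam}. lam ! r)"
    by (rule sum.reindex_bij_witness[of _ Suc "\<lambda>r. r - 1"]) auto
  finally show ?thesis by (simp add: sum_list_sum_nth sum_list_lam[symmetric])
qed

abbreviation rst :: "tab \<Rightarrow> bool" where "rst \<equiv> is_rst lam"

lemma rst_outside: "rst \<tau> \<Longrightarrow> p \<notin> cells lam \<Longrightarrow> \<tau> p = 0"
  by (cases p) (simp add: is_rst_def)

lemma rst_bij: "rst \<tau> \<Longrightarrow> bij_betw \<tau> (cells lam) {1..N}"
  by (simp add: is_rst_def sum_list_lam)

lemma rst_range: "rst \<tau> \<Longrightarrow> p \<in> cells lam \<Longrightarrow> 1 \<le> \<tau> p \<and> \<tau> p \<le> N"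
  using rst_bij[of \<tau>] by (auto simp: bij_betw_def)

lemma rst_cell:
  assumes "rst \<tau>" "1 \<le> a" "a \<le> N"
  obtains p where "p \<in> cells lam" "\<tau> p = a"
proof -
  have "a \<in> \<tau> ` cells lam" using rst_bij[OF assms(1)] assms by (auto simp: bij_betw_def)
  then show ?thesis using that by auto
qed

lemma rst_inj: "rst \<tau> \<Longrightarrow> p \<in> cells lam \<Longrightarrow> \<tau> q = \<tau> p \<Longrightarrow> q = p"
  using rst_bij[of \<tau>] rst_range[of \<tau> p] rst_outside[of \<tau> q]
  by (cases "q \<in> cells lam") (auto simp: bij_betw_def inj_on_def)

lemma CT_rst: "rst \<tau> \<Longrightarrow> (r, c) \<in> cells lam \<Longrightarrow> CT \<tau> (\<tau> (r, c)) = int c - int r"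
proof -
  assume "rst \<tau>" "(r, c) \<in> cells lam"
  then have "(THE p. \<tau> p = \<tau> (r, c)) = (r, c)" by (intro the_equality) (auto dest: rst_inj)
  then show ?thesis by (simp add: CT_def)
qed

lemma rst_row: "rst \<tau> \<Longrightarrow> (r, c) \<in> cells lam \<Longrightarrow> (r, c') \<in> cells lam \<Longrightarrow> c < c' \<Longrightarrow> \<tau> (r, c') < \<tau> (r, c)"
  by (auto simp: is_rst_def)

lemma rst_col: "rst \<tau> \<Longrightarrow> (r, c) \<in> cells lam \<Longrightarrow> (r', c) \<in> cells lam \<Longrightarrow> r < r' \<Longrightarrow> \<tau> (r', c) < \<tau> (r, c)"
  by (auto simp: is_rst_def)

lemma rst_antimono:
  assumes "rst \<tau>" "(r, c) \<in> cells lam" "(r', c') \<in> cells lam" "r \<le> r'" "c \<le> c'"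
  shows "\<tau> (r', c') \<le> \<tau> (r, c)"
proof -
  have m: "(r, c') \<in> cells lam" by (rule cells_down_closed[OF assms(3)]) (use assms in \<open>auto simp: cells_def\<close>)
  have "\<tau> (r', c') \<le> \<tau> (r, c')" using rst_col[of \<tau> r c' r'] assms m by (cases "r = r'") auto
  also have "\<dots> \<le> \<tau> (r, c)" using rst_row[of \<tau> r c c'] assms m by (cases "c = c'") auto
  finally show ?thesis .
qed

section \<open>Axial distances of consecutive entries\<close>

lemma consecutive_cells:
  assumes "rst \<tau>" "(r, c) \<in> cells lam" "(r', c') \<in> cells lam" "\<tau> (r, c) = a" "\<tau> (r', c') = Suc a"
  shows "(r < r' \<and> c' < c) \<or> (r' < r \<and> c < c') \<or> (r' = r \<and> c = Suc c') \<or> (c' = c \<and> r = Suc r')"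
proof -
  have pos: "1 \<le> r'" "1 \<le> c'" using assms by (auto simp: cells_def)
  have 1: "r' < r \<or> c' < c" using rst_antimono[of \<tau> r c r' c'] assms by force
  \<comment> \<open>In the rectangle from (r', c') to (r, c) all entries lie between a and a+1, so
    it contains no third cell. This excludes a strictly diagonal position and any gap within a row
    or column.\<close>
  have between: "(x, y) = (r, c) \<or> (x, y) = (r', c')"
    if "r' \<le> x" "x \<le> r" "c' \<le> y" "y \<le> c" for x y
  proof -
    have xy: "(x, y) \<in> cells lam" by (rule cells_down_closed[OF assms(2)]) (use that pos in auto)
    have "\<tau> (r, c) \<le> \<tau> (x, y)" "\<tau> (x, y) \<le> \<tau> (r', c')"
      using rst_antimono[OF assms(1) xy assms(2)] rst_antimono[OF assms(1,3) xy] that by auto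
    then have "\<tau> (x, y) = \<tau> (r, c) \<or> \<tau> (x, y) = \<tau> (r', c')" using assms by auto
    then show ?thesis using rst_inj assms by blast
  qed
  have 2: "\<not> (r' < r \<and> c' < c)" using between[of r' c] by auto
  have 3: "r = Suc r'" if "r' < r" "c' = c" using between[of "Suc r'" c] that by auto
  have 4: "c = Suc c'" if "c' < c" "r' = r" using between[of r "Suc c'"] that by auto
  show ?thesis using 1 2 3 4 by linarith
qed

lemma axial_cases:
  assumes "rst \<tau>" "(r, c) \<in> cells lam" "(r', c') \<in> cells lam" "\<tau> (r, c) = a" "\<tau> (r', c') = Suc a"
  obtains "2 \<le> axial a \<tau>" "r < r'" "c' < c" | "axial a \<tau> \<le> -2" "r' < r" "c < c'"
  | "axial a \<tau> = 1" "r' = r" "c = Suc c'" | "axial a \<tau> = -1" "c' = c" "r = Suc r'"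
proof -
  have "axial a \<tau> = int c - int r - (int c' - int r')"
    using CT_rst[OF assms(1,2)] CT_rst[OF assms(1,3)] assms(4,5) by (simp add: axial_def)
  then show ?thesis using consecutive_cells[OF assms] that by fastforce
qed

lemma axial_trichotomy:
  assumes "rst \<tau>" "1 \<le> a" "a < N"
  shows "2 \<le> axial a \<tau> \<or> axial a \<tau> \<le> -2 \<or> axial a \<tau> = 1 \<or> axial a \<tau> = -1"
proof -
  obtain p where p: "p \<in> cells lam" "\<tau> p = a" using rst_cell[of \<tau> a] assms by auto
  obtain q where q: "q \<in> cells lam" "\<tau> q = Suc a" using rst_cell[of \<tau> "Suc a"] assms by auto
  show ?thesis
    by (rule axial_cases[of \<tau> "fst p" "snd p" "fst q" "snd q" a]) (use p q assms in auto)
qed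

text \<open>If a and a+2 lay on one diagonal, the two other corners of the rectangle they span would
  both have to hold a+1. This provides the last hypothesis of
  \<open>diag_s_braid_single\<close>.\<close>

lemma axial_two_step:
  assumes "rst \<tau>" "1 \<le> a" "Suc a < N"
  shows "axial a \<tau> + axial (Suc a) \<tau> \<noteq> 0"
proof
  assume eq: "axial a \<tau> + axial (Suc a) \<tau> = 0"
  obtain r c where p: "(r, c) \<in> cells lam" "\<tau> (r, c) = a" using rst_cell[of \<tau> a] assms by (metis less_imp_le Suc_lessD surj_pair)
  obtain r' c' where q: "(r', c') \<in> cells lam" "\<tau> (r', c') = Suc (Suc a)"
    using rst_cell[of \<tau> "Suc (Suc a)"] assms by (metis Suc_leI le_SucI le_add1 plus_1_eq_Suc surj_pair)
  have "int c - int r = int c' - int r'"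
    using CT_rst[OF assms(1) p(1)] CT_rst[OF assms(1) q(1)] p q eq by (simp add: axial_def)
  moreover have "\<not> (r \<le> r' \<and> c \<le> c')" using rst_antimono[OF assms(1) p(1) q(1)] p q by auto
  ultimately have lt: "r' < r" "c' < c" by linarith+
  have pos: "1 \<le> r'" "1 \<le> c'" using q by (auto simp: cells_def)
  have c1: "(r', c) \<in> cells lam" "(r, c') \<in> cells lam"
    using lt pos by (auto intro: cells_down_closed[OF p(1)])
  have "\<tau> (r', c) < Suc (Suc a)" "a < \<tau> (r', c)" "\<tau> (r, c') < Suc (Suc a)" "a < \<tau> (r, c')"
    using rst_row[OF assms(1) q(1) c1(1)] rst_col[OF assms(1) c1(1) p(1)]
      rst_col[OF assms(1) q(1) c1(2)] rst_row[OF assms(1) c1(2) p(1)] lt p q by auto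
  then have "\<tau> (r', c) = \<tau> (r, c')" by linarith
  then show False using rst_inj[OF assms(1) c1(2), of "(r', c)"] lt by auto
qed

text \<open>Exchanging a and a+1 can spoil a strict inequality only between these two entries, hence
  only if they share a row or a column, where the distance is 1 or -1.\<close>

lemma rst_interchange:
  assumes "rst \<tau>" "1 \<le> a" "a < N" "2 \<le> \<bar>axial a \<tau>\<bar>"
  shows "rst (interchange a \<tau>)"
proof -
  have perm: "transpose a (Suc a) permutes {1..N}" using assms by (intro permutes_swap_id) auto
  have bij: "bij_betw (interchange a \<tau>) (cells lam) {1..N}"
    unfolding interchange_def Suc_eq_plus1[symmetric]
    using rst_bij[OF assms(1)] permutes_imp_bij[OF perm] by (rule bij_betw_trans)
  have key: "transpose a (Suc a) y < transpose a (Suc a) x" if "y < x" "\<not> (x = Suc a \<and> y = a)" for x y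
    using that by (auto simp: transpose_def)
  have row: "interchange a \<tau> (r, c') < interchange a \<tau> (r, c)"
    if h: "(r, c) \<in> cells lam" "(r, c') \<in> cells lam" "c < c'" for r c c'
  proof -
    have "\<not> (\<tau> (r, c) = Suc a \<and> \<tau> (r, c') = a)"
    proof
      assume "\<tau> (r, c) = Suc a \<and> \<tau> (r, c') = a"
      then show False
        by - (rule axial_cases[of \<tau> r c' r c a], use assms h in auto)
    qed
    then show ?thesis using key rst_row[OF assms(1) h] by (simp add: interchange_def)
  qed
  have col: "interchange a \<tau> (r', c) < interchange a \<tau> (r, c)"
    if h: "(r, c) \<in> cells lam" "(r', c) \<in> cells lam" "r < r'" for r r' c
  proof -
    have "\<not> (\<tau> (r, c) = Suc a \<and> \<tau> (r', c) = a)"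
    proof
      assume "\<tau> (r, c) = Suc a \<and> \<tau> (r', c) = a"
      then show False
        by - (rule axial_cases[of \<tau> r' c r c a], use assms h in auto)
    qed
    then show ?thesis using key rst_col[OF assms(1) h] by (simp add: interchange_def)
  qed
  show ?thesis
    unfolding is_rst_def sum_list_lam
    using bij row col rst_outside[OF assms(1)] assms(2) by (auto simp: interchange_def transpose_def)
qed

text \<open>Entries decrease up each diagonal, so the entry of a cell is pinned down by its rank
  among all entries of the same content. This is why labels determine a vertex.\<close>

lemma rst_eqI_CT:
  assumes "rst \<tau>" "rst \<tau>'" "\<And>a. 1 \<le> a \<Longrightarrow> a \<le> N \<Longrightarrow> CT \<tau> a = CT \<tau>' a"
  shows "\<tau> = \<tau>'"
proof -
  define D where "D r k = {q \<in> cells lam. int (snd q) - int (fst q) = k \<and> fst q < r}" for r k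
  have diag: "{a. 1 \<le> a \<and> a \<le> N \<and> CT \<sigma> a = int c - int r \<and> \<sigma> (r, c) < a} = \<sigma> ` D r (int c - int r)"
    if that': "rst \<sigma>" "(r, c) \<in> cells lam" for \<sigma> r c
  proof (intro equalityI subsetI)
    fix a assume a: "a \<in> {a. 1 \<le> a \<and> a \<le> N \<and> CT \<sigma> a = int c - int r \<and> \<sigma> (r, c) < a}"
    then obtain r' c' where q: "(r', c') \<in> cells lam" "\<sigma> (r', c') = a"
      using rst_cell[OF that'(1), of a] by (metis (mono_tags, lifting) mem_Collect_eq surj_pair)
    have eq: "int c' - int r' = int c - int r" using CT_rst[OF that'(1) q(1)] q a by auto
    moreover have "r' < r"
    proof (rule ccontr)
      assume "\<not> r' < r"
      then have "a \<le> \<sigma> (r, c)" using rst_antimono[OF that' q(1)] q eq by auto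
      then show False using a by auto
    qed
    ultimately show "a \<in> \<sigma> ` D r (int c - int r)" using q by (force simp: D_def)
  next
    fix a assume "a \<in> \<sigma> ` D r (int c - int r)"
    then obtain r' c' where q: "(r', c') \<in> cells lam" "\<sigma> (r', c') = a" "int c' - int r' = int c - int r" "r' < r"
      by (auto simp: D_def)
    have "\<sigma> (r, c) \<le> a" using rst_antimono[OF that'(1) q(1) that'(2)] q by auto
    moreover have "\<sigma> (r, c) \<noteq> a" using rst_inj[OF that'(1) q(1), of "(r, c)"] q by auto
    ultimately show "a \<in> {a. 1 \<le> a \<and> a \<le> N \<and> CT \<sigma> a = int c - int r \<and> \<sigma> (r, c) < a}"
      using q CT_rst[OF that'(1) q(1)] rst_range[OF that'(1) q(1)] by auto
  qed
  have not_less: "\<not> \<sigma> p < \<sigma>' p"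
    if \<sigma>: "rst \<sigma>" "rst \<sigma>'" "p \<in> cells lam" "\<And>a. 1 \<le> a \<Longrightarrow> a \<le> N \<Longrightarrow> CT \<sigma> a = CT \<sigma>' a" for \<sigma> \<sigma>' p
  proof
    assume less: "\<sigma> p < \<sigma>' p"
    obtain r c where p: "p = (r, c)" by fastforce
    let ?k = "int c - int r"
    let ?A = "{a. 1 \<le> a \<and> a \<le> N \<and> CT \<sigma> a = ?k \<and> \<sigma> p < a}"
    let ?B = "{a. 1 \<le> a \<and> a \<le> N \<and> CT \<sigma>' a = ?k \<and> \<sigma>' p < a}"
    have inj: "inj_on \<sigma> (D r ?k)" "inj_on \<sigma>' (D r ?k)"
      using \<sigma> by (auto simp: D_def inj_on_def dest: rst_inj)
    \<comment> \<open>Both sets count the cells lower on the diagonal of p. If \<sigma> p <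
      \<sigma>' p, then ?B lies in ?A but misses \<sigma>' p, which contradicts equal
      cardinality.\<close>
    have "card ?A = card ?B"
      using diag[of \<sigma> r c] diag[of \<sigma>' r c] \<sigma> p inj by (simp add: card_image)
    moreover have "\<sigma>' p \<in> ?A - ?B"
      using less \<sigma> rst_range[of \<sigma>' p] CT_rst[of \<sigma>' r c] p by auto
    moreover have "?B \<subseteq> ?A" using less \<sigma> by auto
    moreover have "finite ?A" by (rule finite_subset[of _ "{1..N}"]) auto
    ultimately show False by (metis (no_types, lifting) DiffE card_subset_eq)
  qed
  show ?thesis
  proof
    fix p
    show "\<tau> p = \<tau>' p"
    proof (cases "p \<in> cells lam")
      case True
      then show ?thesis using not_less[of \<tau> \<tau>' p] not_less[of \<tau>' \<tau> p] assms by force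
    qed (simp add: rst_outside assms(1,2))
  qed
qed

lemma finite_rst: "finite {\<tau>. rst \<tau>}"
proof (rule finite_subset)
  show "{\<tau>. rst \<tau>} \<subseteq> {f. \<forall>x. (x \<in> cells lam \<longrightarrow> f x \<in> {1..N}) \<and> (x \<notin> cells lam \<longrightarrow> f x = 0)}"
    by (simp add: subset_iff rst_range rst_outside Suc_le_eq[symmetric] del: One_nat_def)
  show "finite {f :: tab. \<forall>x. (x \<in> cells lam \<longrightarrow> f x \<in> {1..N}) \<and> (x \<notin> cells lam \<longrightarrow> f x = 0)}"
    by (rule finite_set_of_finite_funs) auto
qed

lemma rst_tau_shape: "rst (tau_shape lam)"
proof -
  define lt where "lt = (\<lambda>(p :: nat \<times> nat) q. snd p < snd q \<or> (snd p = snd q \<and> fst p < fst q))"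
  let ?f = "\<lambda>p. card (cells lam) - card {x \<in> cells lam. lt x p}"
  have ts: "tau_shape lam p = ?f p" if "p \<in> cells lam" for p
  proof -
    have "{(r', c'). (r', c') \<in> cells lam \<and> (c' < snd p \<or> c' = snd p \<and> r' < fst p)} = {x \<in> cells lam. lt x p}"
      by (auto simp: lt_def)
    then show ?thesis using that
      by (cases p) (simp add: tau_shape_def sum_list_lam card_cells)
  qed
  have bij: "bij_betw ?f (cells lam) {1..card (cells lam)}"
    by (rule bij_betw_card_below[where lt = lt]) (auto simp: lt_def)
  have mono: "?f q < ?f p" if "p \<in> cells lam" "q \<in> cells lam" "lt p q" for p q
  proof -
    have "card {x \<in> cells lam. lt x p} < card {x \<in> cells lam. lt x q}"
      by (rule card_below_strict_mono[where lt = lt]) (use that in \<open>auto simp: lt_def\<close>)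
    moreover have "card {x \<in> cells lam. lt x q} \<le> card (cells lam)"
      by (rule card_mono) auto
    ultimately show ?thesis by linarith
  qed
  have "bij_betw (tau_shape lam) (cells lam) {1..N}"
    using bij bij_betw_cong[of "cells lam" "tau_shape lam" ?f] ts card_cells by auto
  moreover have "tau_shape lam p = 0" if "p \<notin> cells lam" for p
    using that by (cases p) (simp add: tau_shape_def)
  ultimately show ?thesis
    unfolding is_rst_def sum_list_lam using ts mono by (auto simp: lt_def)
qed

lemma tau_shape_col_mono:
  assumes "(r, c) \<in> cells lam" "(r', c') \<in> cells lam" "tau_shape lam (r, c) < tau_shape lam (r', c')"
  shows "c' \<le> c"
proof (rule ccontr)
  assume "\<not> c' \<le> c"
  then have "{(r'', c''). (r'', c'') \<in> cells lam \<and> (c'' < c \<or> c'' = c \<and> r'' < r)}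
     \<subseteq> {(r'', c''). (r'', c'') \<in> cells lam \<and> (c'' < c' \<or> c'' = c' \<and> r'' < r')}"
    by auto
  moreover have "finite {(r'', c''). (r'', c'') \<in> cells lam \<and> (c'' < c' \<or> c'' = c' \<and> r'' < r')}"
    by (rule finite_subset[OF _ finite_cells]) auto
  ultimately have "card {(r'', c''). (r'', c'') \<in> cells lam \<and> (c'' < c \<or> c'' = c \<and> r'' < r)}
      \<le> card {(r'', c''). (r'', c'') \<in> cells lam \<and> (c'' < c' \<or> c'' = c' \<and> r'' < r')}"
    by (rule card_mono[rotated])
  then show False using assms by (simp add: tau_shape_def)
qed

section \<open>The module of tableau-valued polynomials\<close>

text \<open>The type \<open>tabpol\<close> admits arbitrary fillings; this is the span of the
  reverse standard ones, the actual module of vector-valued polynomials, and the place where the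
  braid relation is available.\<close>

definition Mod :: "tabpol set" where
  "Mod = {P. Poly_Mapping.keys P \<subseteq> {\<tau>. rst \<tau>}}"

lemma Mod_0 [simp]: "0 \<in> Mod" by (simp add: Mod_def)

lemma Mod_add [intro]: "P \<in> Mod \<Longrightarrow> Q \<in> Mod \<Longrightarrow> P + Q \<in> Mod"
  using keys_add[of P Q] by (auto simp: Mod_def)

lemma Mod_sum: "(\<And>a. a \<in> A \<Longrightarrow> f a \<in> Mod) \<Longrightarrow> sum f A \<in> Mod"
  by (induction A rule: infinite_finite_induct) auto

lemma Mod_single [intro]: "rst \<tau> \<Longrightarrow> single \<tau> f \<in> Mod"
  by (auto simp: Mod_def)

lemma Mod_pmul [intro]: "P \<in> Mod \<Longrightarrow> pmul f P \<in> Mod"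
  by (auto simp: Mod_def in_keys_iff subset_iff)

lemma Mod_smul [intro]: "P \<in> Mod \<Longrightarrow> smul c P \<in> Mod"
  by (auto simp: smul_def)

text \<open>When an interchange leaves the reverse standard tableaux, the distance is 1 or -1 and
  \<open>seminormal\<close> vanishes.\<close>

lemma Mod_diag_s:
  assumes "P \<in> Mod" "0 < i" "i < N"
  shows "diag_s i P \<in> Mod"
proof -
  have *: "diag_s i (single \<tau> f) \<in> Mod" if "rst \<tau>" for \<tau> f
  proof (cases "2 \<le> \<bar>axial i \<tau>\<bar>")
    case True
    then have "rst (interchange i \<tau>)" using rst_interchange that assms by auto
    then show ?thesis using that by (auto simp: diag_s_single)
  next
    case False
    then have "seminormal (axial i \<tau>) = 0"
      using axial_trichotomy[OF that, of i] assms by (auto simp: seminormal_def)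
    then show ?thesis using that by (auto simp: diag_s_single)
  qed
  have "P = (\<Sum>k\<in>Poly_Mapping.keys P. single k (lookup P k))"
    by (rule poly_mapping_sum_single) auto
  then have "diag_s i P = (\<Sum>k\<in>Poly_Mapping.keys P. diag_s i (single k (lookup P k)))"
    by (metis diag_s_sum)
  also have "\<dots> \<in> Mod" using assms(1) * by (intro Mod_sum) (auto simp: Mod_def)
  finally show ?thesis .
qed

lemma diag_s_braid:
  assumes "P \<in> Mod" "0 < i" "Suc i < N"
  shows "diag_s i (diag_s (Suc i) (diag_s i P)) = diag_s (Suc i) (diag_s i (diag_s (Suc i) P))"
proof (rule additive_eq_on_keys[where F = "\<lambda>P. diag_s i (diag_s (Suc i) (diag_s i P))"
      and G = "\<lambda>P. diag_s (Suc i) (diag_s i (diag_s (Suc i) P))"])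
  fix \<tau> f assume "\<tau> \<in> Poly_Mapping.keys P"
  then have "rst \<tau>" using assms by (auto simp: Mod_def)
  then show "diag_s i (diag_s (Suc i) (diag_s i (single \<tau> f)))
      = diag_s (Suc i) (diag_s i (diag_s (Suc i) (single \<tau> f)))"
    using axial_trichotomy[of \<tau> i] axial_trichotomy[of \<tau> "Suc i"] axial_two_step[of \<tau> i] assms
    by (intro diag_s_braid_single) auto
qed (simp_all add: diag_s_add)

lemma coxeter_Mod: "coxeter_action N diag_s Mod"
proof (rule coxeter_action.intro)
  fix P i j assume "Suc (Suc i) \<le> j"
  then show "diag_s i (diag_s j P) = diag_s j (diag_s i P)" by (rule diag_s_commute)
qed (rule Mod_diag_s diag_s_diag_s diag_s_braid; assumption)+

end

section \<open>Standardization of vectors\<close>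

declare One_nat_def [simp del]

text \<open>The order of positions behind \<sigma>, larger entries first and ties from left to
  right, made reflexive so that \<sigma> of a position counts the position itself.\<close>

definition weakly_before :: "nat list \<Rightarrow> nat \<Rightarrow> nat \<Rightarrow> bool" where
  "weakly_before v j i \<longleftrightarrow> entry v i < entry v j \<or> (entry v j = entry v i \<and> j \<le> i)"

lemma sigma_eq_card:
  assumes "i \<le> length v"
  shows "sigma v i = card {j \<in> {1..length v}. weakly_before v j i}"
proof -
  have "{j \<in> {1..length v}. weakly_before v j i} =
      {j \<in> {1..length v}. entry v i < entry v j} \<union> {j \<in> {1..i}. entry v j = entry v i}"
    using assms by (auto simp: weakly_before_def)
  moreover have "card \<dots> = sigma v i"
    unfolding sigma_def by (subst card_Un_disjoint) auto
  ultimately show ?thesis by simp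
qed

lemma sigma_strict_mono:
  assumes "i \<in> {1..length v}" "j \<in> {1..length v}" "weakly_before v j i" "j \<noteq> i"
  shows "sigma v j < sigma v i"
proof -
  have "{k \<in> {1..length v}. weakly_before v k j} \<subset> {k \<in> {1..length v}. weakly_before v k i}"
  proof (rule psubsetI)
    show "{k \<in> {1..length v}. weakly_before v k j} \<subseteq> {k \<in> {1..length v}. weakly_before v k i}"
      using assms(3) by (auto simp: weakly_before_def)
    have "i \<in> {k \<in> {1..length v}. weakly_before v k i}" "i \<notin> {k \<in> {1..length v}. weakly_before v k j}"
      using assms by (auto simp: weakly_before_def)
    then show "{k \<in> {1..length v}. weakly_before v k j} \<noteq> {k \<in> {1..length v}. weakly_before v k i}"
      by blast
  qed
  then show ?thesis using assms by (simp add: sigma_eq_card psubset_card_mono)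
qed

lemma sigma_range:
  assumes "i \<in> {1..length v}"
  shows "sigma v i \<in> {1..length v}"
proof -
  have "card {j \<in> {1..length v}. weakly_before v j i} \<le> card {1..length v}"
    by (rule card_mono) auto
  moreover have "0 < card {j \<in> {1..length v}. weakly_before v j i}"
    using assms by (subst card_gt_0_iff) (auto simp: weakly_before_def)
  ultimately show ?thesis using assms by (simp add: sigma_eq_card)
qed

lemma inj_on_sigma: "inj_on (sigma v) {1..length v}"
proof (rule inj_onI, rule ccontr)
  fix i j assume h: "i \<in> {1..length v}" "j \<in> {1..length v}" "sigma v i = sigma v j" "i \<noteq> j"
  have "weakly_before v i j \<or> weakly_before v j i" by (auto simp: weakly_before_def)
  then show False using sigma_strict_mono[of i v j] sigma_strict_mono[of j v i] h by auto
qed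

lemma bij_betw_sigma: "bij_betw (sigma v) {1..length v} {1..length v}"
proof -
  have "sigma v ` {1..length v} = {1..length v}"
    using sigma_range card_image[OF inj_on_sigma, of v] by (intro card_subset_eq) (auto simp only: image_subset_iff finite_atLeastAtMost)
  then show ?thesis using inj_on_sigma by (simp add: bij_betw_def)
qed

lemma sigma_Suc:
  assumes "1 \<le> i" "i < length v" "entry v i = entry v (Suc i)"
  shows "sigma v (Suc i) = Suc (sigma v i)"
proof -
  have "{j \<in> {1..length v}. weakly_before v j (Suc i)} = insert (Suc i) {j \<in> {1..length v}. weakly_before v j i}"
    using assms by (auto simp: weakly_before_def le_Suc_eq)
  then show ?thesis using assms by (simp add: sigma_eq_card weakly_before_def)
qed

lemma card_Collect_reindex:
  assumes "bij_betw t A A" "\<And>j. j \<in> A \<Longrightarrow> P j \<longleftrightarrow> Q (t j)"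
  shows "card {j \<in> A. P j} = card {j \<in> A. Q j}"
proof -
  have t: "t ` A = A" "inj_on t A" using assms(1) by (auto simp: bij_betw_def)
  have "{j \<in> A. Q j} = t ` {j \<in> A. P j}"
  proof (intro equalityI subsetI)
    fix x assume x: "x \<in> {j \<in> A. Q j}"
    then obtain j where j: "j \<in> A" "x = t j" using t(1) by blast
    then show "x \<in> t ` {j \<in> A. P j}" using x assms(2)[OF j(1)] by simp
  next
    fix x assume "x \<in> t ` {j \<in> A. P j}"
    then obtain j where j: "j \<in> A" "P j" "x = t j" by blast
    then show "x \<in> {j \<in> A. Q j}" using t(1) assms(2)[OF j(1)] by blast
  qed
  moreover have "inj_on t {j \<in> A. P j}" by (rule inj_on_subset[OF t(2)]) auto
  ultimately show ?thesis by (simp add: card_image)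
qed

lemma length_vswap [simp]: "length (vswap i v) = length v"
  by (simp add: vswap_def)

lemma entry_vswap:
  assumes "1 \<le> i" "i < length v" "1 \<le> k" "k \<le> length v"
  shows "entry (vswap i v) k = entry v (transpose i (Suc i) k)"
  using assms by (auto simp: vswap_def nth_list_update transpose_def)

lemma bij_betw_transpose_Suc:
  assumes "1 \<le> i" "i < n"
  shows "bij_betw (transpose i (Suc i)) {1..n} {1..n}"
  using assms by (intro permutes_imp_bij permutes_swap_id) auto

lemma transpose_Suc_range:
  assumes "1 \<le> i" "i < n" "1 \<le> k" "k \<le> n"
  shows "1 \<le> transpose i (Suc i) k" "transpose i (Suc i) k \<le> n"
  using assms by (auto simp: transpose_def)

lemma sigma_vswap:
  assumes "1 \<le> i" "i < length v" "1 \<le> k" "k \<le> length v" "entry v i \<noteq> entry v (Suc i)"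
  shows "sigma (vswap i v) k = sigma v (transpose i (Suc i) k)"
proof -
  let ?t = "transpose i (Suc i)"
  have "card {j \<in> {1..length v}. weakly_before (vswap i v) j k} = card {j \<in> {1..length v}. weakly_before v j (?t k)}"
  proof (rule card_Collect_reindex[OF bij_betw_transpose_Suc[OF assms(1,2)]])
    fix j assume "j \<in> {1..length v}"
    then have ej: "entry (vswap i v) j = entry v (?t j)" using assms by (intro entry_vswap) auto
    have ek: "entry (vswap i v) k = entry v (?t k)" using assms by (intro entry_vswap) auto
    have "j \<le> k \<longleftrightarrow> ?t j \<le> ?t k" if "entry v (?t j) = entry v (?t k)"
      using that assms(5) by (auto simp: transpose_def split: if_splits)
    then show "weakly_before (vswap i v) j k \<longleftrightarrow> weakly_before v (?t j) (?t k)"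
      unfolding weakly_before_def ej ek by auto
  qed
  then show ?thesis using assms transpose_Suc_range[of i "length v" k] by (simp add: sigma_eq_card)
qed

lemma length_vpsi [simp]: "v \<noteq> [] \<Longrightarrow> length (vpsi v) = length v"
  by (simp add: vpsi_def)

lemma entry_vpsi:
  assumes "v \<noteq> []" "1 \<le> k" "k \<le> length v"
  shows "entry (vpsi v) k = (if k = length v then Suc (entry v 1) else entry v (Suc k))"
proof (cases "k = length v")
  case True
  then show ?thesis using assms by (cases v) (auto simp: vpsi_def nth_append)
next
  case False
  then show ?thesis using assms by (cases v) (auto simp: vpsi_def nth_append)
qed

text \<open>Raising the first entry while moving it to the end changes no comparison. Against
  entries equal to it, it came first by position and now comes first by size; against entries larger
  by one, it came last by size and now comes last by position.\<close>

lemma sigma_vpsi: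
  assumes "v \<noteq> []" "1 \<le> k" "k \<le> length v"
  shows "sigma (vpsi v) k = sigma v (if k = length v then 1 else Suc k)"
proof -
  let ?n = "length v"
  let ?\<rho> = "\<lambda>k. if k = ?n then 1 else Suc k"
  have bij: "bij_betw ?\<rho> {1..?n} {1..?n}"
    using assms by (intro bij_betw_byWitness[where f' = "\<lambda>k. if k = 1 then ?n else k - 1"]) auto
  have "card {j \<in> {1..?n}. weakly_before (vpsi v) j k} = card {j \<in> {1..?n}. weakly_before v j (?\<rho> k)}"
  proof (rule card_Collect_reindex[OF bij])
    fix j assume "j \<in> {1..?n}"
    then show "weakly_before (vpsi v) j k \<longleftrightarrow> weakly_before v (?\<rho> j) (?\<rho> k)"
      using assms by (auto simp: weakly_before_def entry_vpsi)
  qed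
  then show ?thesis using assms by (simp add: sigma_eq_card)
qed

lemma image_mset_entry: "image_mset (entry v) (mset_set {1..length v}) = mset v"
proof -
  have "{1..length v} = set (map Suc [0..<length v])"
    by (auto simp: image_iff Bex_def One_nat_def dest: Suc_le_D)
  moreover have "distinct (map Suc [0..<length v])" by (simp only: distinct_map) auto
  ultimately have "mset_set {1..length v} = mset (map Suc [0..<length v])"
    by (metis mset_set_set)
  then have "image_mset (entry v) (mset_set {1..length v}) = mset (map (entry v) (map Suc [0..<length v]))"
    by (simp only: mset_map)
  also have "map (entry v) (map Suc [0..<length v]) = v"
    by (simp add: o_def map_nth)
  finally show ?thesis .
qed

lemma vplus_sigma:
  assumes "1 \<le> k" "k \<le> length v"
  shows "entry (vplus v) (sigma v k) = entry v k"
proof -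
  let ?n = "length v"
  let ?g = "inv_into {1..?n} (sigma v)"
  \<comment> \<open>w lists v in the order of \<sigma>; being decreasing with the same multiset, it
    must be \<open>vplus v\<close>.\<close>
  define w where "w = map (\<lambda>a. entry v (?g (Suc a))) [0..<?n]"
  have gr: "?g a \<in> {1..?n}" "sigma v (?g a) = a" if "a \<in> {1..?n}" for a
    using that bij_betw_sigma[of v] 
    by (auto simp only: bij_betw_def intro!: inv_into_into f_inv_into_f)
  have "mset w = image_mset (\<lambda>a. entry v (?g a)) (mset_set (Suc ` {0..<?n}))"
    unfolding w_def by (subst image_mset_mset_set[symmetric]) (auto simp: multiset.map_comp o_def)
  also have "\<dots> = image_mset (entry v) (mset_set (?g ` {1..?n}))"
    using bij_betw_sigma[of v]
    by (subst image_mset_mset_set[of ?g, symmetric])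
      (auto simp: multiset.map_comp o_def bij_betw_def image_Suc_atLeastLessThan atLeastLessThanSuc_atLeastAtMost
        One_nat_def intro!: inj_on_inv_into)
  also have "?g ` {1..?n} = {1..?n}"
    using bij_betw_inv_into[OF bij_betw_sigma[of v]] by (simp add: bij_betw_def)
  finally have m: "mset (rev w) = mset v" by (simp add: image_mset_entry del: One_nat_def)
  have mono: "entry v (?g b) \<le> entry v (?g a)" if "1 \<le> a" "a \<le> b" "b \<le> ?n" for a b
  proof (rule ccontr)
    assume "\<not> ?thesis"
    then have "weakly_before v (?g b) (?g a)" "?g b \<noteq> ?g a" by (auto simp: weakly_before_def)
    then have "sigma v (?g b) < sigma v (?g a)" using gr that by (intro sigma_strict_mono) auto
    then show False using gr that by auto
  qed
  have "sorted (rev w)"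
    unfolding sorted_iff_nth_mono by (auto simp: w_def rev_nth intro!: mono)
  then have "sort v = rev w" using m by (intro properties_for_sort)
  then have vw: "vplus v = w" by (simp add: vplus_def)
  have s: "sigma v k \<in> {1..?n}" using assms sigma_range[of k v] by simp
  then have "entry (vplus v) (sigma v k) = entry v (?g (sigma v k))"
    unfolding vw w_def by auto
  also have "?g (sigma v k) = k" using assms by (intro inv_into_f_f inj_on_sigma) auto
  finally show ?thesis .
qed

lemma vplus_antimono:
  assumes "1 \<le> a" "a \<le> b" "b \<le> length v"
  shows "entry (vplus v) b \<le> entry (vplus v) a"
  using assms sorted_nth_mono[of "sort v" "length v - b" "length v - a"]
  by (auto simp: vplus_def rev_nth)

section \<open>Spectral labels of vertices\<close>

definition lab :: "vertex \<Rightarrow> nat \<Rightarrow> nat \<times> int" where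
  "lab u i = (entry (snd u) i, CT (fst u) (sigma (snd u) i))"

definition zl :: "nat \<times> int \<Rightarrow> qalpha" where
  "zl x = alpha * of_nat (fst x) + of_int (snd x)"

lemma zeta_lab: "zeta \<tau> v i = zl (lab (\<tau>, v) i)"
  by (simp add: zeta_def zl_def lab_def)

text \<open>Exchanging neighbouring labels \<open>x\<close>, \<open>y\<close> is an edge of the graph precisely if \<open>x \<sqsubset> y\<close>.\<close>

definition prec :: "nat \<times> int \<Rightarrow> nat \<times> int \<Rightarrow> bool" (infix \<open>\<sqsubset>\<close> 50) where
  "x \<sqsubset> y \<longleftrightarrow> fst x < fst y \<or> (fst x = fst y \<and> 2 \<le> snd x - snd y)"

text \<open>On valid vertices these labels belong to neighbouring cells of the tableau: difference 1
  means the same row, -1 the same column. Interchanging the two entries leaves the reverse standard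
  tableaux.\<close>

definition adjacent :: "nat \<times> int \<Rightarrow> nat \<times> int \<Rightarrow> bool" where
  "adjacent x y \<longleftrightarrow> fst x = fst y \<and> (snd x - snd y = 1 \<or> snd x - snd y = -1)"

lemma prec_trans: "x \<sqsubset> y \<Longrightarrow> y \<sqsubset> z \<Longrightarrow> x \<sqsubset> z"
  by (auto simp: prec_def)

lemma prec_asym: "x \<sqsubset> y \<Longrightarrow> \<not> y \<sqsubset> x"
  by (auto simp: prec_def)

lemma zl_diff_eq_of_int_iff: "zl y - zl x = of_int m \<longleftrightarrow> fst x = fst y \<and> snd y - snd x = m"
proof -
  have "zl y - zl x = of_int m \<longleftrightarrow>
    alpha * of_int (int (fst y) - int (fst x)) + of_int (snd y - snd x - m) = 0"
    by (simp add: zl_def algebra_simps)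
  also have "\<dots> \<longleftrightarrow> fst x = fst y \<and> snd y - snd x = m"
    unfolding alpha_lincomb_eq_0_iff by auto
  finally show ?thesis .
qed

text \<open>Writing d for the difference: d \<noteq> 0 makes the operator of an edge meaningful, d
  \<noteq> 1 keeps the denominators of the coefficients nonzero, and d \<noteq> -1 keeps the factor
  1 + 1/d on symmetrizations nonzero.\<close>

lemma prec_zl:
  assumes "x \<sqsubset> y"
  shows "zl y - zl x \<noteq> 0" "zl y - zl x \<noteq> 1" "zl y - zl x \<noteq> -1"
  using assms zl_diff_eq_of_int_iff[of y x 0] zl_diff_eq_of_int_iff[of y x 1] zl_diff_eq_of_int_iff[of y x "-1"]
  by (auto simp: prec_def)

text \<open>One map serves to follow an edge s_i and to go back along it: on valid vertices it is an
  involution wherever the labels at i and i+1 are comparable. Elsewhere its value need not be a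
  vertex.\<close>

definition step :: "nat \<Rightarrow> vertex \<Rightarrow> vertex" where
  "step i u = (if entry (snd u) i = entry (snd u) (Suc i) then (interchange (sigma (snd u) i) (fst u), snd u)
     else (fst u, vswap i (snd u)))"

abbreviation up :: "nat \<Rightarrow> vertex \<Rightarrow> bool" where "up i u \<equiv> lab u i \<sqsubset> lab u (Suc i)"
abbreviation dn :: "nat \<Rightarrow> vertex \<Rightarrow> bool" where "dn i u \<equiv> lab u (Suc i) \<sqsubset> lab u i"

definition psi :: "vertex \<Rightarrow> vertex" where
  "psi u = (fst u, vpsi (snd u))"

text \<open>Inverse to \<open>psi\<close> only where the last entry is positive, the subtraction
  being truncated.\<close>

definition unpsi :: "vertex \<Rightarrow> vertex" where
  "unpsi u = (fst u, (last (snd u) - 1) # butlast (snd u))"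

context shape
begin

text \<open>By \<open>H_verts_iff\<close> these are exactly the vertices other than \<emptyset>, so
  later arguments need not trace reachability.\<close>

definition valid :: "vertex \<Rightarrow> bool" where
  "valid u \<longleftrightarrow> rst (fst u) \<and> length (snd u) = N"

text \<open>For equal entries \<sigma> takes consecutive values at i and i+1, so an interchange in
  the tableau exchanges two contents just as a swap exchanges two entries. The rule also covers
  interchanges that leave the reverse standard tableaux.\<close>

lemma lab_step:
  assumes "valid u" "1 \<le> i" "i < N" "1 \<le> k" "k \<le> N"
  shows "lab (step i u) k = lab u (transpose i (Suc i) k)"
proof (cases "entry (snd u) i = entry (snd u) (Suc i)")
  case True
  let ?s = "sigma (snd u)"
  have n: "length (snd u) = N" using assms by (simp add: valid_def)
  have s: "?s (Suc i) = Suc (?s i)" using assms True n by (intro sigma_Suc) auto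
  have "transpose (?s i) (?s (Suc i)) (?s k) = ?s (transpose i (Suc i) k)"
    using inj_on_eq_iff[OF inj_on_sigma[of "snd u"], of k i] inj_on_eq_iff[OF inj_on_sigma[of "snd u"], of k "Suc i"]
      assms n by (auto simp: transpose_def)
  moreover have "entry (snd u) (transpose i (Suc i) k) = entry (snd u) k"
    using True by (auto simp: transpose_def)
  ultimately show ?thesis using True s by (simp add: lab_def step_def CT_interchange)
next
  case False
  then show ?thesis using assms by (simp add: lab_def step_def valid_def entry_vswap sigma_vswap)
qed

lemma lab_Suc_equal:
  assumes "valid u" "1 \<le> i" "i < N" "entry (snd u) i = entry (snd u) (Suc i)"
  shows "snd (lab u i) - snd (lab u (Suc i)) = axial (sigma (snd u) i) (fst u)"
    "1 \<le> sigma (snd u) i" "sigma (snd u) i < N"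
proof -
  have n: "length (snd u) = N" using assms by (simp add: valid_def)
  have s: "sigma (snd u) (Suc i) = Suc (sigma (snd u) i)" using assms n by (intro sigma_Suc) auto
  then show "snd (lab u i) - snd (lab u (Suc i)) = axial (sigma (snd u) i) (fst u)"
    by (simp add: lab_def axial_def)
  show "1 \<le> sigma (snd u) i" "sigma (snd u) i < N"
    using sigma_range[of i "snd u"] sigma_range[of "Suc i" "snd u"] s n assms by auto
qed

lemma lab_cases:
  assumes "valid u" "1 \<le> i" "i < N"
  shows "up i u \<or> dn i u \<or> adjacent (lab u i) (lab u (Suc i))"
proof (cases "entry (snd u) i = entry (snd u) (Suc i)")
  case True
  have "rst (fst u)" using assms by (simp add: valid_def)
  then show ?thesis
    using lab_Suc_equal[OF assms True] True axial_trichotomy[of "fst u" "sigma (snd u) i"]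
    by (auto simp: prec_def adjacent_def lab_def)
next
  case False
  then show ?thesis by (auto simp: prec_def lab_def)
qed

lemma valid_step:
  assumes "valid u" "1 \<le> i" "i < N" "up i u \<or> dn i u"
  shows "valid (step i u)"
proof (cases "entry (snd u) i = entry (snd u) (Suc i)")
  case True
  have "rst (interchange (sigma (snd u) i) (fst u))"
    using lab_Suc_equal[OF assms(1-3) True] True assms
    by (intro rst_interchange) (auto simp: valid_def prec_def lab_def)
  then show ?thesis using assms True by (simp add: valid_def step_def)
qed (use assms in \<open>auto simp: valid_def step_def\<close>)

text \<open>The first components spell v; then \<sigma> runs over 1, ..., N, so the second
  components give all contents of the tableau. The common starting points of two paths are
  identified in this way.\<close>

lemma valid_eqI:
  assumes "valid u" "valid w" "\<And>k. 1 \<le> k \<Longrightarrow> k \<le> N \<Longrightarrow> lab u k = lab w k"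
  shows "u = w"
proof -
  have n: "length (snd u) = N" "length (snd w) = N" using assms by (auto simp: valid_def)
  have v: "snd u = snd w"
  proof (rule nth_equalityI)
    fix k assume "k < length (snd u)"
    then show "snd u ! k = snd w ! k" using assms(3)[of "Suc k"] n by (simp add: lab_def)
  qed (use n in auto)
  have "fst u = fst w"
  proof (rule rst_eqI_CT)
    fix a assume "1 \<le> a" "a \<le> N"
    then have "a \<in> sigma (snd u) ` {1..N}"
      using bij_betw_sigma[of "snd u"] n by (auto simp: bij_betw_def)
    then obtain k where k: "1 \<le> k" "k \<le> N" "a = sigma (snd u) k" by auto
    then show "CT (fst u) a = CT (fst w) a"
      using assms(3)[of k] v by (simp add: lab_def)
  qed (use assms in \<open>auto simp: valid_def\<close>)
  with v show ?thesis by (simp add: prod_eq_iff)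
qed

lemma step_step:
  assumes "valid u" "1 \<le> i" "i < N" "up i u \<or> dn i u"
  shows "step i (step i u) = u"
proof (rule valid_eqI)
  have l: "lab (step i u) i = lab u (Suc i)" "lab (step i u) (Suc i) = lab u i"
    using assms by (simp_all add: lab_step)
  then show "valid (step i (step i u))"
    using valid_step[OF assms] assms by (intro valid_step) auto
  fix k assume "1 \<le> k" "k \<le> N"
  then show "lab (step i (step i u)) k = lab u k"
    using assms valid_step[OF assms] transpose_Suc_range[of i N k] by (simp add: lab_step)
qed (use assms in auto)

lemma valid_psi: "valid u \<Longrightarrow> 0 < N \<Longrightarrow> valid (psi u)"
  by (auto simp: valid_def psi_def)

lemma lab_psi:
  assumes "valid u" "1 \<le> k" "k \<le> N"
  shows "lab (psi u) k = (if k = N then (Suc (fst (lab u 1)), snd (lab u 1)) else lab u (Suc k))"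
proof -
  have "snd u \<noteq> []" "length (snd u) = N" using assms by (auto simp: valid_def)
  then show ?thesis using assms by (simp add: lab_def psi_def entry_vpsi sigma_vpsi)
qed

lemma fst_lab_N: "valid u \<Longrightarrow> 0 < N \<Longrightarrow> fst (lab u N) = last (snd u)"
  by (auto simp: lab_def valid_def last_conv_nth)

lemma unpsi:
  assumes "valid u" "0 < N" "0 < fst (lab u N)"
  shows "valid (unpsi u)" "psi (unpsi u) = u"
proof -
  have n: "length (snd u) = N" "snd u \<noteq> []" using assms by (auto simp: valid_def)
  have l: "0 < last (snd u)" using assms fst_lab_N by simp
  show "valid (unpsi u)" using assms n by (simp add: valid_def unpsi_def)
  show "psi (unpsi u) = u"
    using l n by (simp add: psi_def unpsi_def vpsi_def prod_eq_iff)
qed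

lemma unpsi_psi: "valid u \<Longrightarrow> 0 < N \<Longrightarrow> unpsi (psi u) = u"
  by (cases "snd u") (auto simp: valid_def psi_def unpsi_def vpsi_def prod_eq_iff)

lemma lab_unpsi:
  assumes "valid u" "0 < N" "0 < fst (lab u N)" "1 \<le> k" "k \<le> N"
  shows "lab (unpsi u) k = (if k = 1 then (fst (lab u N) - 1, snd (lab u N)) else lab u (k - 1))"
proof (cases "k = 1")
  case True
  have "lab u N = lab (psi (unpsi u)) N" using unpsi[OF assms(1-3)] by simp
  also have "\<dots> = (Suc (fst (lab (unpsi u) 1)), snd (lab (unpsi u) 1))"
    using unpsi[OF assms(1-3)] assms by (subst lab_psi) auto
  finally show ?thesis using True by (simp add: prod_eq_iff)
next
  case False
  have "lab u (k - 1) = lab (psi (unpsi u)) (k - 1)" using unpsi[OF assms(1-3)] by simp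
  also have "\<dots> = lab (unpsi u) k"
    using unpsi[OF assms(1-3)] assms False by (subst lab_psi) auto
  finally show ?thesis using False by simp
qed

section \<open>Edges in terms of labels\<close>

lemma arrow_S_iff:
  assumes "valid u"
  shows "arrow lam (Some u) (S_edge i) (Some w) \<longleftrightarrow> 1 \<le> i \<and> i < N \<and> up i u \<and> w = step i u"
proof -
  obtain \<tau> v where u: "u = (\<tau>, v)" by fastforce
  have n: "length v = N" using assms u by (simp add: valid_def)
  have s: "sigma v (Suc i) = Suc (sigma v i)" if "1 \<le> i" "i < N" "entry v i = entry v (Suc i)"
    using that n by (intro sigma_Suc) auto
  show ?thesis
  proof
    assume "arrow lam (Some u) (S_edge i) (Some w)"
    then show "1 \<le> i \<and> i < N \<and> up i u \<and> w = step i u"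
    proof cases
      case (swap v' \<tau>')
      then show ?thesis using u by (simp add: sum_list_lam prec_def lab_def step_def)
    next
      case (inter v' \<tau>')
      then show ?thesis using u s by (simp add: sum_list_lam prec_def lab_def step_def flip: Suc_eq_plus1)
    qed
  next
    assume h: "1 \<le> i \<and> i < N \<and> up i u \<and> w = step i u"
    show "arrow lam (Some u) (S_edge i) (Some w)"
    proof (cases "entry v i = entry v (Suc i)")
      case True
      then have "arrow lam (Some (\<tau>, v)) (S_edge i) (Some (interchange (sigma v i) \<tau>, v))"
        using h u s by (intro arrow.inter) (auto simp: sum_list_lam prec_def lab_def simp flip: Suc_eq_plus1)
      then show ?thesis using h u True by (simp add: step_def)
    next
      case False
      then have "arrow lam (Some (\<tau>, v)) (S_edge i) (Some (\<tau>, vswap i v))"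
        using h u by (intro arrow.swap) (auto simp: sum_list_lam prec_def lab_def)
      then show ?thesis using h u False by (simp add: step_def)
    qed
  qed
qed

lemma arrow_Psi_iff:
  assumes "valid u"
  shows "arrow lam (Some u) Psi_edge w \<longleftrightarrow> 0 < N \<and> w = Some (psi u)"
proof -
  have n: "snd u \<noteq> [] \<longleftrightarrow> 0 < N" using assms by (auto simp: valid_def)
  show ?thesis
  proof
    assume "arrow lam (Some u) Psi_edge w"
    then show "0 < N \<and> w = Some (psi u)" using n by cases (auto simp: psi_def)
  next
    assume h: "0 < N \<and> w = Some (psi u)"
    then have "snd u \<noteq> []" using n by simp
    then have "arrow lam (Some (fst u, snd u)) Psi_edge (Some (fst u, vpsi (snd u)))"
      by (rule arrow.psi)
    then show "arrow lam (Some u) Psi_edge w" using h by (simp add: psi_def)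
  qed
qed

lemma arrow_valid:
  assumes "arrow lam (Some u) l (Some w)" "valid u"
  shows "valid w"
proof (cases l)
  case Psi_edge
  then show ?thesis using assms arrow_Psi_iff valid_psi by auto
next
  case (S_edge i)
  then show ?thesis using assms arrow_S_iff[OF assms(2), of i w] valid_step by auto
qed

lemma valid_root: "valid (root_vertex lam)"
  by (simp add: valid_def root_vertex_def rst_tau_shape sum_list_lam)

lemma reachable_valid:
  assumes "Some u \<in> reachable lam"
  shows "valid u"
proof -
  have "\<forall>u. x = Some u \<longrightarrow> valid u" if "x \<in> reachable lam" for x
    using that
  proof induction
    case root
    then show ?case by (simp add: valid_root)
  next
    case (step x l w)
    show ?case
    proof (intro allI impI)
      fix u assume w: "w = Some u"
      obtain u' where u': "x = Some u'" using step(2) by cases auto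
      then show "valid u" using arrow_valid step w by blast
    qed
  qed
  then show ?thesis using assms by blast
qed

section \<open>Well-founded descent\<close>

definition ct_bound :: nat where
  "ct_bound = (\<Sum>p\<in>cells lam. fst p + snd p)"

lemma abs_CT_le:
  assumes "rst \<tau>" "1 \<le> a" "a \<le> N"
  shows "\<bar>CT \<tau> a\<bar> \<le> int ct_bound"
proof -
  obtain p where p: "p \<in> cells lam" "\<tau> p = a" using rst_cell[OF assms] by blast
  have "fst p + snd p \<le> ct_bound"
    unfolding ct_bound_def using p finite_cells by (intro member_le_sum[of p]) auto
  moreover have "CT \<tau> a = int (snd p) - int (fst p)"
    using CT_rst[of \<tau> "fst p" "snd p"] assms p by simp
  ultimately show ?thesis by linarith
qed

text \<open>Encodes labels by naturals so that \<sqsubset> becomes <. Contents vary by at most 2B,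
  where B is \<open>ct_bound\<close>, so the factor 2B + 1 lets the first component dominate; the
  summand B keeps the value nonnegative.\<close>

definition height :: "nat \<times> int \<Rightarrow> nat" where
  "height x = nat (int (fst x) * (2 * int ct_bound + 1) + int ct_bound - snd x)"

lemma height_strict_mono:
  assumes "x \<sqsubset> y" "\<bar>snd x\<bar> \<le> int ct_bound" "\<bar>snd y\<bar> \<le> int ct_bound"
  shows "height x < height y"
proof -
  let ?B = "int ct_bound"
  have nonneg: "0 \<le> int (fst x) * (2 * ?B + 1)" by simp
  have "int (fst x) * (2 * ?B + 1) - snd x < int (fst y) * (2 * ?B + 1) - snd y"
  proof (cases "fst x = fst y")
    case False
    then have "int (fst x) + 1 \<le> int (fst y)" using assms by (simp add: prec_def)
    then have "(int (fst x) + 1) * (2 * ?B + 1) \<le> int (fst y) * (2 * ?B + 1)"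
      by (intro mult_right_mono) auto
    then show ?thesis using assms by (simp add: algebra_simps)
  qed (use assms in \<open>auto simp: prec_def\<close>)
  then show ?thesis using nonneg assms unfolding height_def by (subst zless_nat_conj) linarith
qed

lemma abs_snd_lab_le:
  assumes "valid u" "1 \<le> k" "k \<le> N"
  shows "\<bar>snd (lab u k)\<bar> \<le> int ct_bound"
  using assms sigma_range[of k "snd u"] by (auto simp: lab_def valid_def intro!: abs_CT_le)

text \<open>Exchanging neighbouring labels changes this sum by the difference of their weights times
  that of their heights. Weights N - k make it fall along descents, weights k along ascents, which
  gives both termination arguments.\<close>

definition wsum :: "(nat \<Rightarrow> nat) \<Rightarrow> vertex \<Rightarrow> nat" where
  "wsum wt u = (\<Sum>k\<in>{1..N}. wt k * height (lab u k))"

text \<open>The terms at i and i+1 are moved to both sides to avoid subtraction of naturals.\<close>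

lemma sum_transpose:
  fixes f :: "nat \<Rightarrow> nat \<Rightarrow> nat"
  assumes "1 \<le> i" "i < n"
  shows "(\<Sum>k\<in>{1..n}. f k (transpose i (Suc i) k)) + (f i i + f (Suc i) (Suc i))
    = (\<Sum>k\<in>{1..n}. f k k) + (f i (Suc i) + f (Suc i) i)"
proof -
  have A: "{1..n} = insert i (insert (Suc i) ({1..n} - {i, Suc i}))" using assms by auto
  have "(\<Sum>k\<in>{1..n} - {i, Suc i}. f k (transpose i (Suc i) k)) = (\<Sum>k\<in>{1..n} - {i, Suc i}. f k k)"
    by (rule sum.cong) (auto simp: transpose_def)
  then show ?thesis by (subst (1 2) A) simp
qed

lemma wsum_step:
  assumes "valid u" "1 \<le> i" "i < N"
  shows "wsum wt (step i u) + (wt i * height (lab u i) + wt (Suc i) * height (lab u (Suc i)))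
    = wsum wt u + (wt i * height (lab u (Suc i)) + wt (Suc i) * height (lab u i))"
proof -
  have "wsum wt (step i u) = (\<Sum>k\<in>{1..N}. wt k * height (lab u (transpose i (Suc i) k)))"
    unfolding wsum_def using assms by (intro sum.cong) (auto simp: lab_step)
  then show ?thesis
    using sum_transpose[OF assms(2,3), of "\<lambda>k l. wt k * height (lab u l)"] by (simp add: wsum_def)
qed

lemma height_lab_less:
  assumes "valid u" "1 \<le> k" "k \<le> N" "1 \<le> l" "l \<le> N" "lab u k \<sqsubset> lab u l"
  shows "height (lab u k) < height (lab u l)"
  using assms abs_snd_lab_le by (intro height_strict_mono) auto

text \<open>Lexicographic, because undoing \<open>psi\<close> lowers the sum of the entries but
  moves every label, whereas undoing s_i keeps that sum and lowers the weighted heights.\<close>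

definition descent :: "(vertex \<times> vertex) set" where
  "descent = measures [\<lambda>u. sum_list (snd u), wsum (\<lambda>k. N - k)]"

lemma wf_descent: "wf descent"
  by (simp add: descent_def)

lemma sum_list_snd_step:
  assumes "valid u" "1 \<le> i" "i < N"
  shows "sum_list (snd (step i u)) = sum_list (snd u)"
proof -
  have n: "length (snd u) = N" using assms by (simp add: valid_def)
  have "mset (vswap i (snd u)) = mset (snd u)"
    using mset_swap[of i "snd u" "i - 1"] assms n by (simp add: vswap_def)
  then have "sum_list (vswap i (snd u)) = sum_list (snd u)" by (metis sum_mset_sum_list)
  then show ?thesis by (simp add: step_def)
qed

lemma descent_step:
  assumes "valid u" "1 \<le> i" "i < N" "dn i u"
  shows "(step i u, u) \<in> descent"
proof -
  have wt: "N - i = Suc (N - Suc i)" using assms by simp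
  have "height (lab u (Suc i)) < height (lab u i)" using assms by (intro height_lab_less) auto
  then have "wsum (\<lambda>k. N - k) (step i u) < wsum (\<lambda>k. N - k) u"
    using wsum_step[OF assms(1-3), of "\<lambda>k. N - k"] unfolding wt by simp
  then show ?thesis using sum_list_snd_step[OF assms(1-3)] by (simp add: descent_def)
qed

lemma descent_unpsi:
  assumes "valid u" "0 < N" "0 < fst (lab u N)"
  shows "(unpsi u, u) \<in> descent"
proof -
  have ne: "snd u \<noteq> []" and l: "0 < last (snd u)"
    using assms fst_lab_N by (auto simp: valid_def)
  have "sum_list (snd u) = sum_list (butlast (snd u) @ [last (snd u)])" using ne by simp
  also have "\<dots> = sum_list (butlast (snd u)) + last (snd u)" by (simp only: sum_list_append) simp
  finally have "sum_list (snd (unpsi u)) < sum_list (snd u)" using l by (simp add: unpsi_def)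
  then show ?thesis by (simp add: descent_def)
qed

lemma ascent_induct [consumes 1, case_names step]:
  assumes "valid u"
    and "\<And>u. valid u \<Longrightarrow> (\<And>i. 1 \<le> i \<Longrightarrow> i < N \<Longrightarrow> up i u \<Longrightarrow> Q (step i u)) \<Longrightarrow> Q u"
  shows "Q u"
  using assms(1)
proof (induction u rule: measure_induct_rule[of "wsum (\<lambda>k. k)"])
  case (less u)
  show ?case
  proof (rule assms(2)[OF less.prems])
    fix i assume i: "1 \<le> i" "i < N" "up i u"
    have "height (lab u i) < height (lab u (Suc i))" using i less.prems by (intro height_lab_less) auto
    then have "wsum (\<lambda>k. k) (step i u) < wsum (\<lambda>k. k) u"
      using wsum_step[OF less.prems i(1,2), of "\<lambda>k. k"] by simp
    then show "Q (step i u)" using less.IH valid_step[OF less.prems i(1,2)] i by blast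
  qed
qed

section \<open>Sources and sinks\<close>

text \<open>Cells with equal T occupy an interval of entries because \<tau> respects T, so it
  suffices to compare f on consecutive entries and to chain; g settles equal f. It is applied with
  column before row at a source and row before column at a sink.\<close>

lemma sorted_order:
  fixes f g :: "nat \<times> nat \<Rightarrow> nat"
  assumes \<tau>: "rst \<tau>"
    and mono: "\<And>p q. p \<in> cells lam \<Longrightarrow> q \<in> cells lam \<Longrightarrow> \<tau> q < \<tau> p \<Longrightarrow> T p \<le> T q"
    and cons: "\<And>p q. p \<in> cells lam \<Longrightarrow> q \<in> cells lam \<Longrightarrow> \<tau> q = Suc (\<tau> p) \<Longrightarrow> T p = T q \<Longrightarrow> f q \<le> f p"
    and tie: "\<And>p q. p \<in> cells lam \<Longrightarrow> q \<in> cells lam \<Longrightarrow> f p = f q \<Longrightarrow> \<tau> q < \<tau> p \<Longrightarrow> g p < g q"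
    and pq: "p \<in> cells lam" "q \<in> cells lam"
  shows "\<tau> q < \<tau> p \<longleftrightarrow> T p < (T q :: nat) \<or> (T p = T q \<and> (f p < f q \<or> (f p = f q \<and> g p < g q)))"
proof -
  have chain: "f p \<le> f q" if "p \<in> cells lam" "q \<in> cells lam" "\<tau> q < \<tau> p" "T p = T q" for p q
    using that
  proof (induction "\<tau> p" arbitrary: p rule: less_induct)
    case less
    show ?case
    proof (cases "\<tau> p = Suc (\<tau> q)")
      case True
      then show ?thesis using cons[of q p] less.prems by simp
    next
      case False
      then have b: "\<tau> q < \<tau> p - 1" "1 \<le> \<tau> p - 1" "\<tau> p - 1 \<le> N"
        using less.prems rst_range[OF \<tau>, of p] by auto
      obtain p' where p': "p' \<in> cells lam" "\<tau> p' = \<tau> p - 1" using rst_cell[OF \<tau> b(2,3)] by blast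
      have T: "T p \<le> T p'" "T p' \<le> T q"
        using mono[of p p'] mono[of p' q] less.prems p' b by auto
      then have "f p' \<le> f q" using less.hyps[of p'] less.prems p' b by auto
      moreover have "f p \<le> f p'" using cons[of p' p] p' less.prems T b by auto
      ultimately show ?thesis by simp
    qed
  qed
  have fwd: "T p < T q \<or> (T p = T q \<and> (f p < f q \<or> (f p = f q \<and> g p < g q)))"
    if "p \<in> cells lam" "q \<in> cells lam" "\<tau> q < \<tau> p" for p q
    using mono[OF that] chain[OF that] tie[OF that(1,2) _ that(3)] by linarith
  show ?thesis
  proof
    assume r: "T p < T q \<or> (T p = T q \<and> (f p < f q \<or> (f p = f q \<and> g p < g q)))"
    show "\<tau> q < \<tau> p"
    proof (rule ccontr)
      assume "\<not> \<tau> q < \<tau> p"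
      moreover have "\<tau> p \<noteq> \<tau> q" using rst_inj[OF \<tau> pq(2), of p] r by auto
      ultimately have "\<tau> p < \<tau> q" by simp
      from fwd[OF pq(2,1) this] r show False by linarith
    qed
  qed (use fwd pq in blast)
qed

lemma rst_rank:
  assumes "rst \<tau>" "p \<in> cells lam"
  shows "\<tau> p = N - card {q \<in> cells lam. \<tau> p < \<tau> q}"
proof -
  have b: "bij_betw \<tau> (cells lam) {1..N}" by (rule rst_bij[OF assms(1)])
  then have "\<tau> ` {q \<in> cells lam. \<tau> p < \<tau> q} = {\<tau> p<..N}"
  proof (intro equalityI subsetI)
    fix a assume a: "a \<in> {\<tau> p<..N}"
    then obtain q where "q \<in> cells lam" "\<tau> q = a" using rst_cell[OF assms(1), of a] by auto
    then show "a \<in> \<tau> ` {q \<in> cells lam. \<tau> p < \<tau> q}" using a by auto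
  qed (use rst_range[OF assms(1)] in auto)
  moreover have "inj_on \<tau> {q \<in> cells lam. \<tau> p < \<tau> q}"
    using b by (auto simp: bij_betw_def intro: inj_on_subset)
  ultimately have "card {q \<in> cells lam. \<tau> p < \<tau> q} = N - \<tau> p"
    using card_image by fastforce
  then show ?thesis using rst_range[OF assms] by simp
qed

lemma rst_eqI_order:
  assumes "rst \<tau>" "rst \<tau>'"
    and "\<And>p q. p \<in> cells lam \<Longrightarrow> q \<in> cells lam \<Longrightarrow> \<tau> q < \<tau> p \<longleftrightarrow> \<tau>' q < \<tau>' p"
  shows "\<tau> = \<tau>'"
proof
  fix p
  show "\<tau> p = \<tau>' p"
  proof (cases "p \<in> cells lam")
    case True
    then have "{q \<in> cells lam. \<tau> p < \<tau> q} = {q \<in> cells lam. \<tau>' p < \<tau>' q}"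
      using assms(3) by blast
    then show ?thesis using rst_rank[OF assms(1) True] rst_rank[OF assms(2) True] by simp
  qed (simp add: rst_outside assms(1,2))
qed

lemma T_of_cell: "p \<in> cells lam \<Longrightarrow> T_of lam u p = entry (vplus (snd u)) (fst u p)"
  by (cases u) (simp add: T_of_def)

lemma T_of_mono:
  assumes "valid u" "p \<in> cells lam" "q \<in> cells lam" "fst u q < fst u p"
  shows "T_of lam u p \<le> T_of lam u q"
  using assms rst_range[of "fst u" p] rst_range[of "fst u" q]
  by (auto simp: T_of_cell valid_def intro!: vplus_antimono)

text \<open>If \<open>v\<close> is monotone, equal entries are consecutive, so neighbouring entries of a block of the
  tableau sit at neighbouring positions of \<open>v\<close>.\<close>

lemma block_position:
  assumes u: "valid u" and v: "sorted (snd u) \<or> sorted (rev (snd u))"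
    and p: "p \<in> cells lam" "q \<in> cells lam" "fst u q = Suc (fst u p)" "T_of lam u p = T_of lam u q"
  obtains k where "1 \<le> k" "k < N" "sigma (snd u) k = fst u p" "entry (snd u) k = entry (snd u) (Suc k)"
proof -
  define v where "v = snd u"
  have n: "length v = N" and \<tau>: "rst (fst u)" using u by (auto simp: valid_def v_def)
  have s: "sigma v ` {1..N} = {1..N}" using bij_betw_sigma[of v] n by (simp add: bij_betw_def)
  have "fst u p \<in> sigma v ` {1..N}" "fst u q \<in> sigma v ` {1..N}"
    using rst_range[OF \<tau> p(1)] rst_range[OF \<tau> p(2)] p(3) s by auto
  then obtain k k' where k: "1 \<le> k" "k \<le> N" "sigma v k = fst u p" and k': "1 \<le> k'" "k' \<le> N" "sigma v k' = fst u q"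
    by auto
  have "T_of lam u p = entry v k" "T_of lam u q = entry v k'"
    using k k' p n vplus_sigma[of k v] vplus_sigma[of k' v] by (simp_all add: T_of_cell v_def)
  then have eq: "entry v k = entry v k'" using p by simp
  have "k < k'"
  proof (rule ccontr)
    assume "\<not> k < k'"
    moreover have "k \<noteq> k'" using k k' p by auto
    ultimately have "sigma v k' < sigma v k"
      using eq k k' n by (intro sigma_strict_mono) (auto simp: weakly_before_def)
    then show False using k k' p by simp
  qed
  \<comment> \<open>The positions k and k' need not be neighbours; monotonicity traps the entry at
    k+1 between two equal entries.\<close>
  have mono: "sorted v \<Longrightarrow> entry v k \<le> entry v (Suc k) \<and> entry v (Suc k) \<le> entry v k'"
    using k k' \<open>k < k'\<close> n by (auto intro!: sorted_nth_mono)
  have anti: "sorted (rev v) \<Longrightarrow> entry v k' \<le> entry v (Suc k) \<and> entry v (Suc k) \<le> entry v k"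
    using k k' \<open>k < k'\<close> n by (auto intro!: sorted_rev_nth_mono)
  have "entry v k = entry v (Suc k)" using mono anti v eq unfolding v_def by linarith
  then show ?thesis using that k k' \<open>k < k'\<close> v_def by simp
qed

text \<open>The order in which a source numbers the cells from N downwards;
  \<open>row_order\<close>, the reading order in \<open>std\<close>, plays that role at a
  sink.\<close>

definition col_order :: "tab \<Rightarrow> nat \<times> nat \<Rightarrow> nat \<times> nat \<Rightarrow> bool" where
  "col_order T p q \<longleftrightarrow> T p < T q \<or> (T p = T q \<and> (snd p < snd q \<or> (snd p = snd q \<and> fst p < fst q)))"

definition row_order :: "tab \<Rightarrow> nat \<times> nat \<Rightarrow> nat \<times> nat \<Rightarrow> bool" where
  "row_order T p q \<longleftrightarrow> T p < T q \<or> (T p = T q \<and> (fst p < fst q \<or> (fst p = fst q \<and> snd p < snd q)))"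

lemma sorted_if_entries:
  assumes "\<And>k. 1 \<le> k \<Longrightarrow> k < length v \<Longrightarrow> entry v k \<le> entry v (Suc k)"
  shows "sorted v"
  unfolding sorted_iff_nth_Suc
proof (intro allI impI)
  fix i assume "Suc i < length v"
  then show "v ! i \<le> v ! Suc i" using assms[of "Suc i"] by simp
qed

lemma source_structure:
  assumes u: "valid u" and no: "\<And>k. 1 \<le> k \<Longrightarrow> k < N \<Longrightarrow> \<not> dn k u"
  shows "sorted (snd u)"
    and "\<And>p q. p \<in> cells lam \<Longrightarrow> q \<in> cells lam \<Longrightarrow> fst u q < fst u p \<longleftrightarrow> col_order (T_of lam u) p q"
proof -
  have n: "length (snd u) = N" and \<tau>: "rst (fst u)" using u by (auto simp: valid_def)
  show so: "sorted (snd u)"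
  proof (rule sorted_if_entries)
    fix k assume "1 \<le> k" "k < length (snd u)"
    then have "\<not> dn k u" using no n by simp
    then show "entry (snd u) k \<le> entry (snd u) (Suc k)" by (auto simp: prec_def lab_def)
  qed
  show "fst u q < fst u p \<longleftrightarrow> col_order (T_of lam u) p q" if "p \<in> cells lam" "q \<in> cells lam" for p q
    unfolding col_order_def
  proof (rule sorted_order[OF \<tau>])
    fix p q assume pq: "p \<in> cells lam" "q \<in> cells lam" "fst u q = Suc (fst u p)" "T_of lam u p = T_of lam u q"
    obtain k where k: "1 \<le> k" "k < N" "sigma (snd u) k = fst u p" "entry (snd u) k = entry (snd u) (Suc k)"
      using block_position[OF u _ pq] so by blast
    \<comment> \<open>A distance of at most -2 would give a descent at k, and it is the only
      configuration in which the larger of two consecutive entries lies strictly further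
      right.\<close>
    have "\<not> axial (fst u p) (fst u) \<le> -2"
      using no[OF k(1,2)] lab_Suc_equal[OF u k(1,2,4)] k by (auto simp: prec_def lab_def)
    then show "snd q \<le> snd p"
      using pq by - (rule axial_cases[OF \<tau>, of "fst p" "snd p" "fst q" "snd q" "fst u p"], auto)
  next
    fix p q assume pq: "p \<in> cells lam" "q \<in> cells lam" "snd p = snd q" "fst u q < fst u p"
    show "fst p < fst q"
    proof (rule ccontr)
      assume "\<not> fst p < fst q"
      then have "fst u p \<le> fst u q"
        using rst_antimono[OF \<tau>, of "fst q" "snd q" "fst p" "snd p"] pq by (cases p, cases q) simp
      then show False using pq by simp
    qed
  qed (use that T_of_mono[OF u] in auto)
qed

lemma sink_structure:
  assumes u: "valid u" and no: "\<And>k. 1 \<le> k \<Longrightarrow> k < N \<Longrightarrow> \<not> up k u"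
  shows "sorted (rev (snd u))"
    and "\<And>p q. p \<in> cells lam \<Longrightarrow> q \<in> cells lam \<Longrightarrow> fst u q < fst u p \<longleftrightarrow> row_order (T_of lam u) p q"
proof -
  have n: "length (snd u) = N" and \<tau>: "rst (fst u)" using u by (auto simp: valid_def)
  show so: "sorted (rev (snd u))"
    unfolding sorted_rev_iff_nth_Suc
  proof (intro allI impI)
    fix i assume "Suc i < length (snd u)"
    then have "\<not> up (Suc i) u" using no[of "Suc i"] n by simp
    then show "snd u ! Suc i \<le> snd u ! i" by (auto simp: prec_def lab_def)
  qed
  show "fst u q < fst u p \<longleftrightarrow> row_order (T_of lam u) p q" if "p \<in> cells lam" "q \<in> cells lam" for p q
    unfolding row_order_def
  proof (rule sorted_order[OF \<tau>])
    fix p q assume pq: "p \<in> cells lam" "q \<in> cells lam" "fst u q = Suc (fst u p)" "T_of lam u p = T_of lam u q"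
    obtain k where k: "1 \<le> k" "k < N" "sigma (snd u) k = fst u p" "entry (snd u) k = entry (snd u) (Suc k)"
      using block_position[OF u _ pq] so by blast
    have "\<not> 2 \<le> axial (fst u p) (fst u)"
      using no[OF k(1,2)] lab_Suc_equal[OF u k(1,2,4)] k by (auto simp: prec_def lab_def)
    then show "fst q \<le> fst p"
      using pq by - (rule axial_cases[OF \<tau>, of "fst p" "snd p" "fst q" "snd q" "fst u p"], auto)
  next
    fix p q assume pq: "p \<in> cells lam" "q \<in> cells lam" "fst p = fst q" "fst u q < fst u p"
    show "snd p < snd q"
    proof (rule ccontr)
      assume "\<not> snd p < snd q"
      then have "fst u p \<le> fst u q"
        using rst_antimono[OF \<tau>, of "fst q" "snd q" "fst p" "snd p"] pq by (cases p, cases q) simp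
      then show False using pq by simp
    qed
  qed (use that T_of_mono[OF u] in auto)
qed

lemma tau_shape_order:
  assumes "p \<in> cells lam" "q \<in> cells lam"
  shows "tau_shape lam q < tau_shape lam p \<longleftrightarrow> col_order (\<lambda>_. 0) p q"
  unfolding col_order_def
proof (rule sorted_order[OF rst_tau_shape])
  fix p q assume pq: "p \<in> cells lam" "q \<in> cells lam" "tau_shape lam q = Suc (tau_shape lam p)"
  then show "snd q \<le> snd p"
    using tau_shape_col_mono[of "fst p" "snd p" "fst q" "snd q"] by simp
next
  fix p q assume pq: "p \<in> cells lam" "q \<in> cells lam" "snd p = snd q" "tau_shape lam q < tau_shape lam p"
  show "fst p < fst q"
  proof (rule ccontr)
    assume "\<not> fst p < fst q"
    then have "tau_shape lam p \<le> tau_shape lam q"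
      using rst_antimono[OF rst_tau_shape, of "fst q" "snd q" "fst p" "snd p"] pq by (cases p, cases q) simp
    then show False using pq by simp
  qed
qed (use assms in auto)

text \<open>Without descents v is increasing, hence 0 as its last entry is 0, and the cells are then
  numbered by columns, which is \<open>tau_shape\<close>. Thus a backward search stops at the root
  only, which drives reachability and existence.\<close>

lemma exists_dn:
  assumes u: "valid u" "u \<noteq> root_vertex lam" "0 < N \<Longrightarrow> fst (lab u N) = 0"
  shows "\<exists>k. 1 \<le> k \<and> k < N \<and> dn k u"
proof (rule ccontr)
  assume "\<not> ?thesis"
  then have no: "\<And>k. 1 \<le> k \<Longrightarrow> k < N \<Longrightarrow> \<not> dn k u" by blast
  note ss = source_structure[OF u(1) no]
  have n: "length (snd u) = N" and \<tau>: "rst (fst u)" using u by (auto simp: valid_def)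
  have "snd u ! k = 0" if "k < N" for k
    using sorted_nth_mono[OF ss(1), of k "N - 1"] that n u(3) by (simp add: lab_def)
  then have v: "snd u = replicate N 0" using n by (intro nth_equalityI) auto
  have T: "T_of lam u p = 0" if "p \<in> cells lam" for p
  proof -
    have "fst u p - 1 < N" using rst_range[OF \<tau> that] by linarith
    then show ?thesis using that by (simp add: T_of_cell v vplus_def sort_replicate)
  qed
  have "fst u = tau_shape lam"
  proof (rule rst_eqI_order[OF \<tau> rst_tau_shape])
    fix p q assume "p \<in> cells lam" "q \<in> cells lam"
    then show "fst u q < fst u p \<longleftrightarrow> tau_shape lam q < tau_shape lam p"
      using ss(2) tau_shape_order T by (simp add: col_order_def)
  qed
  then show False using u(2) v by (simp add: root_vertex_def sum_list_lam prod_eq_iff)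
qed

lemma valid_descent_induct [consumes 1, case_names step]:
  assumes "valid u"
    and "\<And>u. valid u \<Longrightarrow> (\<And>w. valid w \<Longrightarrow> (w, u) \<in> descent \<Longrightarrow> Q w) \<Longrightarrow> Q u"
  shows "Q u"
  using assms(1) by (induction u rule: wf_induct_rule[OF wf_descent]) (use assms(2) in blast)

lemma up_step_iff:
  assumes "valid u" "1 \<le> i" "i < N"
  shows "up i (step i u) \<longleftrightarrow> dn i u" "dn i (step i u) \<longleftrightarrow> up i u"
  using assms by (simp_all add: lab_step)

lemma valid_reachable: "valid u \<Longrightarrow> Some u \<in> reachable lam"
proof (induction u rule: valid_descent_induct)
  case (step u)
  show ?case
  proof (cases "u = root_vertex lam")
    case True
    then show ?thesis by (simp add: reachable.root)
  next
    case False
    show ?thesis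
    proof (cases "0 < N \<and> 0 < fst (lab u N)")
      case True
      note up = unpsi[OF step(1)]
      have "Some (unpsi u) \<in> reachable lam"
        using step(2)[of "unpsi u"] descent_unpsi[OF step(1)] up True by simp
      moreover have "arrow lam (Some (unpsi u)) Psi_edge (Some u)"
        using arrow_Psi_iff[OF up(1)] up(2) True by auto
      ultimately show ?thesis by (rule reachable.step)
    next
      case no: False
      have "0 < N \<Longrightarrow> fst (lab u N) = 0" using no by simp
      then obtain k where k: "1 \<le> k" "k < N" "dn k u"
        using exists_dn[OF step(1) False] by auto
      have v: "valid (step k u)" using valid_step[OF step(1) k(1,2)] k(3) by simp
      have "Some (step k u) \<in> reachable lam"
        using step(2)[OF v descent_step[OF step(1) k]] .
      moreover have "arrow lam (Some (step k u)) (S_edge k) (Some u)"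
        using arrow_S_iff[OF v, of k u] up_step_iff[OF step(1) k(1,2)] step_step[OF step(1) k(1,2)] k by simp
      ultimately show ?thesis by (rule reachable.step)
    qed
  qed
qed

lemma H_verts_iff: "u \<in> H_verts lam \<longleftrightarrow> valid u"
  using valid_reachable[of u] reachable_valid[of u] by (auto simp: H_verts_def G_verts_def)

lemma H_edge_iff: "H_edge lam u i w \<longleftrightarrow> valid u \<and> 1 \<le> i \<and> i < N \<and> up i u \<and> w = step i u"
  using arrow_S_iff[of u i w] H_verts_iff[of u] by (auto simp: H_edge_def G_edge_def H_verts_def)

end

section \<open>Intertwining operators\<close>

definition opS :: "nat \<Rightarrow> qalpha \<Rightarrow> tabpol \<Rightarrow> tabpol" where
  "opS i a P = diag_s i P + smul a P"

lemma opS_0 [simp]: "opS i a 0 = 0"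
  by (simp add: opS_def)

lemma opS_far:
  assumes "Suc (Suc i) \<le> j"
  shows "opS i a (opS j b P) = opS j b (opS i a P)"
  using diag_s_commute[OF assms, of P]
  by (simp add: opS_def diag_s_add diag_s_smul smul.scale_right_distrib algebra_simps)

lemma diag_word_0 [simp]: "diag_word ws 0 = 0"
  by (induction ws) (auto simp: diag_word_def)

lemma diag_word_add: "diag_word ws (P + Q) = diag_word ws P + diag_word ws Q"
  by (induction ws arbitrary: P Q) (auto simp: diag_word_def diag_s_add)

lemma diag_word_pmul: "diag_word ws (pmul f P) = pmul (fold pol_s ws f) (diag_word ws P)"
  by (induction ws arbitrary: f P) (auto simp: diag_word_def diag_s_pmul)

lemma diag_word_smul: "diag_word ws (smul c P) = smul c (diag_word ws P)"
  by (induction ws arbitrary: P) (auto simp: diag_word_def diag_s_smul)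

lemma diag_word_sum: "diag_word ws (sum g A) = (\<Sum>a\<in>A. diag_word ws (g a))"
  by (rule additive_sum) (auto simp: diag_word_add)

lemma diag_word_append: "diag_word (us @ vs) P = diag_word vs (diag_word us P)"
  by (simp add: diag_word_def)

lemma Psi_add: "Psi n (P + Q) = Psi n P + Psi n Q"
  by (simp add: Psi_def diag_word_add pmul_add)

lemma Psi_smul: "Psi n (smul c P) = smul c (Psi n P)"
  by (simp add: Psi_def diag_word_smul pmul_smul)

lemma Psi_0 [simp]: "Psi n 0 = 0"
  by (simp add: Psi_def)

lemma pol_s_pvar: "pol_s i (pvar k) = pvar (transpose i (Suc i) k)"
proof -
  have "mon_s i (single k 1) = single (transpose i (Suc i) k) 1"
    by (rule poly_mapping_eqI) (auto simp: lookup_single when_def transpose_eq_iff)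
  then show ?thesis unfolding pvar_def pol_s_single by simp
qed

lemma fold_pol_s_pvar: "fold pol_s ws (pvar k) = pvar (word_perm ws k)"
  by (induction ws arbitrary: k) (auto simp: pol_s_pvar word_perm_Cons)

lemma word_perm_cycle:
  "1 \<le> n \<Longrightarrow> word_perm [1..<n] k = (if k = 1 then n else if 1 < k \<and> k \<le> n then k - 1 else k)"
proof (induction n)
  case (Suc n)
  show ?case
  proof (cases "n = 0")
    case False
    then have "[1..<Suc n] = [1..<n] @ [n]" by simp
    then have "word_perm [1..<Suc n] k = transpose n (Suc n) (word_perm [1..<n] k)"
      by (simp add: word_perm_append)
    then show ?thesis using Suc False by (auto simp: transpose_def)
  qed auto
qed auto

context shape
begin

lemma Mod_diag_word: "P \<in> Mod \<Longrightarrow> set ws \<subseteq> {1..<N} \<Longrightarrow> diag_word ws P \<in> Mod"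
  unfolding diag_word_def by (rule coxeter_action.closed_word[OF coxeter_Mod])

lemma diag_word_cong:
  assumes "set us \<subseteq> {1..<N}" "set vs \<subseteq> {1..<N}" "word_perm us = word_perm vs" "P \<in> Mod"
  shows "diag_word us P = diag_word vs P"
  unfolding diag_word_def using assms by (rule coxeter_action.fold_eq_of_word_perm_eq[OF coxeter_Mod])

lemma Mod_opS: "P \<in> Mod \<Longrightarrow> 1 \<le> i \<Longrightarrow> i < N \<Longrightarrow> opS i a P \<in> Mod"
  unfolding opS_def by (intro Mod_add Mod_smul Mod_diag_s) auto

lemma Mod_Psi: "P \<in> Mod \<Longrightarrow> Psi N P \<in> Mod"
  unfolding Psi_def by (intro Mod_pmul Mod_diag_word) auto

text \<open>Once s_i s_i = 1 and the braid relation are applied, the two expansions differ only in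
  the coefficients of s_i and s_(i+1), where a c and b (a + c) have traded places.\<close>

lemma yang_baxter:
  assumes P: "P \<in> Mod" "1 \<le> i" "Suc i < N" and abc: "b * (a + c) = a * c"
  shows "opS i c (opS (Suc i) b (opS i a P)) = opS (Suc i) a (opS i b (opS (Suc i) c P))"
proof -
  let ?s = "diag_s i" and ?t = "diag_s (Suc i)"
  have br: "?s (?t (?s P)) = ?t (?s (?t P))" using P by (intro diag_s_braid) auto
  have L: "opS i c (opS (Suc i) b (opS i a P)) =
     ?s (?t (?s P)) + smul c (?t (?s P)) + smul a (?s (?t P)) + smul (b * (a + c)) (?s P) + smul (a * c) (?t P)
     + smul b P + smul (a * b * c) P"
    by (simp add: opS_def diag_s_add diag_s_smul smul.scale_right_distrib smul.scale_left_distrib algebra_simps)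
  have R: "opS (Suc i) a (opS i b (opS (Suc i) c P)) =
     ?t (?s (?t P)) + smul c (?t (?s P)) + smul a (?s (?t P)) + smul (a * c) (?s P) + smul (b * (a + c)) (?t P)
     + smul b P + smul (a * b * c) P"
    by (simp add: opS_def diag_s_add diag_s_smul smul.scale_right_distrib smul.scale_left_distrib algebra_simps)
  show ?thesis unfolding L R br abc by simp
qed

text \<open>The cycle \<theta> carries s_(i+1) to s_i, and s_i leaves x_N alone.\<close>

lemma opS_Psi:
  assumes "P \<in> Mod" "1 \<le> i" "Suc i < N"
  shows "opS i a (Psi N P) = Psi N (opS (Suc i) a P)"
proof -
  have "word_perm ([1..<N] @ [i]) = word_perm ([Suc i] @ [1..<N])"
  proof
    fix k
    show "word_perm ([1..<N] @ [i]) k = word_perm ([Suc i] @ [1..<N]) k"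
      using assms(2,3) unfolding word_perm_append
      by (simp add: word_perm_cycle transpose_def) auto
  qed
  then have "diag_word ([1..<N] @ [i]) P = diag_word ([Suc i] @ [1..<N]) P"
    using assms by (intro diag_word_cong) auto
  then have "diag_s i (diag_word [1..<N] P) = diag_word [1..<N] (diag_s (Suc i) P)"
    by (simp add: diag_word_def)
  moreover have "pol_s i (pvar N) = pvar N" using assms by (simp add: pol_s_pvar transpose_def)
  ultimately have "diag_s i (Psi N P) = Psi N (diag_s (Suc i) P)"
    by (simp add: Psi_def diag_s_pmul)
  then show ?thesis by (simp add: opS_def Psi_add Psi_smul)
qed

lemma Psi_Psi:
  assumes "2 \<le> N"
  shows "Psi N (Psi N P) = pmul (pvar N * pvar (N - 1)) (diag_word ([1..<N] @ [1..<N]) P)"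
  using assms by (simp add: Psi_def diag_word_pmul fold_pol_s_pvar word_perm_cycle pmul_pmul diag_word_append)

text \<open>Under a single rotation s_(N-1) has no partner among the s_i, as that would be the
  affine generator. Two rotations carry s_1 to s_(N-1), and the factor x_N x_(N-1) is symmetric
  under it.\<close>

lemma opS_Psi_Psi:
  assumes "P \<in> Mod" "2 \<le> N"
  shows "opS (N - 1) a (Psi N (Psi N P)) = Psi N (Psi N (opS 1 a P))"
proof -
  let ?W = "[1..<N] @ [1..<N]"
  have "word_perm (?W @ [N - 1]) = word_perm ([1] @ ?W)"
  proof
    fix k
    have W: "word_perm ?W k = (if k = 1 then N - 1 else if k = 2 then N else if 2 < k \<and> k \<le> N then k - 2 else k)" for k
      using assms(2) unfolding word_perm_append by (auto simp: word_perm_cycle)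
    have L: "word_perm (?W @ [N - 1]) k = transpose (N - 1) N (word_perm ?W k)"
      using word_perm_append[of ?W "[N - 1]"] assms(2) by simp
    have R: "word_perm ([1] @ ?W) k = word_perm ?W (transpose 1 2 k)"
      using word_perm_append[of "[1]" ?W] by (simp add: numeral_2_eq_2 One_nat_def)
    show "word_perm (?W @ [N - 1]) k = word_perm ([1] @ ?W) k"
      unfolding L R W using assms(2) by (auto simp: transpose_def)
  qed
  then have "diag_word (?W @ [N - 1]) P = diag_word ([1] @ ?W) P"
    using assms by (intro diag_word_cong) auto
  then have *: "diag_s (N - 1) (diag_word ?W P) = diag_word ?W (diag_s 1 P)"
    by (simp add: diag_word_def)
  have p: "pol_s (N - 1) (pvar N) = pvar (N - 1)" "pol_s (N - 1) (pvar (N - 1)) = pvar N"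
    using assms by (auto simp: pol_s_pvar transpose_def)
  have "diag_s (N - 1) (Psi N (Psi N P)) = pmul (pvar (N - 1) * pvar N) (diag_s (N - 1) (diag_word ?W P))"
    unfolding Psi_Psi[OF assms(2)] diag_s_pmul pol_s_mult p ..
  also have "\<dots> = Psi N (Psi N (diag_s 1 P))"
    unfolding * Psi_Psi[OF assms(2)] by (simp add: mult.commute)
  finally show ?thesis by (simp add: opS_def Psi_add Psi_smul)
qed

section \<open>Path independence\<close>

text \<open>The coefficient on the edge entering u, written in the labels of u itself; so positions
  i and i+1 are exchanged compared with the rule stated at the start of the edge.\<close>

definition cd :: "vertex \<Rightarrow> nat \<Rightarrow> qalpha" where
  "cd u i = 1 / (zl (lab u i) - zl (lab u (Suc i)))"

definition root_poly :: tabpol where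
  "root_poly = single (tau_shape lam) 1"

lemma lab_step_swap:
  assumes "valid u" "1 \<le> i" "i < N"
  shows "lab (step i u) i = lab u (Suc i)" "lab (step i u) (Suc i) = lab u i"
  using assms by (simp_all add: lab_step)

lemma lab_step_other:
  assumes "valid u" "1 \<le> i" "i < N" "1 \<le> k" "k \<le> N" "k \<noteq> i" "k \<noteq> Suc i"
  shows "lab (step i u) k = lab u k"
  using assms by (simp add: lab_step transpose_def)

lemma tensor_one_single: "tensor 1 (single \<tau> 1) = single \<tau> 1"
  by (auto intro!: poly_mapping_eqI simp: lookup_single when_def)

lemma J_rel_valid: "J_rel lam x P \<Longrightarrow> x = Some u \<Longrightarrow> valid u"
proof (induction arbitrary: u rule: J_rel.induct)
  case root
  then show ?case using valid_root by simp
next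
  case (s_step \<tau> v P i w)
  then show ?case using arrow_valid[of "(\<tau>, v)" "S_edge i" u] by (simp add: G_edge_def)
next
  case (psi_step \<tau> v P w)
  then show ?case using arrow_valid[of "(\<tau>, v)" Psi_edge u] by (simp add: G_edge_def)
qed

lemma G_edge_iff: "valid u \<Longrightarrow> G_edge lam (Some u) l w \<longleftrightarrow> arrow lam (Some u) l w"
  using valid_reachable[of u] by (simp add: G_edge_def G_verts_def)

lemma J_rel_S:
  assumes "valid u" "J_rel lam (Some (step i u)) P" "1 \<le> i" "i < N" "dn i u"
  shows "J_rel lam (Some u) (opS i (cd u i) P)"
proof -
  obtain \<tau> v where s: "step i u = (\<tau>, v)" by fastforce
  have v: "valid (step i u)" using valid_step[OF assms(1,3,4)] assms(5) by simp
  have "arrow lam (Some (step i u)) (S_edge i) (Some u)"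
    using arrow_S_iff[OF v, of i u] up_step_iff[OF assms(1,3,4)] step_step[OF assms(1,3,4)] assms by simp
  then have e: "G_edge lam (Some (\<tau>, v)) (S_edge i) (Some u)" using G_edge_iff[OF v] s by simp
  have "opS i (cd u i) P = diag_s i P + smul (1 / (zeta \<tau> v (i + 1) - zeta \<tau> v i)) P"
    using lab_step_swap[OF assms(1,3,4)] s by (simp add: opS_def cd_def zeta_lab flip: Suc_eq_plus1)
  then show ?thesis using J_rel.s_step[OF _ e, of P] assms(2) s by simp
qed

lemma J_rel_psi:
  assumes "valid u" "J_rel lam (Some (unpsi u)) P" "0 < N" "0 < fst (lab u N)"
  shows "J_rel lam (Some u) (Psi N P)"
proof -
  obtain \<tau> v where s: "unpsi u = (\<tau>, v)" by fastforce
  note up = unpsi[OF assms(1,3,4)]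
  have "arrow lam (Some (unpsi u)) Psi_edge (Some u)" using arrow_Psi_iff[OF up(1)] up assms by simp
  then have e: "G_edge lam (Some (\<tau>, v)) Psi_edge (Some u)" using G_edge_iff[OF up(1)] s by simp
  then show ?thesis using J_rel.psi_step[OF _ e, of P] assms(2) s by (simp add: sum_list_lam)
qed

text \<open>Inversion by the last edge, with its start expressed through u, so that paths can be
  followed backwards.\<close>

lemma J_rel_cases:
  assumes "J_rel lam (Some u) P"
  obtains "u = root_vertex lam" "P = root_poly"
  | i Q where "1 \<le> i" "i < N" "dn i u" "J_rel lam (Some (step i u)) Q" "P = opS i (cd u i) Q"
  | Q where "0 < N" "0 < fst (lab u N)" "J_rel lam (Some (unpsi u)) Q" "P = Psi N Q"
  using assms
proof cases
  case root
  then show ?thesis using that(1) by (simp add: root_poly_def tensor_one_single)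
next
  case (s_step \<tau> v Q i)
  let ?w = "(\<tau>, v)"
  have vw: "valid ?w" using J_rel_valid[OF s_step(2)] by simp
  have a: "1 \<le> i" "i < N" "up i ?w" "u = step i ?w"
    using arrow_S_iff[OF vw, of i u] s_step(3) by (simp_all add: G_edge_def)
  have w: "step i u = ?w" using step_step[OF vw a(1,2)] a by simp
  have "dn i u" using up_step_iff[OF vw a(1,2)] a by simp
  moreover have "P = opS i (cd u i) Q"
    using lab_step_swap[OF vw a(1,2)] a(4) s_step(1)
    by (simp add: opS_def cd_def zeta_lab flip: Suc_eq_plus1)
  ultimately show ?thesis using that(2)[of i Q] a s_step(2) w by simp
next
  case (psi_step \<tau> v Q)
  let ?w = "(\<tau>, v)"
  have vw: "valid ?w" using J_rel_valid[OF psi_step(2)] by simp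
  have a: "0 < N" "u = psi ?w" using arrow_Psi_iff[OF vw] psi_step(3) by (simp_all add: G_edge_def)
  have w: "unpsi u = ?w" using unpsi_psi[OF vw a(1)] a by simp
  have "0 < fst (lab u N)" using lab_psi[OF vw, of N] a by simp
  then show ?thesis using that(3)[of Q] a psi_step w by (simp add: sum_list_lam)
qed

lemma J_rel_Mod:
  assumes "J_rel lam (Some u) P"
  shows "P \<in> Mod"
proof -
  have "\<forall>P. J_rel lam (Some u) P \<longrightarrow> P \<in> Mod" if "valid u" for u
    using that
  proof (induction u rule: valid_descent_induct)
    case (step u)
    show ?case
    proof (intro allI impI)
      fix P assume "J_rel lam (Some u) P"
      then show "P \<in> Mod"
      proof (cases rule: J_rel_cases)
        case 1
        then show ?thesis by (auto simp: root_poly_def rst_tau_shape)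
      next
        case (2 i Q)
        then have "Q \<in> Mod"
          using step(2)[of "step i u"] descent_step[OF step(1)] valid_step[OF step(1)] by blast
        then show ?thesis using 2 Mod_opS by simp
      next
        case (3 Q)
        then have "Q \<in> Mod"
          using step(2)[of "unpsi u"] descent_unpsi[OF step(1)] unpsi[OF step(1)] by blast
        then show ?thesis using 3 Mod_Psi by simp
      qed
    qed
  qed
  then show ?thesis using assms J_rel_valid by blast
qed

lemma J_rel_exists: "valid u \<Longrightarrow> \<exists>P. J_rel lam (Some u) P"
proof (induction u rule: valid_descent_induct)
  case (step u)
  consider "u = root_vertex lam" | "0 < N" "0 < fst (lab u N)" | "u \<noteq> root_vertex lam" "0 < N \<Longrightarrow> fst (lab u N) = 0"
    by linarith
  then show ?case
  proof cases
    case 1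
    then show ?thesis using J_rel.root by blast
  next
    case 2
    then obtain P where "J_rel lam (Some (unpsi u)) P"
      using step(2)[of "unpsi u"] descent_unpsi[OF step(1)] unpsi[OF step(1)] by auto
    then show ?thesis using J_rel_psi[OF step(1)] 2 by blast
  next
    case 3
    then obtain k where k: "1 \<le> k" "k < N" "dn k u" using exists_dn[OF step(1)] by auto
    then have "valid (step k u)" using valid_step[OF step(1)] by simp
    then obtain P where "J_rel lam (Some (step k u)) P"
      using step(2) descent_step[OF step(1) k] by blast
    then show ?thesis using J_rel_S[OF step(1)] k by blast
  qed
qed

text \<open>With \<open>root_fst_lab\<close> this shows that no edge enters the root, so the initial
  value there never competes with a derived one.\<close>

lemma root_no_dn:
  assumes "1 \<le> i" "i < N"
  shows "\<not> dn i (root_vertex lam)"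
proof
  assume dn: "dn i (root_vertex lam)"
  let ?u = "root_vertex lam"
  have \<tau>: "fst ?u = tau_shape lam" by (simp add: root_vertex_def)
  have e: "entry (snd ?u) i = entry (snd ?u) (Suc i)"
    using assms by (simp add: root_vertex_def sum_list_lam)
  let ?a = "sigma (snd ?u) i"
  note l = lab_Suc_equal[OF valid_root assms e]
  have ax: "axial ?a (tau_shape lam) \<le> -2"
    using dn l(1) e unfolding \<tau> by (auto simp: prec_def lab_def)
  obtain p where p: "p \<in> cells lam" "tau_shape lam p = ?a"
    using rst_cell[OF rst_tau_shape, of ?a] l(2,3) by auto
  obtain q where q: "q \<in> cells lam" "tau_shape lam q = Suc ?a"
    using rst_cell[OF rst_tau_shape, of "Suc ?a"] l(3) by auto
  have "snd q \<le> snd p" using tau_shape_col_mono[of "fst p" "snd p" "fst q" "snd q"] p q by simp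
  then show False
    using ax p q by - (rule axial_cases[OF rst_tau_shape, of "fst p" "snd p" "fst q" "snd q" ?a], auto)
qed

lemma root_fst_lab: "0 < N \<Longrightarrow> fst (lab (root_vertex lam) N) = 0"
  by (simp add: lab_def root_vertex_def sum_list_lam)

lemma descent_trans: "(a, b) \<in> descent \<Longrightarrow> (b, c) \<in> descent \<Longrightarrow> (a, c) \<in> descent"
  by (auto simp: descent_def)

text \<open>The definite description \<open>Jack\<close> has a usable value only after uniqueness;
  so uniqueness below a vertex is carried as induction hypothesis, and existence is proved
  separately.\<close>

definition single_valued :: "vertex \<Rightarrow> bool" where
  "single_valued w \<longleftrightarrow> (\<forall>P Q. J_rel lam (Some w) P \<longrightarrow> J_rel lam (Some w) Q \<longrightarrow> P = Q)"

lemma Jack_eqI: "single_valued w \<Longrightarrow> J_rel lam (Some w) P \<Longrightarrow> Jack lam w = P"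
  unfolding Jack_def single_valued_def by (rule the_equality) auto

lemma J_rel_Jack: "valid w \<Longrightarrow> single_valued w \<Longrightarrow> J_rel lam (Some w) (Jack lam w)"
  using J_rel_exists[of w] Jack_eqI by metis

lemma dn_step:
  assumes "valid u" "1 \<le> i" "i < N" "dn i u"
  shows "valid (step i u)" "(step i u, u) \<in> descent"
  using valid_step[OF assms(1-3)] descent_step[OF assms] assms(4) by auto

lemma lab_step_step:
  assumes "valid u" "valid (step i u)" "1 \<le> i" "i < N" "1 \<le> j" "j < N" "1 \<le> k" "k \<le> N"
  shows "lab (step j (step i u)) k = lab u (transpose i (Suc i) (transpose j (Suc j) k))"
  using assms transpose_Suc_range[OF assms(5-8)] by (simp add: lab_step)

section \<open>Local confluence of the edges entering a vertex\<close>

context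
  fixes u :: vertex
  assumes u: "valid u"
    and IH: "\<And>w. valid w \<Longrightarrow> (w, u) \<in> descent \<Longrightarrow> single_valued w"
begin

lemma Jack_dn_below:
  assumes "valid w" "(w, u) \<in> descent" "1 \<le> i" "i < N" "dn i w"
  shows "Jack lam w = opS i (cd w i) (Jack lam (step i w))"
proof -
  note s = dn_step[OF assms(1,3-5)]
  have "single_valued (step i w)" using IH[OF s(1) descent_trans[OF s(2) assms(2)]] .
  then have "J_rel lam (Some (step i w)) (Jack lam (step i w))" using J_rel_Jack s by blast
  then show ?thesis using J_rel_S[OF assms(1) _ assms(3-5)] Jack_eqI[OF IH[OF assms(1,2)]] by blast
qed

lemma Jack_unpsi_below:
  assumes "valid w" "(w, u) \<in> descent" "0 < N" "0 < fst (lab w N)"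
  shows "Jack lam w = Psi N (Jack lam (unpsi w))"
proof -
  note s = unpsi(1)[OF assms(1,3,4)] descent_unpsi[OF assms(1,3,4)]
  have "single_valued (unpsi w)" using IH[OF s(1) descent_trans[OF s(2) assms(2)]] .
  then have "J_rel lam (Some (unpsi w)) (Jack lam (unpsi w))" using J_rel_Jack s by blast
  then show ?thesis using J_rel_psi[OF assms(1) _ assms(3,4)] Jack_eqI[OF IH[OF assms(1,2)]] by blast
qed

lemma Jack_Mod_below:
  assumes "valid w" "(w, u) \<in> descent"
  shows "Jack lam w \<in> Mod"
  using J_rel_Jack[OF assms(1) IH[OF assms]] J_rel_Mod by blast

lemma confluent_far:
  assumes "1 \<le> i" "Suc (Suc i) \<le> j" "j < N" "dn i u" "dn j u"
  shows "opS i (cd u i) (Jack lam (step i u)) = opS j (cd u j) (Jack lam (step j u))"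
proof -
  let ?a = "step i u" and ?b = "step j u"
  have r: "i < N" "1 \<le> j" using assms by auto
  note a = dn_step[OF u assms(1) r(1) assms(4)] and b = dn_step[OF u r(2) assms(3,5)]
  have la: "lab ?a j = lab u j" "lab ?a (Suc j) = lab u (Suc j)"
    using u assms r by (auto intro!: lab_step_other)
  have lb: "lab ?b i = lab u i" "lab ?b (Suc i) = lab u (Suc i)"
    using u assms r by (auto intro!: lab_step_other)
  have da: "dn j ?a" and db: "dn i ?b" using la lb assms by auto
  have eq: "step j ?a = step i ?b"
  proof (rule valid_eqI)
    show "valid (step j ?a)" using dn_step[OF a(1) r(2) assms(3) da] by blast
    show "valid (step i ?b)" using dn_step[OF b(1) assms(1) r(1) db] by blast
    fix k assume k: "1 \<le> k" "k \<le> N"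
    have "transpose i (Suc i) (transpose j (Suc j) k) = transpose j (Suc j) (transpose i (Suc i) k)"
      using assms by (auto simp: transpose_def)
    then show "lab (step j ?a) k = lab (step i ?b) k"
      using lab_step_step[OF u a(1) assms(1) r(1) r(2) assms(3) k]
        lab_step_step[OF u b(1) r(2) assms(3) assms(1) r(1) k] by simp
  qed
  have "Jack lam ?a = opS j (cd u j) (Jack lam (step i ?b))"
    using Jack_dn_below[OF a r(2) assms(3) da] la eq by (simp add: cd_def)
  moreover have "Jack lam ?b = opS i (cd u i) (Jack lam (step i ?b))"
    using Jack_dn_below[OF b assms(1) r(1) db] lb by (simp add: cd_def)
  ultimately show ?thesis using opS_far[OF assms(2)] by simp
qed

text \<open>The hexagon: both paths of length three start where the labels at i, i+1, i+2 read w, y,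
  x. Transitivity of \<sqsubset> supplies the middle edges, and \<open>inverse_sum_identity\<close>
  the relation between the three coefficients.\<close>

lemma confluent_braid:
  assumes "1 \<le> i" "Suc i < N" "dn i u" "dn (Suc i) u"
  shows "opS i (cd u i) (Jack lam (step i u)) = opS (Suc i) (cd u (Suc i)) (Jack lam (step (Suc i) u))"
proof -
  let ?j = "Suc i"
  let ?x = "lab u i" and ?y = "lab u (Suc i)" and ?w = "lab u (Suc (Suc i))"
  have r: "i < N" "1 \<le> ?j" "1 \<le> Suc ?j" "Suc ?j \<le> N" "?j \<le> N" "i \<le> N" using assms by auto
  have xw: "?w \<sqsubset> ?x" using prec_trans assms by blast
  define a where "a = step i u"
  note a = dn_step[OF u assms(1) r(1) assms(3), folded a_def]
  have la: "lab a i = ?y" "lab a ?j = ?x" "lab a (Suc ?j) = ?w"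
    unfolding a_def using lab_step_swap[OF u assms(1) r(1)] lab_step_other[OF u assms(1) r(1) r(3,4)] by auto
  have da: "dn ?j a" using la xw by simp
  define a2 where "a2 = step ?j a"
  note a2 = dn_step[OF a(1) r(2) assms(2) da, folded a2_def]
  have la2: "lab a2 i = ?y" "lab a2 ?j = ?w" "lab a2 (Suc ?j) = ?x"
    unfolding a2_def using lab_step_swap[OF a(1) r(2) assms(2)]
      lab_step_other[OF a(1) r(2) assms(2) assms(1) r(6)] la by auto
  have da2: "dn i a2" using la2 assms by simp
  note a3 = dn_step[OF a2(1) assms(1) r(1) da2]
  define b where "b = step ?j u"
  note b = dn_step[OF u r(2) assms(2,4), folded b_def]
  have lb: "lab b i = ?x" "lab b ?j = ?w" "lab b (Suc ?j) = ?y"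
    unfolding b_def using lab_step_swap[OF u r(2) assms(2)]
      lab_step_other[OF u r(2) assms(2) assms(1) r(6)] by auto
  have db: "dn i b" using lb xw by simp
  define b2 where "b2 = step i b"
  note b2 = dn_step[OF b(1) assms(1) r(1) db, folded b2_def]
  have lb2: "lab b2 i = ?w" "lab b2 ?j = ?x" "lab b2 (Suc ?j) = ?y"
    unfolding b2_def using lab_step_swap[OF b(1) assms(1) r(1)]
      lab_step_other[OF b(1) assms(1) r(1) r(3,4)] lb by auto
  have db2: "dn ?j b2" using lb2 assms by simp
  note b3 = dn_step[OF b2(1) r(2) assms(2) db2]
  have eq: "step i a2 = step ?j b2"
  proof (rule valid_eqI[OF a3(1) b3(1)])
    fix k assume k: "1 \<le> k" "k \<le> N"
    let ?s = "transpose i ?j" and ?t = "transpose ?j (Suc ?j)"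
    have "lab (step i a2) k = lab u (?s (?t (?s k)))"
      unfolding a2_def using lab_step_step[OF a(1) a2(1)[unfolded a2_def] r(2) assms(2) assms(1) r(1) k]
        lab_step[OF u assms(1) r(1)] transpose_Suc_range[OF assms(1) r(1) k]
        transpose_Suc_range[OF r(2) assms(2) transpose_Suc_range[OF assms(1) r(1) k]]
      by (simp add: a_def)
    moreover have "lab (step ?j b2) k = lab u (?t (?s (?t k)))"
      unfolding b2_def using lab_step_step[OF b(1) b2(1)[unfolded b2_def] assms(1) r(1) r(2) assms(2) k]
        lab_step[OF u r(2) assms(2)] transpose_Suc_range[OF r(2) assms(2) k]
        transpose_Suc_range[OF assms(1) r(1) transpose_Suc_range[OF r(2) assms(2) k]]
      by (simp add: b_def)
    moreover have "?s (?t (?s k)) = ?t (?s (?t k))" by (auto simp: transpose_def)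
    ultimately show "lab (step i a2) k = lab (step ?j b2) k" by simp
  qed
  have du: "(a2, u) \<in> descent" "(b2, u) \<in> descent"
    using descent_trans[OF a2(2) a(2)] descent_trans[OF b2(2) b(2)] by auto
  let ?J = "Jack lam (step ?j b2)"
  have JM: "?J \<in> Mod" using Jack_Mod_below b3 descent_trans du by blast
  have A: "Jack lam a = opS ?j (1 / (zl ?x - zl ?w)) (opS i (1 / (zl ?y - zl ?w)) ?J)"
    using Jack_dn_below[OF a r(2) assms(2) da] Jack_dn_below[OF a2(1) du(1) assms(1) r(1) da2] la la2 eq
    by (simp add: cd_def a2_def)
  have B: "Jack lam b = opS i (1 / (zl ?x - zl ?w)) (opS ?j (1 / (zl ?x - zl ?y)) ?J)"
    using Jack_dn_below[OF b assms(1) r(1) db] Jack_dn_below[OF b2(1) du(2) r(2) assms(2) db2] lb lb2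
    by (simp add: cd_def b2_def)
  have yb: "1 / (zl ?x - zl ?w) * (1 / (zl ?y - zl ?w) + 1 / (zl ?x - zl ?y))
      = 1 / (zl ?y - zl ?w) * (1 / (zl ?x - zl ?y))"
    using inverse_sum_identity[of "zl ?y - zl ?w" "zl ?x - zl ?y"] prec_zl(1)[OF xw] prec_zl(1)[OF assms(3)]
      prec_zl(1)[OF assms(4)] by simp
  show ?thesis
    using yang_baxter[OF JM assms(1,2) yb] A B by (simp add: cd_def a_def b_def)
qed

text \<open>Rotation shifts positions by one, so s_i after \<Psi> closes up with s_(i+1) before
  it.\<close>

lemma confluent_psi:
  assumes "1 \<le> i" "Suc i < N" "dn i u" "0 < fst (lab u N)"
  shows "opS i (cd u i) (Jack lam (step i u)) = Psi N (Jack lam (unpsi u))"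
proof -
  let ?j = "Suc i"
  have r: "i < N" "1 \<le> ?j" "0 < N" "1 \<le> N" "i \<le> N" "?j \<le> N" "1 \<le> Suc ?j" "Suc ?j \<le> N" using assms by auto
  define a where "a = step i u"
  define b where "b = unpsi u"
  note a = dn_step[OF u assms(1) r(1) assms(3), folded a_def]
  note b = unpsi[OF u r(3) assms(4), folded b_def] and bd = descent_unpsi[OF u r(3) assms(4), folded b_def]
  have laN: "lab a N = lab u N" unfolding a_def using lab_step_other[OF u assms(1) r(1) r(4)] assms by simp
  note lu = lab_unpsi[OF u r(3) assms(4), folded b_def]
  have lb: "lab b ?j = lab u i" "lab b (Suc ?j) = lab u ?j"
    using lu[OF r(2,6)] lu[OF r(7,8)] assms(1) by auto
  have db: "dn ?j b" using lb assms by simp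
  note b2 = dn_step[OF b(1) r(2) assms(2) db]
  have pa: "0 < fst (lab a N)" using laN assms by simp
  note ua = unpsi[OF a(1) r(3) pa]
  have eq: "unpsi a = step ?j b"
  proof (rule valid_eqI[OF ua(1) b2(1)])
    fix k assume k: "1 \<le> k" "k \<le> N"
    have s: "lab (step ?j b) k = lab b (transpose ?j (Suc ?j) k)"
      by (rule lab_step[OF b(1) r(2) assms(2) k])
    show "lab (unpsi a) k = lab (step ?j b) k"
    proof (cases "k = 1")
      case True
      then show ?thesis
        using lab_unpsi[OF a(1) r(3) pa k] s lu[OF k] laN assms by (simp add: transpose_def)
    next
      case False
      have k1: "1 \<le> k - 1" "k - 1 \<le> N" using k False by auto
      have "lab (unpsi a) k = lab u (transpose i ?j (k - 1))"
        using lab_unpsi[OF a(1) r(3) pa k] False lab_step[OF u assms(1) r(1) k1] by (simp add: a_def)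
      also have "transpose i ?j (k - 1) = transpose ?j (Suc ?j) k - 1"
        using k False assms by (auto simp: transpose_def)
      also have "lab u (transpose ?j (Suc ?j) k - 1) = lab b (transpose ?j (Suc ?j) k)"
        using lu[OF transpose_Suc_range[OF r(2) assms(2) k]] False assms k
        by (auto simp: transpose_def split: if_splits)
      finally show ?thesis using s by simp
    qed
  qed
  let ?J = "Jack lam (step ?j b)"
  have JM: "?J \<in> Mod" using Jack_Mod_below b2 descent_trans[OF b2(2) bd] by blast
  have "Jack lam a = Psi N ?J" using Jack_unpsi_below[OF a r(3) pa] eq by simp
  moreover have "Jack lam b = opS ?j (cd u i) ?J"
    using Jack_dn_below[OF b(1) bd r(2) assms(2) db] lb by (simp add: cd_def)
  ultimately show ?thesis using opS_Psi[OF JM assms(1,2)] by (simp add: a_def b_def)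
qed

text \<open>The exchange involves the entry created by the last \<Psi>-step, so the two edges meet
  only after a second \<Psi>-step is undone, at an exchange of the positions 1 and 2.\<close>

lemma confluent_psi_last:
  assumes "2 \<le> N" "dn (N - 1) u" "0 < fst (lab u N)"
  shows "opS (N - 1) (cd u (N - 1)) (Jack lam (step (N - 1) u)) = Psi N (Jack lam (unpsi u))"
proof -
  let ?i = "N - 1"
  have r: "1 \<le> ?i" "?i < N" "0 < N" "1 \<le> N" "Suc ?i = N" "N \<le> N" "?i \<le> N" "1 \<le> (1::nat)" "1 < N" "2 \<le> N"
    "1 \<le> (2::nat)" "Suc 1 = 2"
    using assms by auto
  let ?x = "lab u ?i" and ?y = "lab u N"
  let ?x' = "(fst ?x - 1, snd ?x)" and ?y' = "(fst ?y - 1, snd ?y)"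
  have yx: "?y \<sqsubset> ?x" using assms r by simp
  \<comment> \<open>The entry at N-1 is at least the last one, which is positive; hence
    \<open>psi\<close> can be undone twice.\<close>
  have px: "0 < fst ?x" using yx assms by (auto simp: prec_def)
  have yx': "?y' \<sqsubset> ?x'" using yx assms by (auto simp: prec_def)
  \<comment> \<open>The undone steps lower both entries by 1, so \<alpha> cancels and the
    coefficient of the exchange is unchanged.\<close>
  have zl': "zl ?x' - zl ?y' = zl ?x - zl ?y"
    using px assms by (simp add: zl_def algebra_simps of_nat_diff)
  define b where "b = unpsi u"
  note b = unpsi[OF u r(3) assms(3), folded b_def] and bd = descent_unpsi[OF u r(3) assms(3), folded b_def]
  note lu = lab_unpsi[OF u r(3) assms(3), folded b_def]
  have lbN: "lab b N = ?x" using lu[OF r(4,6)] assms by simp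
  have pb: "0 < fst (lab b N)" using lbN px by simp
  define c where "c = unpsi b"
  note c = unpsi[OF b(1) r(3) pb, folded c_def] and cd' = descent_unpsi[OF b(1) r(3) pb, folded c_def]
  note lc = lab_unpsi[OF b(1) r(3) pb, folded c_def]
  have lc1: "lab c 1 = ?x'" using lc[OF r(8,4)] lbN by simp
  have lc2: "lab c 2 = ?y'" using lc[OF r(11,10)] lu[OF r(8,4)] by (simp add: One_nat_def)
  have dc: "dn 1 c" using lc1 lc2 yx' r(12) by simp
  note c2 = dn_step[OF c(1) r(8,9) dc]
  define a where "a = step ?i u"
  note a = dn_step[OF u r(1,2) assms(2), folded a_def]
  have la: "lab a ?i = ?y" "lab a N = ?x"
    unfolding a_def using lab_step_swap[OF u r(1,2)] r(5) by auto
  have pa: "0 < fst (lab a N)" using la px by simp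
  note a1 = unpsi[OF a(1) r(3) pa] and a1d = descent_unpsi[OF a(1) r(3) pa]
  note la1 = lab_unpsi[OF a(1) r(3) pa]
  have la1N: "lab (unpsi a) N = ?y" using la1[OF r(4,6)] la assms by simp
  have pa1: "0 < fst (lab (unpsi a) N)" using la1N assms by simp
  note a2 = unpsi[OF a1(1) r(3) pa1]
  note la2 = lab_unpsi[OF a1(1) r(3) pa1]
  have eq: "unpsi (unpsi a) = step 1 c"
  proof (rule valid_eqI[OF a2(1) c2(1)])
    fix k assume k: "1 \<le> k" "k \<le> N"
    show "lab (unpsi (unpsi a)) k = lab (step 1 c) k"
    proof -
      consider "k = 1" | "k = 2" | "2 < k" using k by linarith
      then show ?thesis
      proof cases
        case 1
        then show ?thesis using la2[OF k] la1N lab_step_swap(1)[OF c(1) r(8,9)] lc2 r(12) by simp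
      next
        case 2
        then show ?thesis
          using la2[OF k] la1[OF r(8,4)] la lab_step_swap(2)[OF c(1) r(8,9)] lc1
          by (simp add: One_nat_def numeral_2_eq_2)
      next
        case 3
        have k': "1 \<le> k - 1" "k - 1 \<le> N" "1 \<le> k - 2" "k - 2 \<le> N" "k \<noteq> 1" "k - 1 \<noteq> 1" "k - 1 - 1 = k - 2"
          using 3 k by auto
        have "lab (unpsi (unpsi a)) k = lab a (k - 2)"
          using la2[OF k] la1[OF k'(1,2)] k'(5-7) by simp
        also have "\<dots> = lab u (k - 2)"
          unfolding a_def using 3 k by (intro lab_step_other[OF u r(1,2) k'(3,4)]) auto
        also have "\<dots> = lab c k"
          using lc[OF k] lu[OF k'(1,2)] k'(5-7) by simp
        also have "\<dots> = lab (step 1 c) k"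
          using 3 k r(12) by (intro lab_step_other[OF c(1) r(8,9), symmetric]) auto
        finally show ?thesis .
      qed
    qed
  qed
  have du: "(c, u) \<in> descent" "(unpsi a, u) \<in> descent"
    using descent_trans[OF cd' bd] descent_trans[OF a1d a(2)] by auto
  let ?J = "Jack lam (step 1 c)"
  have JM: "?J \<in> Mod" using Jack_Mod_below c2 descent_trans[OF c2(2) du(1)] by blast
  have "Jack lam a = Psi N (Psi N ?J)"
    using Jack_unpsi_below[OF a r(3) pa] Jack_unpsi_below[OF a1(1) du(2) r(3) pa1] eq by simp
  moreover have "Jack lam b = Psi N (opS 1 (cd u ?i) ?J)"
    using Jack_unpsi_below[OF b(1) bd r(3) pb] Jack_dn_below[OF c(1) du(1) r(8,9) dc] lc1 lc2 r(5,12) zl'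
    by (simp add: cd_def c_def)
  ultimately show ?thesis using opS_Psi_Psi[OF JM assms(1)] by (simp add: a_def b_def)
qed

lemma confluent_S:
  assumes "1 \<le> i" "i < j" "j < N" "dn i u" "dn j u"
  shows "opS i (cd u i) (Jack lam (step i u)) = opS j (cd u j) (Jack lam (step j u))"
proof (cases "j = Suc i")
  case True
  then show ?thesis using confluent_braid[of i] assms by simp
next
  case False
  then show ?thesis using confluent_far[of i j] assms by simp
qed

lemma confluent_S_psi:
  assumes "1 \<le> i" "i < N" "dn i u" "0 < fst (lab u N)"
  shows "opS i (cd u i) (Jack lam (step i u)) = Psi N (Jack lam (unpsi u))"
proof (cases "Suc i < N")
  case True
  then show ?thesis using confluent_psi[OF assms(1) True assms(3,4)] by simp
next
  case False
  then have "i = N - 1" "2 \<le> N" using assms by auto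
  then show ?thesis using confluent_psi_last assms by simp
qed

lemma single_valued_step: "single_valued u"
proof -
  \<comment> \<open>The values brought in by an edge, whose start already has a unique polynomial.
    At the root there are none; elsewhere any two agree by local confluence.\<close>
  define entering where "entering P \<longleftrightarrow>
      (\<exists>i. 1 \<le> i \<and> i < N \<and> dn i u \<and> P = opS i (cd u i) (Jack lam (step i u)))
    \<or> (0 < N \<and> 0 < fst (lab u N) \<and> P = Psi N (Jack lam (unpsi u)))" for P
  have cases: "(u = root_vertex lam \<and> P = root_poly) \<or> entering P" if "J_rel lam (Some u) P" for P
    using that
  proof (cases rule: J_rel_cases)
    case (2 i Q)
    note s = dn_step[OF u 2(1-3)]
    have "Jack lam (step i u) = Q" using Jack_eqI[OF IH[OF s] 2(4)] .
    then show ?thesis using 2 unfolding entering_def by blast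
  next
    case (3 Q)
    have "Jack lam (unpsi u) = Q"
      using Jack_eqI[OF IH[OF unpsi(1)[OF u 3(1,2)] descent_unpsi[OF u 3(1,2)]] 3(3)] .
    then show ?thesis using 3 unfolding entering_def by blast
  qed auto
  have root: "\<not> entering P" if "u = root_vertex lam" for P
    using root_no_dn root_fst_lab that unfolding entering_def by auto
  have S: "opS i (cd u i) (Jack lam (step i u)) = opS j (cd u j) (Jack lam (step j u))"
    if "1 \<le> i" "i < N" "dn i u" "1 \<le> j" "j < N" "dn j u" for i j
  proof (cases i j rule: linorder_cases)
    case less
    show ?thesis by (rule confluent_S[OF that(1) less that(5,3,6)])
  next
    case greater
    show ?thesis by (rule confluent_S[OF that(4) greater that(2,6,3), symmetric])
  qed simp
  have eq: "P = Q" if "entering P" "entering Q" for P Q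
  proof (cases "0 < N \<and> 0 < fst (lab u N)")
    case True
    have *: "R = Psi N (Jack lam (unpsi u))" if "entering R" for R
      using that unfolding entering_def
    proof (elim disjE exE conjE)
      fix i assume "1 \<le> i" "i < N" "dn i u" "R = opS i (cd u i) (Jack lam (step i u))"
      then show ?thesis using confluent_S_psi[of i] True by simp
    qed
    show ?thesis using *[OF that(1)] *[OF that(2)] by metis
  next
    case False
    have *: "\<exists>i. 1 \<le> i \<and> i < N \<and> dn i u \<and> R = opS i (cd u i) (Jack lam (step i u))" if "entering R" for R
      using that[unfolded entering_def]
    proof (rule disjE)
      assume "0 < N \<and> 0 < fst (lab u N) \<and> R = Psi N (Jack lam (unpsi u))"
      then show ?thesis using False by simp
    qed
    from *[OF that(1)] obtain i
      where i: "1 \<le> i" "i < N" "dn i u" "P = opS i (cd u i) (Jack lam (step i u))" by (elim exE conjE)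
    from *[OF that(2)] obtain j
      where j: "1 \<le> j" "j < N" "dn j u" "Q = opS j (cd u j) (Jack lam (step j u))" by (elim exE conjE)
    show ?thesis unfolding i(4) j(4) by (rule S[OF i(1-3) j(1-3)])
  qed
  show ?thesis
    unfolding single_valued_def
  proof (intro allI impI)
    fix P Q assume "J_rel lam (Some u) P" "J_rel lam (Some u) Q"
    then show "P = Q" using cases[of P] cases[of Q] root[of P] root[of Q] eq[of P Q] by auto
  qed
qed

end

section \<open>Values of the polynomials along edges\<close>

lemma valid_single_valued: "valid u \<Longrightarrow> single_valued u"
proof (induction u rule: valid_descent_induct)
  case (step u)
  show ?case using step(1) step(2) by (rule single_valued_step)
qed

lemma Jack_J_rel: "valid u \<Longrightarrow> J_rel lam (Some u) (Jack lam u)"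
  using J_rel_Jack valid_single_valued by blast

lemma Jack_Mod: "valid u \<Longrightarrow> Jack lam u \<in> Mod"
  using Jack_J_rel J_rel_Mod by blast

lemma Jack_dn:
  assumes "valid u" "1 \<le> i" "i < N" "dn i u"
  shows "Jack lam u = opS i (cd u i) (Jack lam (step i u))"
  using Jack_eqI[OF valid_single_valued[OF assms(1)] J_rel_S[OF assms(1) Jack_J_rel assms(2-4)]]
    dn_step(1)[OF assms] by blast

lemma Jack_unpsi:
  assumes "valid u" "0 < N" "0 < fst (lab u N)"
  shows "Jack lam u = Psi N (Jack lam (unpsi u))"
  using Jack_eqI[OF valid_single_valued[OF assms(1)] J_rel_psi[OF assms(1) Jack_J_rel assms(2,3)]]
    unpsi(1)[OF assms] by blast

lemma Jack_root: "Jack lam (root_vertex lam) = root_poly"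
  using Jack_eqI[OF valid_single_valued[OF valid_root] J_rel.root] by (simp add: root_poly_def tensor_one_single)

lemma sigma_replicate: "1 \<le> k \<Longrightarrow> k \<le> n \<Longrightarrow> sigma (replicate n x) k = k"
proof -
  assume k: "1 \<le> k" "k \<le> n"
  have "{j \<in> {1..n}. weakly_before (replicate n x) j k} = {1..k}"
    using k by (auto simp: weakly_before_def)
  then show ?thesis using k by (simp add: sigma_eq_card)
qed

text \<open>Here the operators act on tableaux alone. The scalar of an edge is the negative of the
  diagonal entry at its start, and the off-diagonal entry there is normalized to 1, so each edge
  just replaces one tableau by the next.\<close>

lemma Jack_zero: "rst \<tau> \<Longrightarrow> Jack lam (\<tau>, replicate N 0) = single \<tau> 1"
proof -
  have "snd u = replicate N 0 \<longrightarrow> Jack lam u = single (fst u) 1" if "valid u" for u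
    using that
  proof (induction u rule: valid_descent_induct)
    case (step u)
    show ?case
    proof
      assume v: "snd u = replicate N 0"
      show "Jack lam u = single (fst u) 1"
      proof (cases "u = root_vertex lam")
        case True
        then show ?thesis using Jack_root by (simp add: root_poly_def root_vertex_def)
      next
        case False
        have "0 < N \<Longrightarrow> fst (lab u N) = 0" using v by (simp add: lab_def)
        then obtain k where k: "1 \<le> k" "k < N" "dn k u" using exists_dn[OF step(1) False] by auto
        have s: "sigma (snd u) k = k" "sigma (snd u) (Suc k) = Suc k"
          using k v by (auto simp: sigma_replicate)
        define \<tau>' where "\<tau>' = interchange k (fst u)"
        have st: "step k u = (\<tau>', replicate N 0)" using v s k by (simp add: step_def \<tau>'_def)
        have lk: "lab u k = (0, CT (fst u) k)" "lab u (Suc k) = (0, CT (fst u) (Suc k))"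
          using s v k by (auto simp: lab_def)
        have ax: "axial k (fst u) \<le> -2" using k(3) lk by (simp add: prec_def axial_def)
        have J': "Jack lam (step k u) = single \<tau>' 1"
          using step(2)[of "step k u"] dn_step[OF step(1) k] st by simp
        have ax': "axial k \<tau>' = - axial k (fst u)" by (simp add: \<tau>'_def axial_interchange)
        have cd: "cd u k = 1 / of_int (axial k (fst u))" using lk by (simp add: cd_def zl_def axial_def)
        have ii: "interchange k \<tau>' = fst u" by (simp add: \<tau>'_def)
        have "Jack lam u = opS k (cd u k) (single \<tau>' 1)" using Jack_dn[OF step(1) k] J' by simp
        also have "\<dots> = smul (1 / of_int (- axial k (fst u)) + 1 / of_int (axial k (fst u))) (single \<tau>' 1)
            + smul (seminormal (- axial k (fst u))) (single (fst u) 1)"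
          unfolding opS_def diag_s_single cd ax' ii pol_s_1 smul.scale_left_distrib by (simp add: add_ac)
        also have "\<dots> = single (fst u) 1" using ax by (simp add: seminormal_def)
        finally show ?thesis .
      qed
    qed
  qed
  moreover assume "rst \<tau>"
  ultimately show ?thesis by (simp add: valid_def)
qed

text \<open>Unlike \<open>exists_dn\<close>, this yields a strict drop of entries. Such a drop is
  visible in v alone, so one step serves every tableau, and it cannot occur at a position where
  neighbouring entries agree.\<close>

lemma exists_entry_descent:
  assumes "valid u" "snd u \<noteq> replicate N 0" "0 < N \<Longrightarrow> fst (lab u N) = 0"
  shows "\<exists>j. 1 \<le> j \<and> j < N \<and> entry (snd u) (Suc j) < entry (snd u) j"
proof (rule ccontr)
  assume no: "\<not> ?thesis"
  have n: "length (snd u) = N" using assms by (simp add: valid_def)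
  have so: "sorted (snd u)"
  proof (rule sorted_if_entries)
    fix k assume "1 \<le> k" "k < length (snd u)"
    then show "entry (snd u) k \<le> entry (snd u) (Suc k)" using no n by (meson not_less)
  qed
  have "snd u ! k = 0" if "k < N" for k
    using sorted_nth_mono[OF so, of k "N - 1"] that n assms(3) by (simp add: lab_def)
  then have "snd u = replicate N 0" using n by (intro nth_equalityI) auto
  then show False using assms by simp
qed

lemma dn_if_entry:
  "entry (snd u) (Suc j) < entry (snd u) j \<Longrightarrow> dn j u"
  by (simp add: prec_def lab_def)

text \<open>These are the edges into the vertex \<open>\<emptyset>\<close>.\<close>

lemma Jack_adjacent:
  assumes "valid u" "1 \<le> i" "i < N" "adjacent (lab u i) (lab u (Suc i))"
  shows "opS i (1 / (zl (lab u (Suc i)) - zl (lab u i))) (Jack lam u) = 0"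
proof -
  define A where "A u \<longleftrightarrow> (\<forall>i. 1 \<le> i \<and> i < N \<and> adjacent (lab u i) (lab u (Suc i))
      \<longrightarrow> opS i (1 / (zl (lab u (Suc i)) - zl (lab u i))) (Jack lam u) = 0)" for u
  have AD: "opS i (1 / (zl (lab u (Suc i)) - zl (lab u i))) (Jack lam u) = 0"
    if "A u" "1 \<le> i" "i < N" "adjacent (lab u i) (lab u (Suc i))" for u i
    using that unfolding A_def by simp
  have "A u" if "valid u" for u
    using that
  proof (induction u rule: valid_descent_induct)
    case (step u)
    note u = step(1)
    show ?case unfolding A_def
    proof (intro allI impI, elim conjE)
      fix i assume i: "1 \<le> i" "i < N" and adj: "adjacent (lab u i) (lab u (Suc i))"
      let ?x = "lab u i" and ?y = "lab u (Suc i)"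
      let ?c = "1 / (zl ?y - zl ?x)"
      have N: "0 < N" "1 \<le> N" "i \<le> N" using i by auto
      \<comment> \<open>Either \<Psi> is undone, once in general and twice when i = N-1, or v = 0
        and the action is explicit, or the entries drop at some j different from i.\<close>
      consider "0 < fst (lab u N)" "Suc i < N" | "0 < fst (lab u N)" "i = N - 1" "2 \<le> N"
        | "snd u = replicate N 0" | "fst (lab u N) = 0" "snd u \<noteq> replicate N 0"
        using i by linarith
      then show "opS i ?c (Jack lam u) = 0"
      proof cases
        case 1
        note w = unpsi(1)[OF u N(1) 1(1)] descent_unpsi[OF u N(1) 1(1)]
        have r: "1 \<le> Suc i" "Suc i \<le> N" "1 \<le> Suc (Suc i)" "Suc (Suc i) \<le> N" using 1 by auto
        note l = lab_unpsi[OF u N(1) 1(1)]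
        have lw: "lab (unpsi u) (Suc i) = ?x" "lab (unpsi u) (Suc (Suc i)) = ?y"
          using l[OF r(1,2)] l[OF r(3,4)] i by auto
        have "opS (Suc i) ?c (Jack lam (unpsi u)) = 0"
          using AD[OF step(2)[OF w] r(1) 1(2)] lw adj by simp
        then show ?thesis
          using Jack_unpsi[OF u N(1) 1(1)] opS_Psi[OF Jack_Mod[OF w(1)] i(1) 1(2)] by simp
      next
        case 2
        have r: "1 \<le> (1::nat)" "1 < N" "1 \<le> (2::nat)" "2 \<le> N" "Suc 1 = 2" "Suc i = N" "N \<le> N" using 2 by auto
        note w = unpsi(1)[OF u N(1) 2(1)] descent_unpsi[OF u N(1) 2(1)]
        note l = lab_unpsi[OF u N(1) 2(1)]
        have lN: "lab (unpsi u) N = ?x" using l[OF N(2) r(7)] 2 by simp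
        have y: "lab u N = ?y" using r by simp
        have fx: "fst ?x = fst ?y" using adj by (simp add: adjacent_def)
        have px: "0 < fst (lab (unpsi u) N)" unfolding lN fx y[symmetric] by (rule 2(1))
        note w2 = unpsi(1)[OF w(1) N(1) px] descent_trans[OF descent_unpsi[OF w(1) N(1) px] w(2)]
        note l2 = lab_unpsi[OF w(1) N(1) px]
        have m1: "2 - 1 = (1::nat)" by simp
        have lw: "lab (unpsi (unpsi u)) 1 = (fst ?x - 1, snd ?x)"
          using l2[OF r(1) N(2)] lN by simp
        have lw': "lab (unpsi (unpsi u)) (Suc 1) = (fst ?y - 1, snd ?y)"
          unfolding r(5) using l2[OF r(3,4)] l[OF r(1) N(2)] y unfolding m1 by simp
        have adj': "adjacent (fst ?x - 1, snd ?x) (fst ?y - 1, snd ?y)" using adj by (simp add: adjacent_def)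
        have zl': "zl (fst ?y - 1, snd ?y) - zl (fst ?x - 1, snd ?x) = zl ?y - zl ?x"
          unfolding fx by (simp add: zl_def fx)
        have "opS 1 ?c (Jack lam (unpsi (unpsi u))) = 0"
          using AD[OF step(2)[OF w2] r(1,2)] unfolding lw lw' zl' using adj' by simp
        moreover have "Jack lam u = Psi N (Psi N (Jack lam (unpsi (unpsi u))))"
          using Jack_unpsi[OF u N(1) 2(1)] Jack_unpsi[OF w(1) N(1) px] by simp
        ultimately show ?thesis
          using opS_Psi_Psi[OF Jack_Mod[OF w2(1)] r(4), of ?c] 2(2) by simp
      next
        case 3
        have \<tau>: "rst (fst u)" using u by (simp add: valid_def)
        have J: "Jack lam u = single (fst u) 1" using Jack_zero[OF \<tau>] 3 by (metis prod.collapse)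
        have s: "sigma (snd u) i = i" "sigma (snd u) (Suc i) = Suc i"
          using i 3 by (auto simp: sigma_replicate)
        have lk: "?x = (0, CT (fst u) i)" "?y = (0, CT (fst u) (Suc i))"
          using s 3 i by (auto simp: lab_def)
        have ax: "axial i (fst u) = 1 \<or> axial i (fst u) = -1"
          using adj lk by (simp add: adjacent_def axial_def)
        have c: "?c = - (1 / of_int (axial i (fst u)))"
          using lk by (simp add: zl_def axial_def minus_divide_right)
        have "seminormal (axial i (fst u)) = 0" using ax by (simp add: seminormal_def)
        then show ?thesis unfolding J opS_def diag_s_single c pol_s_1 by simp
      next
        case 4
        obtain j where j: "1 \<le> j" "j < N" "entry (snd u) (Suc j) < entry (snd u) j"
          using exists_entry_descent[OF u 4(2)] 4(1) by auto
        have dj: "dn j u" by (rule dn_if_entry[OF j(3)])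
        have fj: "fst (lab u (Suc j)) < fst (lab u j)" using j(3) by (simp add: lab_def)
        have fxy: "fst ?x = fst ?y" using adj by (simp add: adjacent_def)
        have "j \<noteq> i" using fj fxy by auto
        note w = dn_step[OF u j(1,2) dj]
        consider "Suc (Suc j) \<le> i \<or> Suc (Suc i) \<le> j" | "j = Suc i" | "i = Suc j"
          using \<open>j \<noteq> i\<close> by linarith
        then show ?thesis
        proof cases
          case 1
          have lw: "lab (step j u) i = ?x" "lab (step j u) (Suc i) = ?y"
            using 1 i j by (auto intro!: lab_step_other[OF u j(1,2)])
          have "opS i ?c (Jack lam (step j u)) = 0"
            using AD[OF step(2)[OF w] i] lw adj by simp
          moreover have "opS i ?c (opS j (cd u j) (Jack lam (step j u)))
              = opS j (cd u j) (opS i ?c (Jack lam (step j u)))"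
            using 1 opS_far[of i j] opS_far[of j i] by (elim disjE) auto
          ultimately show ?thesis using Jack_dn[OF u j(1,2) dj] by simp
        next
          case 2
          let ?z = "lab u (Suc (Suc i))"
          have r: "Suc i < N" "1 \<le> Suc i" "i \<le> N" using 2 j by auto
          have lw: "lab (step j u) i = ?x" "lab (step j u) (Suc i) = ?z" "lab (step j u) (Suc (Suc i)) = ?y"
            using 2 i lab_step_swap[OF u j(1,2)] lab_step_other[OF u j(1,2) i(1) r(3)] by auto
          have zx: "?z \<sqsubset> ?x" and zy: "?z \<sqsubset> ?y" using fj fxy 2 by (auto simp: prec_def)
          have dw: "dn i (step j u)" using lw zx by simp
          note w2 = dn_step[OF w(1) i dw]
          have lw2: "lab (step i (step j u)) (Suc i) = ?x" "lab (step i (step j u)) (Suc (Suc i)) = ?y"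
            using lab_step_swap[OF w(1) i] lab_step_other[OF w(1) i, of "Suc (Suc i)"] lw 2 j i by auto
          let ?J = "Jack lam (step i (step j u))"
          have Aw: "A (step i (step j u))" by (rule step(2)[OF w2(1) descent_trans[OF w2(2) w(2)]])
          have z: "opS (Suc i) ?c ?J = 0" using AD[OF Aw r(2,1)] lw2 adj by simp
          have JM: "?J \<in> Mod" by (rule Jack_Mod[OF w2(1)])
          \<comment> \<open>The coefficient of the annihilating operator satisfies the same identity
            as that of an edge, so \<open>yang_baxter\<close> carries this operator across two edges
            to a vertex covered by the induction hypothesis.\<close>
          have yb: "1 / (zl ?y - zl ?z) * (1 / (zl ?x - zl ?z) + ?c) = 1 / (zl ?x - zl ?z) * ?c"
            using inverse_sum_identity[of "zl ?x - zl ?z" "zl ?y - zl ?x"] prec_zl(1)[OF zx] prec_zl(1)[OF zy]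
              zl_diff_eq_of_int_iff[of ?y ?x 0] adj by (auto simp: adjacent_def)
          have "Jack lam u = opS (Suc i) (1 / (zl ?y - zl ?z)) (opS i (1 / (zl ?x - zl ?z)) ?J)"
            using Jack_dn[OF u j(1,2) dj] Jack_dn[OF w(1) i dw] lw 2 by (simp add: cd_def)
          then show ?thesis using yang_baxter[OF JM i(1) r(1) yb] z by simp
        next
          case 3
          let ?z = "lab u j"
          have r: "Suc j < N" "1 \<le> Suc j" "j \<le> N" "1 \<le> Suc (Suc j)" "Suc (Suc j) \<le> N" using 3 i j by auto
          have lw: "lab (step j u) j = ?x" "lab (step j u) (Suc j) = ?z" "lab (step j u) (Suc (Suc j)) = ?y"
            using 3 lab_step_swap[OF u j(1,2)] lab_step_other[OF u j(1,2) r(4,5)] by auto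
          have xz: "?x \<sqsubset> ?z" and yz: "?y \<sqsubset> ?z" using fj fxy 3 by (auto simp: prec_def)
          have dw: "dn (Suc j) (step j u)" using lw yz by simp
          note w2 = dn_step[OF w(1) r(2,1) dw]
          have lw2: "lab (step (Suc j) (step j u)) j = ?x" "lab (step (Suc j) (step j u)) (Suc j) = ?y"
            using lab_step_swap[OF w(1) r(2,1)] lab_step_other[OF w(1) r(2,1) j(1) r(3)] lw by auto
          let ?J = "Jack lam (step (Suc j) (step j u))"
          have Aw: "A (step (Suc j) (step j u))" by (rule step(2)[OF w2(1) descent_trans[OF w2(2) w(2)]])
          have z: "opS j ?c ?J = 0" using AD[OF Aw j(1,2)] lw2 adj by simp
          have JM: "?J \<in> Mod" by (rule Jack_Mod[OF w2(1)])
          have yb: "1 / (zl ?z - zl ?x) * (?c + 1 / (zl ?z - zl ?y)) = ?c * (1 / (zl ?z - zl ?y))"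
            using inverse_sum_identity[of "zl ?y - zl ?x" "zl ?z - zl ?y"] prec_zl(1)[OF xz] prec_zl(1)[OF yz]
              zl_diff_eq_of_int_iff[of ?y ?x 0] adj by (auto simp: adjacent_def)
          have "Jack lam u = opS j (1 / (zl ?z - zl ?x)) (opS (Suc j) (1 / (zl ?z - zl ?y)) ?J)"
            using Jack_dn[OF u j(1,2) dj] Jack_dn[OF w(1) r(2,1) dw] lw 3 by (simp add: cd_def)
          then show ?thesis using yang_baxter[OF JM j(1) r(1) yb] z 3 by simp
        qed
      qed
    qed
  qed
  then show ?thesis using AD assms by blast
qed

end

section \<open>Coefficients of monomials\<close>

text \<open>The coefficient of the monomial m is kept as a constant polynomial, so that
  \<open>diag_s\<close> and \<open>diag_word\<close> still apply and reduce to the action on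
  tableaux.\<close>

definition cp :: "(nat \<Rightarrow>\<^sub>0 nat) \<Rightarrow> tabpol \<Rightarrow> tabpol" where
  "cp m P = Poly_Mapping.map (\<lambda>f. pconst (lookup f m)) P"

lemma lookup_cp [simp]: "lookup (cp m P) \<tau> = pconst (lookup (lookup P \<tau>) m)"
  by (simp add: cp_def map.rep_eq when_def)

lemma cp_0 [simp]: "cp m 0 = 0"
  by (auto intro!: poly_mapping_eqI)

lemma cp_add: "cp m (P + Q) = cp m P + cp m Q"
  by (rule poly_mapping_eqI) (simp add: lookup_add pconst_add)

lemma cp_smul: "cp m (smul c P) = smul c (cp m P)"
  by (rule poly_mapping_eqI) (simp add: pconst_mult)

lemma cp_single: "cp m (single \<tau> f) = single \<tau> (pconst (lookup f m))"
  by (rule poly_mapping_eqI) (simp add: lookup_single when_def)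

lemma cp_sum: "cp m (sum g A) = (\<Sum>a\<in>A. cp m (g a))"
  by (rule additive_sum) (auto simp: cp_add)

lemma cp_diag_s: "cp m (diag_s i P) = diag_s i (cp (mon_s i m) P)"
  by (rule additive_eq_on_keys[where F = "\<lambda>P. cp m (diag_s i P)" and G = "\<lambda>P. diag_s i (cp (mon_s i m) P)"])
    (auto simp: diag_s_add cp_add diag_s_single cp_smul cp_single)

definition mon_perm :: "nat list \<Rightarrow> (nat \<Rightarrow>\<^sub>0 nat) \<Rightarrow> (nat \<Rightarrow>\<^sub>0 nat)" where
  "mon_perm ws m = Poly_Mapping.map_key (word_perm ws) m"

lemma lookup_mon_perm [simp]: "lookup (mon_perm ws m) k = lookup m (word_perm ws k)"
  by (simp add: mon_perm_def map_key.rep_eq inj_word_perm)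

lemma cp_diag_word: "cp m (diag_word ws P) = diag_word ws (cp (mon_perm ws m) P)"
proof (induction ws arbitrary: P)
  case Nil
  have "mon_perm [] m = m" by (rule poly_mapping_eqI) simp
  then show ?case by (simp add: diag_word_def)
next
  case (Cons i ws)
  have "mon_s i (mon_perm ws m) = mon_perm (i # ws) m"
    by (rule poly_mapping_eqI) (simp add: word_perm_Cons)
  then show ?case using Cons[of "diag_s i P"] by (simp add: diag_word_def cp_diag_s)
qed

lemma lookup_pvar_mult:
  "lookup (pvar k * f) m = (if 0 < lookup m k then lookup f (m - single k 1) else 0)"
proof (rule additive_eq_on_keys[where F = "\<lambda>f. lookup (pvar k * f) m"
      and G = "\<lambda>f. if 0 < lookup m k then lookup f (m - single k 1) else 0"])
  fix m' :: "nat \<Rightarrow>\<^sub>0 nat" and c :: qalpha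
  have "single k 1 + m' = m \<longleftrightarrow> 0 < lookup m k \<and> m' = m - single k 1"
  proof
    assume "single k 1 + m' = m"
    then show "0 < lookup m k \<and> m' = m - single k 1" by (auto simp: lookup_add)
  next
    assume h: "0 < lookup m k \<and> m' = m - single k 1"
    show "single k 1 + m' = m"
    proof (rule poly_mapping_eqI)
      fix l show "lookup (single k 1 + m') l = lookup m l"
        using h by (cases "l = k") (auto simp: lookup_add lookup_minus lookup_single)
    qed
  qed
  then show "lookup (pvar k * single m' c) m = (if 0 < lookup m k then lookup (single m' c) (m - single k 1) else 0)"
    by (auto simp: pvar_def mult_single lookup_single when_def)
qed (auto simp: algebra_simps lookup_add)

lemma cp_pmul_pvar: "cp m (pmul (pvar k) P) = (if 0 < lookup m k then cp (m - single k 1) P else 0)"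
  by (rule poly_mapping_eqI) (simp add: lookup_pvar_mult)

lemma cp_Psi:
  "cp m (Psi n P) = (if 0 < lookup m n then diag_word [1..<n] (cp (mon_perm [1..<n] (m - single n 1)) P) else 0)"
  by (simp add: Psi_def cp_pmul_pvar cp_diag_word)

definition mon :: "nat list \<Rightarrow> (nat \<Rightarrow>\<^sub>0 nat)" where
  "mon v = (\<Sum>k\<in>{1..length v}. single k (entry v k))"

lemma lookup_mon: "lookup (mon v) k = (if 1 \<le> k \<and> k \<le> length v then entry v k else 0)"
proof -
  have "lookup (mon v) k = (\<Sum>j\<in>{1..length v}. if j = k then entry v k else 0)"
    unfolding mon_def lookup_sum by (rule sum.cong) (auto simp: lookup_single when_def)
  then show ?thesis by (auto simp: sum.delta)
qed

section \<open>The order on exponents\<close>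

text \<open>\<open>level n f t r\<close> is the number of integers \<open>i + n (j - f i) \<le> r - n t\<close> with \<open>1 \<le> i \<le> n\<close>, \<open>j \<ge> 0\<close>.
  On such sets of integers \<open>\<Psi>\<close> is a shift and the affine symmetric group acts naturally; comparing the
  counts is containment of the associated core partitions, hence compatible with both actions.\<close>

definition level :: "nat \<Rightarrow> (nat \<Rightarrow> nat) \<Rightarrow> nat \<Rightarrow> nat \<Rightarrow> nat" where
  "level n f t r = (\<Sum>k\<in>{1..n}. if k \<le> r then f k + 1 - t else f k - t)"

definition level_le :: "nat \<Rightarrow> (nat \<Rightarrow> nat) \<Rightarrow> (nat \<Rightarrow> nat) \<Rightarrow> bool" where
  "level_le n f g \<longleftrightarrow> (\<forall>t r. r \<le> n \<longrightarrow> level n f t r \<le> level n g t r)"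

lemma level_cong: "(\<And>k. 1 \<le> k \<Longrightarrow> k \<le> n \<Longrightarrow> f k = g k) \<Longrightarrow> level n f = level n g"
  unfolding level_def by (intro ext sum.cong) auto

lemma level_le_cong:
  assumes "\<And>k. 1 \<le> k \<Longrightarrow> k \<le> n \<Longrightarrow> f k = f' k" "\<And>k. 1 \<le> k \<Longrightarrow> k \<le> n \<Longrightarrow> g k = g' k"
  shows "level_le n f g \<longleftrightarrow> level_le n f' g'"
  unfolding level_le_def using level_cong[of n f f'] level_cong[of n g g'] assms by simp

lemma level_le_refl [simp]: "level_le n f f"
  by (simp add: level_le_def)

lemma level_le_trans: "level_le n f g \<Longrightarrow> level_le n g h \<Longrightarrow> level_le n f h"
  unfolding level_le_def by (meson order_trans)

lemma level_Suc:
  assumes "r < n"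
  shows "level n f t (Suc r) = level n f t r + (if t \<le> f (Suc r) then 1 else 0)"
proof -
  have A: "Suc r \<in> {1..n}" using assms by auto
  have "(\<Sum>k\<in>{1..n} - {Suc r}. if k \<le> Suc r then f k + 1 - t else f k - t)
      = (\<Sum>k\<in>{1..n} - {Suc r}. if k \<le> r then f k + 1 - t else f k - t)"
    by (rule sum.cong) auto
  then show ?thesis unfolding level_def sum.remove[OF finite_atLeastAtMost A] by auto
qed

lemma level_card:
  "r \<le> n \<Longrightarrow> level n f t r = level n f t 0 + card {k \<in> {1..r}. t \<le> f k}"
proof (induction r)
  case (Suc r)
  have "{k \<in> {1..Suc r}. t \<le> f k} = {k \<in> {1..r}. t \<le> f k} \<union> (if t \<le> f (Suc r) then {Suc r} else {})"
    by (auto simp: le_Suc_eq)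
  then have "card {k \<in> {1..Suc r}. t \<le> f k} = card {k \<in> {1..r}. t \<le> f k} + (if t \<le> f (Suc r) then 1 else 0)"
    by (auto simp: card_insert_if)
  then show ?case using Suc level_Suc[of r n f t] by simp
qed simp

text \<open>For r \<noteq> i the transposition preserves the set of indices up to r, so the sum is
  merely permuted.\<close>

lemma level_transpose_other:
  assumes "1 \<le> i" "i < n" "r \<noteq> i"
  shows "level n (f \<circ> transpose i (Suc i)) t r = level n f t r"
proof -
  let ?t = "transpose i (Suc i)"
  have p: "?t permutes {1..n}" using assms by (intro permutes_swap_id) auto
  have "level n (f \<circ> ?t) t r = (\<Sum>k\<in>{1..n}. ((\<lambda>k. if k \<le> r then f k + 1 - t else f k - t) \<circ> ?t) k)"
    unfolding level_def using assms by (intro sum.cong) (auto simp: transpose_def)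
  also have "\<dots> = level n f t r"
    unfolding level_def by (rule sum.permute[OF p, symmetric])
  finally show ?thesis .
qed

lemma level_transpose_same:
  assumes "1 \<le> i" "i < n"
  shows "level n (f \<circ> transpose i (Suc i)) t i = level n f t (i - 1) + (if t \<le> f (Suc i) then 1 else 0)"
proof -
  obtain j where j: "i = Suc j" using assms by (cases i) auto
  then show ?thesis
    using assms level_Suc[of j n "f \<circ> transpose i (Suc i)" t] level_transpose_other[of i n j f t] by simp
qed

lemma level_at:
  assumes "1 \<le> i" "i < n"
  shows "level n f t i = level n f t (i - 1) + (if t \<le> f i then 1 else 0)"
  using assms level_Suc[of "i - 1" n f t] by simp

text \<open>As in the lifting property of the Bruhat order, only the cutoff r = i is affected. If
  g(i+1) reaches t, one compares at i-1; if not, g i does not reach t either, and one compares at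
  i+1.\<close>

lemma level_le_transpose:
  assumes "1 \<le> i" "i < n" "g i \<le> g (Suc i)" "level_le n f g"
  shows "level_le n (f \<circ> transpose i (Suc i)) (g \<circ> transpose i (Suc i))"
  unfolding level_le_def
proof (intro allI impI)
  fix t r assume r: "r \<le> n"
  have le: "level n f t s \<le> level n g t s" if "s \<le> n" for s using assms(4) that by (simp add: level_le_def)
  show "level n (f \<circ> transpose i (Suc i)) t r \<le> level n (g \<circ> transpose i (Suc i)) t r"
  proof (cases "r = i")
    case True
    have s: "level n h t (Suc i) = level n h t (i - 1) + (if t \<le> h i then 1 else 0) + (if t \<le> h (Suc i) then 1 else 0)" for h
      using level_Suc[of i n h t] level_at[OF assms(1,2), of h t] assms by simp
    have "level n f t (i - 1) \<le> level n g t (i - 1)" "level n f t (Suc i) \<le> level n g t (Suc i)"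
      using assms by (auto intro!: le)
    then show ?thesis
      unfolding True level_transpose_same[OF assms(1,2)] using s[of f] s[of g] assms(3)
      by (auto split: if_splits)
  next
    case False
    then show ?thesis using level_transpose_other[OF assms(1,2)] le[OF r] by simp
  qed
qed

lemma level_le_swap_up:
  assumes "1 \<le> i" "i < n" "g i \<le> g (Suc i)"
  shows "level_le n g (g \<circ> transpose i (Suc i))"
  unfolding level_le_def
proof (intro allI impI)
  fix t r assume "r \<le> n"
  show "level n g t r \<le> level n (g \<circ> transpose i (Suc i)) t r"
    using level_transpose_same[OF assms(1,2), of g t] level_at[OF assms(1,2), of g t]
      level_transpose_other[OF assms(1,2), of r g t] assms(3) by (cases "r = i") auto
qed

lemma not_level_le_swap:
  assumes "1 \<le> i" "i < n" "g i < g (Suc i)"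
  shows "\<not> level_le n (g \<circ> transpose i (Suc i)) g"
proof
  assume "level_le n (g \<circ> transpose i (Suc i)) g"
  \<comment> \<open>The threshold g(i+1) is reached by exactly one of the two exchanged
    entries.\<close>
  then have "level n (g \<circ> transpose i (Suc i)) (g (Suc i)) i \<le> level n g (g (Suc i)) i"
    using assms by (simp add: level_le_def)
  then show False
    using level_transpose_same[OF assms(1,2), of g "g (Suc i)"] level_at[OF assms(1,2), of g "g (Suc i)"] assms(3)
    by simp
qed

text \<open>\<open>vpsi\<close> on functions, so that exponents of monomials and entries of v are
  rotated alike.\<close>

definition rot :: "nat \<Rightarrow> (nat \<Rightarrow> nat) \<Rightarrow> nat \<Rightarrow> nat" where
  "rot n g k = (if k = n then g 1 + 1 else g (Suc k))"

lemma sum_split_first: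
  fixes F :: "nat \<Rightarrow> nat"
  shows "(\<Sum>k\<in>{1..Suc n}. F k) = F 1 + (\<Sum>k\<in>{1..n}. F (Suc k))"
proof -
  have "(\<Sum>k\<in>{1..Suc n}. F k) = F 1 + (\<Sum>k\<in>{Suc 1..Suc n}. F k)"
    by (rule sum.atLeast_Suc_atMost) simp
  also have "(\<Sum>k\<in>{Suc 1..Suc n}. F k) = (\<Sum>k\<in>{1..n}. F (Suc k))"
    by (rule sum.shift_bounds_cl_Suc_ivl)
  finally show ?thesis .
qed

lemma level_rot:
  assumes "r < n"
  shows "level n (rot n g) t r = level n g t (Suc r)"
proof -
  obtain m where m: "n = Suc m" using assms by (cases n) auto
  have "level n (rot n g) t r = (\<Sum>k\<in>{1..m}. if k \<le> r then g (Suc k) + 1 - t else g (Suc k) - t) + (g 1 + 1 - t)"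
    unfolding level_def m using assms m by (auto simp: rot_def intro!: sum.cong)
  moreover have "level n g t (Suc r) = (g 1 + 1 - t) + (\<Sum>k\<in>{1..m}. if k \<le> r then g (Suc k) + 1 - t else g (Suc k) - t)"
    unfolding level_def m sum_split_first by (auto intro!: sum.cong)
  ultimately show ?thesis by simp
qed

text \<open>In the picture of integers this is the same shift as for r < n: past r = n the threshold
  drops to t - 1 and the cutoff restarts at 1. For t = 0 there is no lower threshold, and the count
  is computed outright.\<close>

lemma level_rot_top:
  assumes "0 < n"
  shows "level n (rot n g) t n = (if t = 0 then level n g 0 0 + n + 1 else level n g (t - 1) 1)"
proof -
  obtain m where m: "n = Suc m" using assms by (cases n) auto
  have L: "level n (rot n g) t n = (\<Sum>k\<in>{1..m}. g (Suc k) + 1 - t) + (g 1 + 2 - t)"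
    unfolding level_def m by (auto simp: rot_def intro!: sum.cong)
  show ?thesis
  proof (cases "t = 0")
    case True
    have "level n g 0 0 = g 1 + (\<Sum>k\<in>{1..m}. g (Suc k))"
      unfolding level_def m sum_split_first by (auto intro!: sum.cong)
    then show ?thesis using L True m by (simp add: sum.distrib sum_Suc)
  next
    case False
    have a: "level n g (t - 1) 1 = (g 1 + 1 - (t - 1)) + (\<Sum>k\<in>{1..m}. g (Suc k) - (t - 1))"
      unfolding level_def m sum_split_first by (auto intro!: sum.cong)
    have b: "g 1 + 1 - (t - 1) = g 1 + 2 - t" using False by simp
    have c: "(\<Sum>k\<in>{1..m}. g (Suc k) + 1 - t) = (\<Sum>k\<in>{1..m}. g (Suc k) - (t - 1))"
      using False by (intro sum.cong) auto
    show ?thesis unfolding L a b c using False by simp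
  qed
qed

lemma level_le_rot:
  assumes "0 < n" "level_le n f g"
  shows "level_le n (rot n f) (rot n g)"
  unfolding level_le_def
proof (intro allI impI)
  fix t r assume r: "r \<le> n"
  have le: "level n f t s \<le> level n g t s" if "s \<le> n" for t s using assms(2) that by (simp add: level_le_def)
  show "level n (rot n f) t r \<le> level n (rot n g) t r"
  proof (cases "r < n")
    case True
    then show ?thesis using level_rot[OF True] le[of "Suc r" t] by simp
  next
    case False
    then have "r = n" using r by simp
    then show ?thesis using level_rot_top[OF assms(1)] le[of 0 0] le[of 1 "t - 1"] assms(1) by simp
  qed
qed

text \<open>At threshold f k and cutoff k all k positions count for f, because f decreases; so they
  must all count for g. Hence f \<le> g pointwise, and equal sums, read off at t = r = 0, force
  equality.\<close>

lemma level_le_max: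
  assumes anti: "\<And>j k. 1 \<le> j \<Longrightarrow> j \<le> k \<Longrightarrow> k \<le> n \<Longrightarrow> f k \<le> f j"
    and same: "\<And>t. level n f t 0 = level n g t 0"
    and le: "level_le n f g" and k: "1 \<le> k" "k \<le> n"
  shows "f k = g k"
proof -
  have ge: "f k \<le> g k" if "1 \<le> k" "k \<le> n" for k
  proof -
    have "level n f (f k) k \<le> level n g (f k) k" using le that by (simp add: level_le_def)
    then have "card {j \<in> {1..k}. f k \<le> f j} \<le> card {j \<in> {1..k}. f k \<le> g j}"
      using level_card[of k n f "f k"] level_card[of k n g "f k"] same that by simp
    moreover have "{j \<in> {1..k}. f k \<le> f j} = {1..k}" using anti that by auto
    ultimately have "card {1..k} \<le> card {j \<in> {1..k}. f k \<le> g j}" by simp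
    then have "{j \<in> {1..k}. f k \<le> g j} = {1..k}"
      by (intro card_seteq) auto
    then have "k \<in> {j \<in> {1..k}. f k \<le> g j}" using that by simp
    then show ?thesis by simp
  qed
  show ?thesis
  proof (rule ccontr)
    assume "f k \<noteq> g k"
    then have "f k < g k" using ge[OF k] by simp
    then have "(\<Sum>j\<in>{1..n}. f j) < (\<Sum>j\<in>{1..n}. g j)"
      using k ge by (intro sum_strict_mono_ex1) auto
    moreover have "level n h 0 0 = (\<Sum>j\<in>{1..n}. h j)" for h
      unfolding level_def by (rule sum.cong) auto
    ultimately show False using same[of 0] by simp
  qed
qed

section \<open>Leading monomials\<close>

context shape
begin

text \<open>Descending through v alone makes the word \<open>ws\<close> common to all tableaux. The
  leading coefficient is then the image of \<tau> under an invertible operator independent of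
  \<tau>, which later separates the summands of J_T.\<close>

lemma Jack_leading:
  assumes "length v = N"
  shows "\<exists>ws. set ws \<subseteq> {1..<N} \<and> (\<forall>\<tau>. rst \<tau> \<longrightarrow>
    (\<forall>m. cp m (Jack lam (\<tau>, v)) \<noteq> 0 \<longrightarrow> level_le N (lookup m) (entry v)) \<and>
    cp (mon v) (Jack lam (\<tau>, v)) = diag_word ws (single \<tau> 1))"
proof -
  define L where "L v ws \<longleftrightarrow> set ws \<subseteq> {1..<N} \<and> (\<forall>\<tau>. rst \<tau> \<longrightarrow>
    (\<forall>m. cp m (Jack lam (\<tau>, v)) \<noteq> 0 \<longrightarrow> level_le N (lookup m) (entry v)) \<and>
    cp (mon v) (Jack lam (\<tau>, v)) = diag_word ws (single \<tau> 1))" for v ws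
  have "\<exists>ws. L (snd u) ws" if "valid u" for u
    using that
  proof (induction u rule: valid_descent_induct)
    case (step u)
    define v where "v = snd u"
    have n: "length v = N" using step(1) by (simp add: valid_def v_def)
    have vv: "valid (\<tau>, v)" if "rst \<tau>" for \<tau> using that n by (simp add: valid_def)
    consider "v = replicate N 0" | "0 < N" "0 < fst (lab u N)"
      | "v \<noteq> replicate N 0" "0 < N \<Longrightarrow> fst (lab u N) = 0"
      by linarith
    then have "\<exists>ws. L v ws"
    proof cases
      case 1
      have "lookup (mon v) k = 0" for k
        by (auto simp: lookup_mon 1)
      then have m0: "mon v = 0" by (intro poly_mapping_eqI) simp
      have "L v []"
        unfolding L_def
      proof (intro conjI allI impI)
        fix \<tau> assume "rst \<tau>"
        then have J: "Jack lam (\<tau>, v) = single \<tau> 1" using Jack_zero 1 by simp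
        show "cp (mon v) (Jack lam (\<tau>, v)) = diag_word [] (single \<tau> 1)"
          by (simp add: J cp_single m0 diag_word_def)
        fix m assume "cp m (Jack lam (\<tau>, v)) \<noteq> 0"
        then have "m = 0" by (cases "m = 0") (simp_all add: J cp_single lookup_one)
        then show "level_le N (lookup m) (entry v)"
          using level_le_cong[of N "lookup m" "\<lambda>_. 0" "entry v" "\<lambda>_. 0"] 1 by auto
      qed simp
      then show ?thesis by blast
    next
      case 2
      define v' where "v' = snd (unpsi u)"
      have n': "length v' = N" using unpsi(1)[OF step(1) 2] by (simp add: valid_def v'_def)
      obtain ws where ws: "L v' ws"
        using step(2)[OF unpsi(1)[OF step(1) 2] descent_unpsi[OF step(1) 2]] v'_def by blast
      have fN: "0 < entry v N" using 2 by (simp add: lab_def v_def)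
      have ev: "entry v k = rot N (entry v') k" if "1 \<le> k" "k \<le> N" for k
      proof -
        have "v = vpsi v'" using unpsi(2)[OF step(1) 2] by (simp add: v'_def v_def psi_def prod_eq_iff)
        moreover have "v' \<noteq> []" using n' 2 by auto
        ultimately show ?thesis using entry_vpsi[of v' k] that n' by (simp add: rot_def)
      qed
      have up: "unpsi (\<tau>, v) = (\<tau>, v')" for \<tau> by (simp add: unpsi_def v_def v'_def)
      let ?m' = "\<lambda>m. mon_perm [1..<N] (m - single N 1)"
      have rm: "lookup m k = rot N (lookup (?m' m)) k" if "0 < lookup m N" "1 \<le> k" "k \<le> N" for m k
        using that 2(1) by (auto simp: rot_def word_perm_cycle lookup_minus lookup_single when_def)
      have J: "Jack lam (\<tau>, v) = Psi N (Jack lam (\<tau>, v'))" if "rst \<tau>" for \<tau>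
        using Jack_unpsi[OF vv[OF that] 2(1)] fN up by (simp add: lab_def)
      have "L v (ws @ [1..<N])"
        unfolding L_def
      proof (intro conjI allI impI)
        show "set (ws @ [1..<N]) \<subseteq> {1..<N}" using ws by (auto simp: L_def)
        fix \<tau> assume \<tau>: "rst \<tau>"
        have mv: "?m' (mon v) = mon v'"
        proof (rule poly_mapping_eqI)
          fix k
          consider "k = 1" | "1 < k \<and> k \<le> N" | "k = 0 \<or> N < k" by linarith
          then show "lookup (?m' (mon v)) k = lookup (mon v') k"
          proof cases
            case 1
            then show ?thesis using 2(1) n n' ev[of N]
              by (simp add: word_perm_cycle lookup_minus lookup_mon rot_def)
          next
            case c2: 2
            then obtain l where l: "k = Suc l" "1 \<le> l" "l < N" by (cases k) auto
            then have "word_perm [1..<N] k = l" by (simp add: word_perm_cycle)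
            then show ?thesis using l n n' ev[of l]
              by (simp add: lookup_minus lookup_mon rot_def lookup_single)
          next
            case 3
            then show ?thesis using 2(1) n n'
              by (auto simp: word_perm_cycle lookup_minus lookup_mon)
          qed
        qed
        have "0 < lookup (mon v) N" using fN n 2(1) by (simp add: lookup_mon)
        then show "cp (mon v) (Jack lam (\<tau>, v)) = diag_word (ws @ [1..<N]) (single \<tau> 1)"
          using ws \<tau> J[OF \<tau>] mv by (simp add: cp_Psi L_def diag_word_append)
        fix m assume "cp m (Jack lam (\<tau>, v)) \<noteq> 0"
        then have m: "0 < lookup m N" "cp (?m' m) (Jack lam (\<tau>, v')) \<noteq> 0"
          using J[OF \<tau>] by (auto simp: cp_Psi split: if_splits)
        have "level_le N (lookup (?m' m)) (entry v')" using ws \<tau> m(2) by (simp add: L_def)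
        then have "level_le N (rot N (lookup (?m' m))) (rot N (entry v'))" using 2(1) by (intro level_le_rot)
        then show "level_le N (lookup m) (entry v)"
          using level_le_cong[of N "lookup m" "rot N (lookup (?m' m))" "entry v" "rot N (entry v')"] rm[OF m(1)] ev
          by blast
      qed
      then show ?thesis by blast
    next
      case 3
      obtain j where j: "1 \<le> j" "j < N" "entry v (Suc j) < entry v j"
        using exists_entry_descent[OF step(1)] 3 unfolding v_def by blast
      define v' where "v' = vswap j v"
      let ?t = "transpose j (Suc j)"
      have ev: "entry v' k = entry v (?t k)" if "1 \<le> k" "k \<le> N" for k
        unfolding v'_def using entry_vswap[OF j(1) _ that(1)] j(2) that n by simp
      have ev2: "entry v k = entry v' (?t k)" if "1 \<le> k" "k \<le> N" for k
        using ev[OF transpose_Suc_range[OF j(1,2) that]] by simp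
      have lt: "entry v' j < entry v' (Suc j)" using ev[of j] ev[of "Suc j"] j by simp
      have dj: "dn j (\<tau>, v)" for \<tau> using j(3) by (intro dn_if_entry) simp
      have st: "step j (\<tau>, v) = (\<tau>, v')" for \<tau> using j(3) by (simp add: step_def v'_def)
      have du: "dn j u" using dj[of "fst u"] by (simp add: v_def)
      have su: "snd (step j u) = v'" using st[of "fst u"] by (simp add: v_def)
      obtain ws where ws: "L v' ws"
        using step(2)[OF dn_step[OF step(1) j(1,2) du]] su by auto
      have J: "Jack lam (\<tau>, v) = opS j (cd (\<tau>, v) j) (Jack lam (\<tau>, v'))" if "rst \<tau>" for \<tau>
        using Jack_dn[OF vv[OF that] j(1,2) dj] st by simp
      have le: "level_le N (entry v') (entry v)"
        using level_le_swap_up[OF j(1,2), of "entry v'"] lt ev2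
          level_le_cong[of N "entry v'" "entry v'" "entry v" "entry v' \<circ> ?t"] by simp
      have "L v (ws @ [j])"
        unfolding L_def
      proof (intro conjI allI impI)
        show "set (ws @ [j]) \<subseteq> {1..<N}" using ws j by (auto simp: L_def)
        fix \<tau> assume \<tau>: "rst \<tau>"
        have lev: "level_le N (lookup m) (entry v')" if "cp m (Jack lam (\<tau>, v')) \<noteq> 0" for m
          using ws \<tau> that by (simp add: L_def)
        have mv: "mon_s j (mon v) = mon v'"
        proof (rule poly_mapping_eqI)
          fix k show "lookup (mon_s j (mon v)) k = lookup (mon v') k"
            using ev[of k] n j transpose_Suc_range[OF j(1,2), of k]
            by (auto simp: lookup_mon v'_def transpose_def split: if_splits)
        qed
        \<comment> \<open>The scalar summand of the edge must not disturb the leading term: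
          \<open>mon v\<close> is strictly above v', which bounds all exponents of the previous
          polynomial.\<close>
        have "cp (mon v) (Jack lam (\<tau>, v')) = 0"
        proof (rule ccontr)
          assume "cp (mon v) (Jack lam (\<tau>, v')) \<noteq> 0"
          then have "level_le N (lookup (mon v)) (entry v')" by (rule lev)
          then have "level_le N (entry v' \<circ> ?t) (entry v')"
            using level_le_cong[of N "lookup (mon v)" "entry v' \<circ> ?t" "entry v'" "entry v'"] ev2 n
            by (simp add: lookup_mon)
          then show False using not_level_le_swap[of j N "entry v'"] j lt by simp
        qed
        then show "cp (mon v) (Jack lam (\<tau>, v)) = diag_word (ws @ [j]) (single \<tau> 1)"
          using ws \<tau> J[OF \<tau>] mv by (simp add: opS_def cp_add cp_smul cp_diag_s L_def diag_word_def)
        fix m assume "cp m (Jack lam (\<tau>, v)) \<noteq> 0"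
        then consider "cp (mon_s j m) (Jack lam (\<tau>, v')) \<noteq> 0" | "cp m (Jack lam (\<tau>, v')) \<noteq> 0"
          using J[OF \<tau>] by (force simp: opS_def cp_add cp_smul cp_diag_s)
        then show "level_le N (lookup m) (entry v)"
        proof cases
          case 1
          have "level_le N (lookup (mon_s j m) \<circ> ?t) (entry v' \<circ> ?t)"
            using lev[OF 1] lt j by (intro level_le_transpose) auto
          then show ?thesis
            using level_le_cong[of N "lookup m" "lookup (mon_s j m) \<circ> ?t" "entry v" "entry v' \<circ> ?t"] ev2 by simp
        next
          case 2
          then show ?thesis using lev le level_le_trans by blast
        qed
      qed
      then show ?thesis by blast
    qed
    then show ?case by (simp add: v_def)
  qed
  then have "\<exists>ws. L v ws" using assms rst_tau_shape by (metis snd_conv fst_conv valid_def)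
  then show ?thesis unfolding L_def .
qed

text \<open>Rearrangements have the same counts at r = 0, and among them the decreasing one is
  maximal by \<open>level_le_max\<close>; so its monomial cannot occur where the exponents are
  bounded by a different v.\<close>

lemma Jack_leading_dominant:
  assumes "valid (\<tau>, v)" "length v' = N" "mset v' = mset v" "sorted (rev v')" "v \<noteq> v'"
  shows "cp (mon v') (Jack lam (\<tau>, v)) = 0"
proof (rule ccontr)
  assume "cp (mon v') (Jack lam (\<tau>, v)) \<noteq> 0"
  moreover have n: "length v = N" "rst \<tau>" using assms(1) by (auto simp: valid_def)
  ultimately have "level_le N (lookup (mon v')) (entry v)" using Jack_leading[OF n(1)] by blast
  then have le: "level_le N (entry v') (entry v)"
    using level_le_cong[of N "lookup (mon v')" "entry v'" "entry v" "entry v"] assms(2) by (simp add: lookup_mon)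
  have lev0: "level N (entry w) t 0 = sum_mset (image_mset (\<lambda>x. x - t) (mset w))" if "length w = N" for w t
  proof -
    have "level N (entry w) t 0 = (\<Sum>k\<in>{1..length w}. entry w k - t)"
      unfolding level_def that by (rule sum.cong) auto
    also have "\<dots> = sum_mset (image_mset (\<lambda>x. x - t) (image_mset (entry w) (mset_set {1..length w})))"
      by (simp add: sum_unfold_sum_mset multiset.map_comp o_def)
    finally show ?thesis by (simp add: image_mset_entry)
  qed
  have ent: "entry v' k = entry v k" if "1 \<le> k" "k \<le> N" for k
  proof (rule level_le_max[OF _ _ le that])
    fix t show "level N (entry v') t 0 = level N (entry v) t 0" using lev0 assms n by simp
  next
    fix j k assume "1 \<le> j" "j \<le> k" "k \<le> N"
    then show "entry v' k \<le> entry v' j" using sorted_rev_nth_mono[OF assms(4), of "j - 1" "k - 1"] assms(2) by simp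
  qed
  have "v' ! k = v ! k" if "k < N" for k using ent[of "Suc k"] that by simp
  then show False using assms(2,5) n by (metis nth_equalityI)
qed

end

section \<open>The symmetrizer\<close>

lemma of_nat_qalpha_eq_0_iff: "(of_nat n :: qalpha) = 0 \<longleftrightarrow> n = 0"
  using of_int_qalpha_eq_0_iff[of "int n"] by simp

lemma qalpha_two_nonzero: "(2 :: qalpha) \<noteq> 0"
  using of_nat_qalpha_eq_0_iff[of 2] by simp

lemma smul_two: "smul 2 P = P + P"
  using smul.scale_left_distrib[of 1 1 P] by simp

lemma sum_const_smul: "finite A \<Longrightarrow> (\<Sum>a\<in>A. P) = smul (of_nat (card A)) P"
  by (induction A rule: finite_induct) (auto simp: smul.scale_left_distrib)

lemma Sym_0 [simp]: "Sym n 0 = 0"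
  by (simp add: Sym_def diag_perm_def)

lemma Sym_add: "Sym n (P + Q) = Sym n P + Sym n Q"
  by (simp add: Sym_def diag_perm_def diag_word_add sum.distrib)

lemma Sym_smul: "Sym n (smul c P) = smul c (Sym n P)"
  by (simp add: Sym_def diag_perm_def diag_word_smul smul.scale_sum_right)

lemma Sym_sum: "Sym n (sum g A) = (\<Sum>a\<in>A. Sym n (g a))"
  by (rule additive_sum) (auto simp: Sym_add)

lemma diag_perm_word:
  assumes "w permutes {1..n}"
  obtains ws where "set ws \<subseteq> {1..<n}" "word_perm ws = w" "\<And>P. diag_perm n w P = diag_word ws P"
proof -
  define ws where "ws = (SOME ws. set ws \<subseteq> {1..<n} \<and> word_perm ws = w)"
  have "set ws \<subseteq> {1..<n} \<and> word_perm ws = w"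
    unfolding ws_def by (rule someI_ex) (rule word_perm_surj[OF assms])
  then show ?thesis using that[of ws] by (simp add: diag_perm_def ws_def)
qed

lemma Sym_invariant:
  assumes "\<And>i. 1 \<le> i \<Longrightarrow> i < n \<Longrightarrow> diag_s i P = P"
  shows "Sym n P = smul (of_nat (card {w. w permutes {1..n}})) P"
proof -
  have word: "diag_word ws P = P" if "set ws \<subseteq> {1..<n}" for ws
    using that by (induction ws) (auto simp: diag_word_def assms)
  have "diag_perm n w P = P" if "w permutes {1..n}" for w
    using diag_perm_word[OF that] word by metis
  then have "Sym n P = (\<Sum>w | w permutes {1..n}. P)" by (simp add: Sym_def)
  then show ?thesis using sum_const_smul[OF finite_permutations[of "{1..n}"]] by simp
qed

context shape
begin

text \<open>The chosen word of w with i put in front and the chosen word of w s_i represent the same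
  permutation, hence the same operator on \<open>Mod\<close>; the sum is then reindexed by
  translation.\<close>

lemma Sym_diag_s:
  assumes "P \<in> Mod" "1 \<le> i" "i < N"
  shows "Sym N (diag_s i P) = Sym N P"
proof -
  let ?t = "transpose i (Suc i)"
  have tp: "?t permutes {1..N}" using assms by (intro permutes_swap_id) auto
  have eq: "diag_perm N w (diag_s i P) = diag_perm N (w \<circ> ?t) P" if w: "w permutes {1..N}" for w
  proof -
    obtain ws where ws: "set ws \<subseteq> {1..<N}" "word_perm ws = w" "\<And>P. diag_perm N w P = diag_word ws P"
      using diag_perm_word[OF w] by metis
    have wt: "(w \<circ> ?t) permutes {1..N}" by (rule permutes_compose[OF tp w])
    obtain us where us: "set us \<subseteq> {1..<N}" "word_perm us = w \<circ> ?t" "\<And>P. diag_perm N (w \<circ> ?t) P = diag_word us P"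
      using diag_perm_word[OF wt] by metis
    have "diag_word (i # ws) P = diag_word us P"
      using assms ws(1,2) us(1,2) by (intro diag_word_cong) (auto simp: word_perm_Cons)
    then show ?thesis using ws(3) us(3) by (simp add: diag_word_def)
  qed
  have "Sym N (diag_s i P) = (\<Sum>w | w permutes {1..N}. diag_perm N (w \<circ> ?t) P)"
    unfolding Sym_def by (rule sum.cong) (auto simp: eq)
  also have "\<dots> = Sym N P"
    unfolding Sym_def
    by (rule sum.reindex_bij_witness[of _ "\<lambda>w. w \<circ> ?t" "\<lambda>w. w \<circ> ?t"])
      (simp_all add: permutes_compose[OF tp] o_assoc[symmetric])
  finally show ?thesis .
qed

lemma Sym_opS:
  assumes "P \<in> Mod" "1 \<le> i" "i < N"
  shows "Sym N (opS i a P) = smul (1 + a) (Sym N P)"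
  by (simp add: opS_def Sym_add Sym_smul Sym_diag_s[OF assms] smul.scale_left_distrib)

section \<open>Coefficients on a component\<close>

text \<open>The factor of an inverted pair in a closed form for the coefficients. An edge turns one
  neighbouring pair into an inversion and permutes the other pairs, so the product changes by
  exactly the prescribed ratio, and paths need not be compared.\<close>

definition inv_factor :: "nat \<times> int \<Rightarrow> nat \<times> int \<Rightarrow> qalpha" where
  "inv_factor x y = (if y \<sqsubset> x then (zl y - zl x) / (zl y - zl x + 1) else 1)"

definition inv_pairs :: "(nat \<times> nat) set" where
  "inv_pairs = {(i, j). 1 \<le> i \<and> i < j \<and> j \<le> N}"

definition inv_prod :: "vertex \<Rightarrow> qalpha" where
  "inv_prod u = (\<Prod>p\<in>inv_pairs. inv_factor (lab u (fst p)) (lab u (snd p)))"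

lemma finite_inv_pairs: "finite inv_pairs"
  by (rule finite_subset[of _ "{1..N} \<times> {1..N}"]) (auto simp: inv_pairs_def)

lemma inv_factor_nonzero: "inv_factor x y \<noteq> 0"
proof (cases "y \<sqsubset> x")
  case True
  have "zl y - zl x \<noteq> 0" "zl y - zl x + 1 \<noteq> 0" using prec_zl[OF True] by (auto simp: algebra_simps)
  then show ?thesis using True by (simp add: inv_factor_def)
qed (simp add: inv_factor_def)

lemma inv_prod_nonzero: "inv_prod u \<noteq> 0"
  unfolding inv_prod_def using finite_inv_pairs inv_factor_nonzero by (simp add: prod_zero_iff)

lemma inv_prod_step:
  assumes "valid u" "1 \<le> i" "i < N" "up i u"
  defines "x \<equiv> lab u i" and "y \<equiv> lab u (Suc i)"
  shows "inv_prod (step i u) = (zl x - zl y) / (zl x - zl y + 1) * inv_prod u"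
proof -
  let ?t = "transpose i (Suc i)"
  let ?p = "(i, Suc i)" and ?R = "inv_pairs - {(i, Suc i)}"
  have p: "?p \<in> inv_pairs" using assms by (simp add: inv_pairs_def)
  have ordered: "(?t (fst q), ?t (snd q)) \<in> ?R" if "q \<in> ?R" for q
    using that assms(2,3) by (cases q) (auto simp: inv_pairs_def transpose_def)
  have "(\<Prod>q\<in>?R. inv_factor (lab (step i u) (fst q)) (lab (step i u) (snd q)))
      = (\<Prod>q\<in>?R. inv_factor (lab u (?t (fst q))) (lab u (?t (snd q))))"
    using assms(1-3) by (intro prod.cong) (auto simp: inv_pairs_def lab_step)
  also have "\<dots> = (\<Prod>q\<in>?R. inv_factor (lab u (fst q)) (lab u (snd q)))"
    by (rule prod.reindex_bij_witness[of _ "\<lambda>q. (?t (fst q), ?t (snd q))" "\<lambda>q. (?t (fst q), ?t (snd q))"])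
      (use ordered in \<open>auto simp del: One_nat_def\<close>)
  finally have R: "(\<Prod>q\<in>?R. inv_factor (lab (step i u) (fst q)) (lab (step i u) (snd q)))
      = (\<Prod>q\<in>?R. inv_factor (lab u (fst q)) (lab u (snd q)))" .
  have f1: "inv_factor (lab (step i u) i) (lab (step i u) (Suc i)) = (zl x - zl y) / (zl x - zl y + 1)"
    using lab_step_swap[OF assms(1-3)] assms(4) by (simp add: inv_factor_def x_def y_def)
  have f2: "inv_factor (lab u i) (lab u (Suc i)) = 1"
    using prec_asym[OF assms(4)] by (simp add: inv_factor_def)
  show ?thesis
    unfolding inv_prod_def prod.remove[OF finite_inv_pairs p] R using f1 f2 by simp
qed

end

locale component = shape +
  fixes C :: "vertex set" and T :: tab
  assumes C: "C \<in> H_components lam"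
    and T: "T_of lam ` C = {T}"
begin

lemma C_facts:
  obtains u0 where "valid u0" "C = (H_adj lam)\<^sup>* `` {u0}"
  using C H_verts_iff by (auto simp: H_components_def)

lemma C_nonempty: "C \<noteq> {}" using T by auto

lemma C_valid: "u \<in> C \<Longrightarrow> valid u"
proof -
  assume "u \<in> C"
  obtain u0 where u0: "valid u0" "C = (H_adj lam)\<^sup>* `` {u0}" by (rule C_facts)
  then have "(u0, u) \<in> (H_adj lam)\<^sup>*" using \<open>u \<in> C\<close> by simp
  then show "valid u"
  proof induction
    case base
    then show ?case by (rule u0(1))
  next
    case (step y z)
    then obtain i where "H_edge lam y i z \<or> H_edge lam z i y" by (auto simp: H_adj_def)
    then show ?case using H_edge_iff[of y i z] H_edge_iff[of z i y] valid_step[of y i] by auto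
  qed
qed

lemma C_step:
  assumes "u \<in> C" "1 \<le> i" "i < N" "up i u \<or> dn i u"
  shows "step i u \<in> C"
proof -
  note v = C_valid[OF assms(1)]
  have vs: "valid (step i u)" by (rule valid_step[OF v assms(2-4)])
  have "H_edge lam u i (step i u) \<or> H_edge lam (step i u) i u"
    using H_edge_iff[of u i "step i u"] H_edge_iff[of "step i u" i u] v vs assms
      up_step_iff[OF v assms(2,3)] step_step[OF v assms(2-4)] by auto
  then have "(u, step i u) \<in> H_adj lam" by (auto simp: H_adj_def)
  moreover obtain u0 where u0: "C = (H_adj lam)\<^sup>* `` {u0}" by (rule C_facts)
  ultimately show ?thesis using assms(1) by (auto intro: rtrancl_into_rtrancl)
qed

lemma T_of_C: "u \<in> C \<Longrightarrow> T_of lam u = T"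
  using T by auto

lemma mset_C:
  assumes "u \<in> C"
  shows "mset (snd u) = image_mset T (mset_set (cells lam))"
proof -
  have v: "rst (fst u)" "length (snd u) = N" using C_valid[OF assms] by (auto simp: valid_def)
  have "image_mset T (mset_set (cells lam)) = image_mset (entry (vplus (snd u))) (image_mset (fst u) (mset_set (cells lam)))"
    unfolding multiset.map_comp using T_of_C[OF assms] T_of_cell[of _ u]
    by (intro image_mset_cong) simp
  also have "image_mset (fst u) (mset_set (cells lam)) = mset_set {1..length (vplus (snd u))}"
    using rst_bij[OF v(1)] v(2) by (subst image_mset_mset_set) (auto simp: bij_betw_def vplus_def)
  finally show ?thesis unfolding image_mset_entry by (simp add: vplus_def)
qed

lemma finite_C: "finite C"
proof (rule finite_subset)
  let ?A = "set_mset (image_mset T (mset_set (cells lam)))"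
  show "C \<subseteq> {\<tau>. rst \<tau>} \<times> {v. set v \<subseteq> ?A \<and> length v = N}"
  proof
    fix u assume u: "u \<in> C"
    have "set (snd u) = ?A" using mset_C[OF u] by (metis set_mset_mset)
    then show "u \<in> {\<tau>. rst \<tau>} \<times> {v. set v \<subseteq> ?A \<and> length v = N}"
      using C_valid[OF u] by (cases u) (auto simp: valid_def)
  qed
  show "finite ({\<tau>. rst \<tau>} \<times> {v. set v \<subseteq> ?A \<and> length v = N})"
    by (intro finite_cartesian_product finite_rst finite_lists_length_eq) auto
qed

abbreviation sink :: vertex where "sink \<equiv> (std lam T, lambda_T lam T)"

lemma card_less_sum: "card {q \<in> cells lam. T q < t} = (\<Sum>j<t. card {q \<in> cells lam. T q = j})"
proof (induction t)
  case (Suc t)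
  have "{q \<in> cells lam. T q < Suc t} = {q \<in> cells lam. T q < t} \<union> {q \<in> cells lam. T q = t}" by auto
  moreover have "card ({q \<in> cells lam. T q < t} \<union> {q \<in> cells lam. T q = t})
      = card {q \<in> cells lam. T q < t} + card {q \<in> cells lam. T q = t}"
    by (rule card_Un_disjoint) auto
  ultimately show ?case using Suc by simp
qed simp

lemma sink_unique:
  assumes "u \<in> C" "\<And>k. 1 \<le> k \<Longrightarrow> k < N \<Longrightarrow> \<not> up k u"
  shows "u = sink"
proof -
  note v = C_valid[OF assms(1)]
  have so: "sorted (rev (snd u))" by (rule sink_structure(1)[OF v]) (rule assms(2))
  have ord: "fst u q < fst u p \<longleftrightarrow> row_order (T_of lam u) p q" if "p \<in> cells lam" "q \<in> cells lam" for p q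
    by (rule sink_structure(2)[OF v _ that]) (rule assms(2))
  have \<tau>: "rst (fst u)" using v by (simp add: valid_def)
  have "lambda_T lam T = rev (sort (rev (snd u)))"
    unfolding lambda_T_def mset_C[OF assms(1), symmetric] by (metis mset_rev sorted_list_of_multiset_mset)
  then have "lambda_T lam T = snd u" using so by (simp add: sorted_sort_id)
  moreover have "fst u p = std lam T p" for p
  proof (cases "p \<in> cells lam")
    case True
    obtain r c where p: "p = (r, c)" by fastforce
    \<comment> \<open>A and B together are the cells that precede p in \<open>row_order\<close>;
      their cardinalities are the two numbers subtracted in \<open>std\<close>.\<close>
    define A where "A = {q \<in> cells lam. T q < T p}"
    define B where "B = {(r', c') \<in> cells lam. T (r', c') = T (r, c) \<and> (r' < r \<or> (r' = r \<and> c' < c))}"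
    have fin: "finite A" "finite B"
      unfolding A_def B_def by (rule finite_subset[OF _ finite_cells], force)+
    have AB: "A \<inter> B = {}" unfolding A_def B_def p by auto
    have "fst u p < fst u q \<longleftrightarrow> q \<in> A \<union> B" if "q \<in> cells lam" for q
      using ord[OF that True] that unfolding T_of_C[OF assms(1)] row_order_def A_def B_def p
      by (cases q) simp
    moreover have "A \<union> B \<subseteq> cells lam" unfolding A_def B_def by auto
    ultimately have "{q \<in> cells lam. fst u p < fst u q} = A \<union> B" by blast
    then have "fst u p = N - (card A + card B)"
      using rst_rank[OF \<tau> True] card_Un_disjoint[OF fin AB] by simp
    also have "\<dots> = std lam T p"
      using True unfolding A_def card_less_sum B_def std_def sum_list_lam p by simp
    finally show ?thesis .
  next
    case False
    then show ?thesis using rst_outside[OF \<tau>] by (cases p) (simp add: std_def)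
  qed
  ultimately show ?thesis by (simp add: prod_eq_iff fun_eq_iff)
qed

section \<open>The source of a component and the coefficients\<close>

definition is_source :: "vertex \<Rightarrow> bool" where
  "is_source s \<longleftrightarrow> s \<in> C \<and> (\<forall>k. 1 \<le> k \<and> k < N \<longrightarrow> \<not> dn k s)"

lemma is_source_order:
  assumes "is_source s"
  shows "s \<in> C" "sorted (snd s)"
    "p \<in> cells lam \<Longrightarrow> q \<in> cells lam \<Longrightarrow> fst s q < fst s p \<longleftrightarrow> col_order T p q"
proof -
  show C: "s \<in> C" using assms by (simp add: is_source_def)
  have no: "\<not> dn k s" if "1 \<le> k" "k < N" for k using assms that by (simp add: is_source_def)
  show "sorted (snd s)" by (rule source_structure(1)[OF C_valid[OF C]]) (rule no)
  assume pq: "p \<in> cells lam" "q \<in> cells lam"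
  have "fst s q < fst s p \<longleftrightarrow> col_order (T_of lam s) p q"
    by (rule source_structure(2)[OF C_valid[OF C] _ pq]) (rule no)
  then show "fst s q < fst s p \<longleftrightarrow> col_order T p q" by (simp add: T_of_C[OF C])
qed

text \<open>T fixes the multiset of entries, hence the increasing vector, and it fixes the column
  order, hence the tableau.\<close>

lemma source_unique:
  assumes "is_source u" "is_source w"
  shows "u = w"
proof -
  note su = is_source_order[OF assms(1)] and sw = is_source_order[OF assms(2)]
  have "mset (snd u) = mset (snd w)" using mset_C[OF su(1)] mset_C[OF sw(1)] by simp
  then have "snd u = snd w" using su(2) sw(2) by (metis sorted_sort_id sorted_list_of_multiset_mset)
  moreover have "fst u = fst w"
  proof (rule rst_eqI_order)
    fix p q assume pq: "p \<in> cells lam" "q \<in> cells lam"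
    show "fst u q < fst u p \<longleftrightarrow> fst w q < fst w p"
      using su(3)[OF pq] sw(3)[OF pq] by simp
  qed (use C_valid[OF su(1)] C_valid[OF sw(1)] in \<open>auto simp: valid_def\<close>)
  ultimately show ?thesis by (simp add: prod_eq_iff)
qed

lemma source_exists:
  obtains s where "is_source s"
proof -
  have "u \<in> C \<longrightarrow> (\<exists>s. is_source s)" if "valid u" for u
    using that
  proof (induction u rule: valid_descent_induct)
    case (step u)
    show ?case
    proof
      assume u: "u \<in> C"
      show "\<exists>s. is_source s"
      proof (cases "\<exists>k. 1 \<le> k \<and> k < N \<and> dn k u")
        case True
        then obtain k where k: "1 \<le> k" "k < N" "dn k u" by (elim exE conjE)
        have "step k u \<in> C" using C_step[OF u k(1,2)] k(3) by simp
        then show ?thesis using step(2)[OF dn_step[OF step(1) k]] by simp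
      next
        case False
        then have "is_source u" using u by (simp add: is_source_def)
        then show ?thesis ..
      qed
    qed
  qed
  moreover obtain u where "u \<in> C" using C_nonempty by auto
  ultimately have "\<exists>s. is_source s" using C_valid[of u] by simp
  then show ?thesis using that by (elim exE)
qed

text \<open>\<open>E_rel\<close> may start at any vertex without entering edge; because there is
  only one, dividing by \<open>inv_prod s\<close> normalizes all paths alike.\<close>

lemma E_rel_source_value:
  assumes s: "is_source s" and "E_rel lam C u e"
  shows "u \<in> C \<and> e = inv_prod u / inv_prod s"
  using assms(2)
proof induction
  case (source u)
  have "\<not> dn k u" if "1 \<le> k" "k < N" for k
  proof
    assume dk: "dn k u"
    note vu = C_valid[OF source(1)]
    have "H_edge lam (step k u) k u"
      using H_edge_iff[of "step k u" k u] dn_step(1)[OF vu that dk] up_step_iff[OF vu that]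
        step_step[OF vu that] that dk by simp
    moreover have "step k u \<in> C" using C_step[OF source(1) that] dk by simp
    ultimately show False using source(2) by blast
  qed
  then have "is_source u" using source(1) by (simp add: is_source_def)
  then have "u = s" by (rule source_unique[OF _ s])
  then show ?case using source inv_prod_nonzero[of s] by simp
next
  case (step \<tau>' v' e w i)
  have h: "valid (\<tau>', v')" "1 \<le> i" "i < N" "up i (\<tau>', v')" "w = step i (\<tau>', v')"
    using H_edge_iff[of "(\<tau>', v')" i w] step(3) by simp_all
  show ?case
    using inv_prod_step[OF h(1-4)] step h(5) by (simp add: zeta_lab flip: Suc_eq_plus1)
qed

lemma E_rel_exists: "u \<in> C \<Longrightarrow> \<exists>e. E_rel lam C u e"
proof -
  have "u \<in> C \<longrightarrow> (\<exists>e. E_rel lam C u e)" if "valid u" for u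
    using that
  proof (induction u rule: valid_descent_induct)
    case (step u)
    show ?case
    proof
      assume u: "u \<in> C"
      show "\<exists>e. E_rel lam C u e"
      proof (cases "\<exists>k. 1 \<le> k \<and> k < N \<and> dn k u")
        case True
        then obtain k where k: "1 \<le> k" "k < N" "dn k u" by (elim exE conjE)
        note ds = dn_step[OF step(1) k]
        have sC: "step k u \<in> C" using C_step[OF u k(1,2)] k(3) by simp
        then obtain e where e: "E_rel lam C (fst (step k u), snd (step k u)) e" using step(2)[OF ds] by auto
        have "H_edge lam (fst (step k u), snd (step k u)) k u"
          using H_edge_iff[of "step k u" k u] ds(1) up_step_iff[OF step(1) k(1,2)]
            step_step[OF step(1) k(1,2)] k by simp
        then show ?thesis using E_rel.step[OF e u] by blast
      next
        case False
        have "\<not> (\<exists>u'\<in>C. \<exists>i. H_edge lam u' i u)"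
        proof
          assume "\<exists>u'\<in>C. \<exists>i. H_edge lam u' i u"
          then obtain u' i where "H_edge lam u' i u" by blast
          then have h: "valid u'" "1 \<le> i" "i < N" "up i u'" "u = step i u'"
            using H_edge_iff[of u' i u] by simp_all
          then have "dn i u" using up_step_iff[OF h(1-3)] by simp
          then show False using False h by blast
        qed
        then show ?thesis using E_rel.source[OF u] by blast
      qed
    qed
  qed
  moreover assume "u \<in> C"
  ultimately show ?thesis using C_valid by simp
qed

abbreviation E :: "vertex \<Rightarrow> qalpha" where "E \<equiv> E_coeff lam C"

lemma E_eq:
  assumes s: "is_source s" and "u \<in> C"
  shows "E u = inv_prod u / inv_prod s"
proof -
  obtain e where e: "E_rel lam C u e" using E_rel_exists[OF assms(2)] by blast
  have val: "e' = inv_prod u / inv_prod s" if "E_rel lam C u e'" for e'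
    using E_rel_source_value[OF s that] by simp
  show ?thesis unfolding E_coeff_def
    using e val by (intro the_equality) auto
qed

lemma E_nonzero: "u \<in> C \<Longrightarrow> E u \<noteq> 0"
proof -
  assume u: "u \<in> C"
  obtain s where s: "is_source s" by (rule source_exists)
  show ?thesis using E_eq[OF s u] inv_prod_nonzero by simp
qed

lemma E_step:
  assumes "u \<in> C" "1 \<le> i" "i < N" "up i u"
  shows "E (step i u) = (zl (lab u i) - zl (lab u (Suc i))) / (zl (lab u i) - zl (lab u (Suc i)) + 1) * E u"
proof -
  obtain s where s: "is_source s" by (rule source_exists)
  have "step i u \<in> C" using C_step[OF assms(1-3)] assms(4) by simp
  then show ?thesis
    using E_eq[OF s] assms(1) inv_prod_step[OF C_valid[OF assms(1)] assms(2-4)] by simp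
qed

section \<open>Symmetrization on a component\<close>

lemma Jack_up:
  assumes "valid u" "1 \<le> i" "i < N" "up i u"
  shows "Jack lam (step i u) = opS i (1 / (zl (lab u (Suc i)) - zl (lab u i))) (Jack lam u)"
proof -
  have v: "valid (step i u)" using valid_step[OF assms(1-3)] assms(4) by simp
  show ?thesis
    using Jack_dn[OF v assms(2,3)] up_step_iff[OF assms(1-3)] step_step[OF assms(1-3)] assms(4)
      lab_step_swap[OF assms(1-3)] by (simp add: cd_def)
qed

lemma Sym_sink:
  assumes "u \<in> C"
  shows "sink \<in> C \<and> (\<exists>c. c \<noteq> 0 \<and> Sym N (Jack lam sink) = smul c (Sym N (Jack lam u)))"
proof -
  have "u \<in> C \<longrightarrow> (sink \<in> C \<and> (\<exists>c. c \<noteq> 0 \<and> Sym N (Jack lam sink) = smul c (Sym N (Jack lam u))))" if "valid u" for u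
    using that
  proof (induction u rule: ascent_induct)
    case (step u)
    show ?case
    proof
      assume u: "u \<in> C"
      show "sink \<in> C \<and> (\<exists>c. c \<noteq> 0 \<and> Sym N (Jack lam sink) = smul c (Sym N (Jack lam u)))"
      proof (cases "\<exists>k. 1 \<le> k \<and> k < N \<and> up k u")
        case True
        then obtain k where k: "1 \<le> k" "k < N" "up k u" by (elim exE conjE)
        have "step k u \<in> C" using C_step[OF u k(1,2)] k(3) by simp
        then obtain c where c: "sink \<in> C" "c \<noteq> 0" "Sym N (Jack lam sink) = smul c (Sym N (Jack lam (step k u)))"
          using step(2)[OF k] by blast
        let ?d = "zl (lab u (Suc k)) - zl (lab u k)"
        have "Sym N (Jack lam (step k u)) = smul (1 + 1 / ?d) (Sym N (Jack lam u))"
          unfolding Jack_up[OF step(1) k] by (rule Sym_opS[OF Jack_Mod[OF step(1)] k(1,2)])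
        then have "Sym N (Jack lam sink) = smul (c * (1 + 1 / ?d)) (Sym N (Jack lam u))" using c by simp
        \<comment> \<open>It equals (d + 1)/d, and d is not -1 along an edge.\<close>
        moreover have "1 + 1 / ?d \<noteq> 0"
        proof -
          have "1 + 1 / ?d = (?d - (-1)) / ?d" using prec_zl(1)[OF k(3)] by (simp add: add_divide_distrib)
          then show ?thesis using prec_zl[OF k(3)] by (metis divide_eq_0_iff right_minus_eq)
        qed
        ultimately show ?thesis using c by (metis mult_eq_0_iff)
      next
        case False
        have "\<not> up k u" if "1 \<le> k" "k < N" for k using False that by simp
        then have eq: "u = sink" by (rule sink_unique[OF u])
        show ?thesis using u unfolding eq by (intro conjI exI[of _ 1]) simp_all
      qed
    qed
  qed
  then show ?thesis using assms C_valid[OF assms] by blast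
qed

lemma sink_in_C: "sink \<in> C"
  using Sym_sink C_nonempty by auto

lemma adjacent_zl:
  assumes "adjacent x y"
  shows "zl y - zl x = of_int (snd y - snd x)"
  using assms zl_diff_eq_of_int_iff[of y x "snd y - snd x"] by (simp add: adjacent_def)

text \<open>A difference of -1 would place two equal values of T one above the other in a column,
  which 1-compatibility forbids. The row case remains, in which s_i fixes the polynomial.\<close>

lemma adjacent_cells:
  assumes "u \<in> C" "1 \<le> i" "i < N" "adjacent (lab u i) (lab u (Suc i))" "one_compatible lam T"
  shows "snd (lab u i) - snd (lab u (Suc i)) = 1"
proof (rule ccontr)
  assume no: "\<not> ?thesis"
  note v = C_valid[OF assms(1)]
  have \<tau>: "rst (fst u)" and n: "length (snd u) = N" using v by (auto simp: valid_def)
  have e: "entry (snd u) i = entry (snd u) (Suc i)" using assms(4) by (simp add: adjacent_def lab_def)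
  let ?a = "sigma (snd u) i"
  note l = lab_Suc_equal[OF v assms(2,3) e]
  have ax: "axial ?a (fst u) = -1" using no assms(4) l(1) by (simp add: adjacent_def)
  have s: "sigma (snd u) (Suc i) = Suc ?a" using assms n e by (intro sigma_Suc) auto
  obtain r c where p: "(r, c) \<in> cells lam" "fst u (r, c) = ?a"
    using rst_cell[OF \<tau>, of ?a] l(2,3) by (metis less_imp_le surj_pair)
  obtain r' c' where q: "(r', c') \<in> cells lam" "fst u (r', c') = Suc ?a"
    using rst_cell[OF \<tau>, of "Suc ?a"] l(3) by (metis Suc_leI le_add2 plus_1_eq_Suc surj_pair Suc_eq_plus1)
  have cr: "c' = c" "r = Suc r'"
    using ax by (auto intro: axial_cases[OF \<tau> p(1) q(1) p(2) q(2)])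
  have "T (r, c) = entry (snd u) i" "T (r', c') = entry (snd u) (Suc i)"
    using T_of_C[OF assms(1)] T_of_cell[OF p(1), of u] T_of_cell[OF q(1), of u] p q s
      vplus_sigma[of i "snd u"] vplus_sigma[of "Suc i" "snd u"] n assms by auto
  moreover have "T (r', c) < T (r, c)"
    using assms(5) p q cr unfolding one_compatible_def by blast
  ultimately show False using e cr by simp
qed

text \<open>Orbits of the involution \<pi> have two elements along an edge and one elsewhere. Adding
  f u + f (\<pi> u) over all u gives twice J_T, which spares a choice of representatives, and 2 is
  invertible.\<close>

lemma Jack_T_symmetric:
  assumes oc: "one_compatible lam T" and i: "1 \<le> i" "i < N"
  shows "diag_s i (Jack_T lam C) = Jack_T lam C"
proof -
  define f where "f u = smul (E u) (Jack lam u)" for u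
  define \<pi> where "\<pi> u = (if up i u \<or> dn i u then step i u else u)" for u
  have \<pi>C: "\<pi> u \<in> C" if "u \<in> C" for u using that C_step[OF that i] by (simp add: \<pi>_def)
  have \<pi>\<pi>: "\<pi> (\<pi> u) = u" if "u \<in> C" for u
  proof (cases "up i u \<or> dn i u")
    case True
    then have "\<pi> u = step i u" "up i (step i u) \<or> dn i (step i u)"
      using up_step_iff[OF C_valid[OF that] i] by (auto simp: \<pi>_def)
    then show ?thesis using step_step[OF C_valid[OF that] i True] by (simp add: \<pi>_def)
  qed (simp add: \<pi>_def)
  have pair: "diag_s i (f u + f (step i u)) = f u + f (step i u)" if u: "u \<in> C" "up i u" for u
  proof -
    let ?d = "zl (lab u (Suc i)) - zl (lab u i)"
    have d: "?d \<noteq> 0" "?d - 1 \<noteq> 0" using prec_zl[OF u(2)] by auto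
    \<comment> \<open>The ratio of the coefficients along the edge. It solves 1 + g/d = g, so J and
      J s_i enter the pair with the same coefficient.\<close>
    define g where "g = ?d / (?d - 1)"
    have "(zl (lab u i) - zl (lab u (Suc i))) / (zl (lab u i) - zl (lab u (Suc i)) + 1) = (- ?d) / (- (?d - 1))"
      by (simp add: algebra_simps)
    also have "\<dots> = g" unfolding g_def by (simp only: minus_divide_divide)
    finally have Ew: "E (step i u) = g * E u" using E_step[OF u(1) i u(2)] by simp
    have g1: "1 + g * (1 / ?d) = g" using d by (simp add: g_def field_simps)
    let ?J = "Jack lam u"
    have "f u + f (step i u) = smul (E u * (1 + g * (1 / ?d))) ?J + smul (E u * g) (diag_s i ?J)"
      unfolding f_def Ew Jack_up[OF C_valid[OF u(1)] i u(2)] opS_def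
      by (simp add: smul.scale_right_distrib smul.scale_left_distrib algebra_simps)
    also have "\<dots> = smul (E u * g) (?J + diag_s i ?J)" unfolding g1 by (simp add: smul.scale_right_distrib)
    finally show ?thesis by (simp add: diag_s_smul diag_s_add add.commute)
  qed
  have inv: "diag_s i (f u + f (\<pi> u)) = f u + f (\<pi> u)" if u: "u \<in> C" for u
  proof -
    note v = C_valid[OF u]
    consider "up i u" | "dn i u" | "adjacent (lab u i) (lab u (Suc i))" "\<not> up i u" "\<not> dn i u"
      using lab_cases[OF v i] by blast
    then show ?thesis
    proof cases
      case 1
      then show ?thesis using pair[OF u] by (simp add: \<pi>_def)
    next
      case 2
      have "step i u \<in> C" using C_step[OF u i] 2 by simp
      moreover have "up i (step i u)" using up_step_iff[OF v i] 2 by simp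
      ultimately show ?thesis using pair[of "step i u"] step_step[OF v i] 2 by (simp add: \<pi>_def add.commute)
    next
      case 3
      have "zl (lab u (Suc i)) - zl (lab u i) = of_int (- 1)"
        using adjacent_zl[OF 3(1)] adjacent_cells[OF u i 3(1) oc] by (metis minus_diff_eq)
      then have "diag_s i (Jack lam u) - Jack lam u = 0"
        using Jack_adjacent[OF v i 3(1)] by (simp add: opS_def)
      then have "diag_s i (Jack lam u) = Jack lam u" by simp
      then show ?thesis using 3 by (simp add: \<pi>_def f_def diag_s_add diag_s_smul)
    qed
  qed
  let ?J = "Jack_T lam C"
  have J: "?J = (\<Sum>u\<in>C. f u)" by (simp add: Jack_T_def f_def)
  have "(\<Sum>u\<in>C. f (\<pi> u)) = (\<Sum>u\<in>C. f u)"
    by (rule sum.reindex_bij_witness[of _ \<pi> \<pi>]) (simp_all add: \<pi>C \<pi>\<pi>)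
  then have JJ: "?J + ?J = (\<Sum>u\<in>C. f u + f (\<pi> u))" by (simp add: J sum.distrib)
  have "diag_s i (?J + ?J) = ?J + ?J" unfolding JJ diag_s_sum by (rule sum.cong) (auto simp: inv)
  then have "smul 2 (diag_s i ?J) = smul 2 ?J"
    unfolding diag_s_add smul_two .
  then show ?thesis using qalpha_two_nonzero by simp
qed

section \<open>Vanishing and nonvanishing of the symmetrizations\<close>

lemma diag_word_rev: "diag_word (rev ws) (diag_word ws P) = P"
  by (induction ws arbitrary: P) (auto simp: diag_word_def)

lemma Jack_T_nonzero: "Jack_T lam C \<noteq> 0"
proof
  assume z: "Jack_T lam C = 0"
  define l where "l = lambda_T lam T"
  have lC: "(std lam T, l) \<in> C" using sink_in_C by (simp add: l_def)
  have n: "length l = N" and rs: "rst (std lam T)" using C_valid[OF lC] by (auto simp: valid_def)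
  have so: "sorted (rev l)" by (simp add: l_def lambda_T_def)
  obtain ws where ws: "\<And>\<tau>. rst \<tau> \<Longrightarrow> cp (mon l) (Jack lam (\<tau>, l)) = diag_word ws (single \<tau> 1)"
    using Jack_leading[OF n] by blast
  \<comment> \<open>The coefficient of the leading monomial in J_T before the common operator
    \<open>diag_word ws\<close> is applied.\<close>
  define X where "X = (\<Sum>u\<in>C. if snd u = l then smul (E u) (single (fst u) 1) else 0)"
  have each: "cp (mon l) (smul (E u) (Jack lam u)) = diag_word ws (if snd u = l then smul (E u) (single (fst u) 1) else 0)"
    if u: "u \<in> C" for u
  proof (cases "snd u = l")
    case True
    have "rst (fst u)" using C_valid[OF u] by (simp add: valid_def)
    then have "cp (mon l) (Jack lam u) = diag_word ws (single (fst u) 1)"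
      using ws[of "fst u"] True by (metis prod.collapse)
    then show ?thesis using True by (simp add: cp_smul diag_word_smul)
  next
    case False
    have "mset l = mset (snd u)" using mset_C[OF lC] mset_C[OF u] by simp
    then have "cp (mon l) (Jack lam (fst u, snd u)) = 0"
      using C_valid[OF u] False n so by (intro Jack_leading_dominant) auto
    then show ?thesis using False by (simp add: cp_smul)
  qed
  have "cp (mon l) (Jack_T lam C) = diag_word ws X"
    unfolding Jack_T_def X_def cp_sum diag_word_sum by (rule sum.cong) (auto simp: each)
  then have "diag_word ws X = 0" using z by simp
  then have X0: "X = 0" using diag_word_rev[of ws X] by simp
  \<comment> \<open>Among the terms of X only the sink carries the tableau \<open>std lam T\<close>,
    so nothing can cancel its coefficient.\<close>
  have "lookup X (std lam T) = (\<Sum>u\<in>C. if u = (std lam T, l) then pconst (E (std lam T, l)) else 0)"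
    unfolding X_def lookup_sum by (rule sum.cong) (auto simp: lookup_single when_def)
  also have "\<dots> = pconst (E (std lam T, l))" using finite_C lC by (simp add: sum.delta)
  finally have "pconst (E (std lam T, l)) = 0" using X0 by simp
  then have "lookup (pconst (E (std lam T, l))) 0 = 0" by simp
  then show False using E_nonzero[OF lC] by (simp add: pconst_def)
qed

lemma Sym_sink_zero:
  assumes "\<not> one_compatible lam T"
  shows "Sym N (Jack lam sink) = 0"
proof -
  obtain s where src: "is_source s" by (rule source_exists)
  note ss = is_source_order[OF src]
  note v = C_valid[OF ss(1)] and Ts = T_of_C[OF ss(1)]
  have \<tau>: "rst (fst s)" using v by (simp add: valid_def)
  obtain r r' c where rc: "(r, c) \<in> cells lam" "(r', c) \<in> cells lam" "r < r'" "\<not> T (r, c) < T (r', c)"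
    using assms unfolding one_compatible_def by blast
  \<comment> \<open>T grows weakly up a column, so a failure between rows r and r' already makes T
    equal in rows r and r+1; neighbouring cells are taken so that the distance is -1.\<close>
  have m: "(Suc r, c) \<in> cells lam" by (rule cells_down_closed[OF rc(2)]) (use rc in \<open>auto simp: cells_def\<close>)
  let ?p = "(Suc r, c)" and ?q = "(r, c)"
  have mono: "T x \<le> T y" if "x \<in> cells lam" "y \<in> cells lam" "fst s y < fst s x" for x y
    using T_of_mono[OF v that] Ts by simp
  have lt: "fst s ?p < fst s ?q" using rst_col[OF \<tau> rc(1) m] by simp
  have "T ?p \<le> T (r', c)"
  proof (cases "Suc r = r'")
    case False
    then show ?thesis using mono[OF m rc(2)] rst_col[OF \<tau> m rc(2)] rc(3) by simp
  qed simp
  then have Teq: "T ?p = T ?q" using mono[OF rc(1) m lt] rc(4) by simp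
  \<comment> \<open>A cell numbered strictly between the two would lie between (r, c) and (r+1, c)
    in \<open>col_order\<close> with the same value of T, and there is none.\<close>
  have suc: "fst s ?q = Suc (fst s ?p)"
  proof (rule ccontr)
    assume ne: "fst s ?q \<noteq> Suc (fst s ?p)"
    have b: "1 \<le> Suc (fst s ?p)" "Suc (fst s ?p) \<le> N"
      using lt rst_range[OF \<tau> rc(1)] by auto
    obtain x where x: "x \<in> cells lam" "fst s x = Suc (fst s ?p)" using rst_cell[OF \<tau> b] by blast
    have "col_order T ?q x" "col_order T x ?p"
      using ss(3)[OF rc(1) x(1)] ss(3)[OF x(1) m] x(2) lt ne by auto
    then show False using Teq unfolding col_order_def fst_conv snd_conv by linarith
  qed
  obtain k where k: "1 \<le> k" "k < N" "sigma (snd s) k = fst s ?p" "entry (snd s) k = entry (snd s) (Suc k)"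
    using block_position[OF v _ m rc(1) suc] ss(2) Teq Ts by auto
  have "axial (fst s ?p) (fst s) = -1"
    using CT_rst[OF \<tau> m] CT_rst[OF \<tau> rc(1)] suc by (simp add: axial_def)
  then have diff: "snd (lab s k) - snd (lab s (Suc k)) = -1"
    using lab_Suc_equal(1)[OF v k(1,2,4)] k(3) by simp
  then have adj: "adjacent (lab s k) (lab s (Suc k))" using k(4) by (simp add: adjacent_def lab_def)
  have "snd (lab s (Suc k)) - snd (lab s k) = 1" using diff by linarith
  then have "zl (lab s (Suc k)) - zl (lab s k) = 1" using adjacent_zl[OF adj] by (simp only: of_int_1)
  \<comment> \<open>The operator is s_k + 1, so symmetrizing this equation yields twice the
    symmetrization at the source.\<close>
  then have "opS k 1 (Jack lam s) = 0" using Jack_adjacent[OF v k(1,2) adj] by simp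
  then have "smul 2 (Sym N (Jack lam s)) = 0"
    using Sym_opS[OF Jack_Mod[OF v] k(1,2), of 1] by simp
  then have "Sym N (Jack lam s) = 0" using qalpha_two_nonzero by simp
  then show ?thesis using Sym_sink[OF ss(1)] by auto
qed

text \<open>Were it 0, all symmetrizations on the component would vanish, and with them that of J_T.
  But symmetrizing the invariant J_T multiplies it by the number of permutations, which is nonzero
  in characteristic 0.\<close>

lemma Sym_sink_nonzero:
  assumes "one_compatible lam T"
  shows "Sym N (Jack lam sink) \<noteq> 0"
proof
  assume z: "Sym N (Jack lam sink) = 0"
  have "Sym N (Jack lam u) = 0" if "u \<in> C" for u
    using Sym_sink[OF that] z by (auto simp: smul.scale_eq_0_iff)
  then have "Sym N (Jack_T lam C) = 0" by (simp add: Jack_T_def Sym_sum Sym_smul)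
  moreover have "Sym N (Jack_T lam C) = smul (of_nat (card {w. w permutes {1..N}})) (Jack_T lam C)"
    by (rule Sym_invariant) (rule Jack_T_symmetric[OF assms])
  moreover have "card {w. w permutes {1..N}} \<noteq> 0"
    using finite_permutations[of "{1..N}"] permutes_id[of "{1..N}"] by (auto simp del: permutes_id)
  ultimately show False using Jack_T_nonzero of_nat_qalpha_eq_0_iff smul.scale_eq_0_iff by metis
qed

lemma Sym_multiple:
  assumes "u \<in> C"
  shows "\<exists>c. Sym N (Jack lam u) = smul c (Sym N (Jack lam sink))"
proof -
  obtain c where "c \<noteq> 0" "Sym N (Jack lam sink) = smul c (Sym N (Jack lam u))"
    using Sym_sink[OF assms] by blast
  then have "Sym N (Jack lam u) = smul (1 / c) (Sym N (Jack lam sink))" by simp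
  then show ?thesis ..
qed

end

theorem theorem5p9:
  fixes lam :: "nat list" and N :: nat and HT :: "vertex set" and T :: tab
  assumes "partition_of lam N"
    and "HT \<in> H_components lam"
    and "T_of lam ` HT = {T}"
  shows "(\<forall>u\<in>HT. \<exists>c. Sym N (Jack lam u) = smul c (Sym N (Jack lam (std lam T, lambda_T lam T))))
    \<and> (Sym N (Jack lam (std lam T, lambda_T lam T)) \<noteq> 0 \<longleftrightarrow> one_compatible lam T)
    \<and> (one_compatible lam T \<longrightarrow> (\<forall>i. 1 \<le> i \<and> i < N \<longrightarrow> diag_s i (Jack_T lam HT) = Jack_T lam HT))"
proof -
  interpret component lam N HT T
    using assms by unfold_locales
  show ?thesis
    using Sym_multiple Sym_sink_zero Sym_sink_nonzero Jack_T_symmetric by blast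
qed

end
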